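(* Let $P\in M_n(\Bbbk[[\hbar]])$ be of Cartan type, $\mathcal R=(\mathfrak h,\Pi,\Pi^\vee)$ a realization of $P$ of rank $t$, $\{H_g\}_{g\in\mathcal G}$ a $\Bbbk[[\hbar]]$-basis of $\mathfrak h$ and $\Phi=(\phi_{gk})_{g,k\in\mathcal G}\in\mathfrak{so}_t(\Bbbk[[\hbar]])$ an antisymmetric matrix. Let $P_\Phi$, $\mathcal R_\Phi$ be the twist deformations of $P$, $\mathcal R$ by $\Phi$, and let $\mathcal F_\Phi$ be the toral twist of $U^{\mathcal R}_{P,\hbar}(\mathfrak g)$ associated with $\Phi$. Then there exists an isomorphism of topological Hopf algebras $$f^\Phi_P:\;U^{\mathcal R_\Phi}_{P_\Phi,\hbar}(\mathfrak g)\;\xrightarrow{\ \cong\ }\;\big(U^{\mathcal R}_{P,\hbar}(\mathfrak g)\big)^{\mathcal F_\Phi}$$ given by $E_i\mapsto E_i^\Phi:=\mathcal L_{\Phi,i}^{-1}E_i$, $T\mapsto T$, $F_i\mapsto F_i^\Phi:=F_i\,\mathcal K_{\Phi,i}$ for all $i\in I$, $T\in\mathfrak h$. In particular, the class of all FoMpQUEAs of any fixed Cartan type and of fixed rank is stable by toral twist deformations. Moreover, inside it the subclass of all such FoMpQUEAs associated with straight, resp. small, realizations is stable as well. Similar, parallel statements hold true for the Borel FoMpQUEAs, namely there exist isomorphisms $f^\Phi_{P,\pm}:U^{\mathcal R_\Phi}_{P_\Phi,\hbar}(\mathfrak b_\pm)\xrightarrow{\cong}\big(U^{\mathcal R}_{P,\hbar}(\mathfrak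 b_\pm)\big)^{\mathcal F_\Phi}$ given by the same formulas.
   Context: $\Bbbk$ is a field of characteristic zero, $n\ge1$, $I=\{1,\dots,n\}$. $A=(a_{ij})$ is a symmetrizable generalized Cartan matrix, $D=\mathrm{diag}(d_i)$ the unique diagonal matrix with coprime positive integer entries such that $DA$ is symmetric. $P=(p_{ij})\in M_n(\Bbbk[[\hbar]])$ is of Cartan type with Cartan matrix $A$ if $P+P^T=2DA$. Realization of $P$: a triple $\mathcal R=(\mathfrak h,\Pi,\Pi^\vee)$, $\mathfrak h$ a free $\Bbbk[[\hbar]]$-module of finite rank (the rank of $\mathcal R$), $\Pi^\vee=\{T_i^\pm\}_{i\in I}\subseteq\mathfrak h$, $\Pi=\{\alpha_i\}_{i\in I}\subseteq\mathfrak h^*$, with $\alpha_j(T_i^+)=p_{ij}$, $\alpha_j(T_i^-)=p_{ji}$, and the classes of $S_i=\frac12(T_i^++T_i^-)$ in $\mathfrak h/\hbar\mathfrak h$ linearly independent over $\Bbbk$. It is straight if the classes of the $\alpha_i$ in $\mathfrak h^*/\hbar\mathfrak h^*$ are linearly independent over $\Bbbk$; it is small if $\mathrm{Span}_{\Bbbk[[\hbar]]}\{S_i\}_{i\in I}=\mathrm{Span}_{\Bbbk[[\hbar]]}\{T_i^+,T_i^-\}_{i\in I}$. FoMpQUEA (formal multiparameter quantum universal enveloping algebra): $U^{\mathcal R}_{P,\hbar}(\mathfrak g)$ is the unital associative $\hbar$-adically complete topological $\Bbbk[[\hbar]]$-algebra generated by the module $\mathfrak h$ and $E_i,F_i$ ($i\in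 I$), with relations $TE_j-E_jT=\alpha_j(T)E_j$, $TF_j-F_jT=-\alpha_j(T)F_j$, $T'T''=T''T'$, $E_iF_j-F_jE_i=\delta_{ij}\frac{e^{\hbar T_i^+}-e^{-\hbar T_i^-}}{q_i-q_i^{-1}}$ and, for $i\ne j$, $\sum_{k=0}^{1-a_{ij}}(-1)^k\left[{1-a_{ij}\atop k}\right]_{q_i}q_{ij}^{k/2}q_{ji}^{-k/2}E_i^{1-a_{ij}-k}E_jE_i^k=0=\sum_{k=0}^{1-a_{ij}}(-1)^k\left[{1-a_{ij}\atop k}\right]_{q_i}q_{ij}^{k/2}q_{ji}^{-k/2}F_i^kF_jF_i^{1-a_{ij}-k}$, where $q_i=e^{\hbar d_i}$, $q_{ij}^{\pm1/2}=e^{\pm\hbar p_{ij}/2}$, $[r]_q=(q^r-q^{-r})/(q-q^{-1})$. It is a topological Hopf algebra with $\Delta(E_i)=E_i\otimes1+e^{\hbar T_i^+}\otimes E_i$, $\Delta(T)=T\otimes1+1\otimes T$, $\Delta(F_i)=F_i\otimes e^{-\hbar T_i^-}+1\otimes F_i$, $\epsilon(E_i)=\epsilon(T)=\epsilon(F_i)=0$. Its Borel subalgebra $U^{\mathcal R}_{P,\hbar}(\mathfrak b_+)$ (resp. $U^{\mathcal R}_{P,\hbar}(\mathfrak b_-)$) is the complete subalgebra generated by $\mathfrak h$ and the $E_i$'s (resp. the $F_i$'s); both are Hopf subalgebras. The rank of a FoMpQUEA is the rank of $\mathcal R$; it is called straight, small, etc., if $\mathcal R$ is. Twist deformation of $(P,\mathcal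 R)$: $T^\pm_{\Phi,\ell}=T^\pm_\ell\pm\sum_{g,k}\alpha_\ell(H_g)\phi_{kg}H_k$; $\mathcal R_\Phi=(\mathfrak h,\Pi,\{T^\pm_{\Phi,i}\}_{i\in I})$ is a realization of $P_\Phi:=P-\mathfrak A\Phi\mathfrak A^T$, where $\mathfrak A=(\alpha_\ell(H_g))_{\ell\in I,\,g\in\mathcal G}$; $P_\Phi$ is of Cartan type with the same Cartan matrix. Toral twist: $\mathcal F_\Phi=\exp\!\big(\tfrac{\hbar}{2}\sum_{g,k}\phi_{gk}H_g\otimes H_k\big)\in U^{\mathcal R}_{P,\hbar}(\mathfrak g)^{\widehat\otimes2}$. For a twist $\mathcal F$ of a Hopf algebra $H$, $H^{\mathcal F}$ is $H$ with the same product, unit, counit and coproduct $\Delta^{\mathcal F}(x)=\mathcal F\Delta(x)\mathcal F^{-1}$ (and corresponding antipode). Further, $\mathcal L_{\Phi,\ell}=\exp\!\big(\frac\hbar2\sum_{g,k}\alpha_\ell(H_g)\phi_{gk}H_k\big)$, $\mathcal K_{\Phi,\ell}=\exp\!\big(\frac\hbar2\sum_{g,k}\alpha_\ell(H_g)\phi_{kg}H_k\big)$.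
   Formalization: Stability of the small subclass is stated only when all Σ_{g,k} α_ℓ(H_g)φ_{kg}H_k lie in Span{S_i} (i.e. R_Φ is small); as printed it fails, e.g. n=1, P=(2), basis H_1,H_2, T^±=H_1, α(H_1)=2, α(H_2)=0, φ_12 a nonzero constant. *)

theory Defs
  imports
    "HOL-Analysis.Cartesian_Space"
    "HOL-Analysis.Elementary_Topology"
    "HOL-Analysis.Abstract_Topology"
    "HOL-Computational_Algebra.Formal_Power_Series"
    "HOL-Library.Poly_Mapping"
    "HOL-Library.Product_Plus"
    "HOL-Algebra.QuotRing"
    "HOL-Algebra.Module"
begin

text \<open>The ground ring is \<^typ>\<open>'k fps\<close> for a field \<open>'k\<close> of characteristic zero; the formal
  parameter \<open>\<hbar>\<close> is \<^const>\<open>fps_X\<close>. The index set \<open>I\<close> is a finite type \<open>'i\<close>, and the index set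
  of a basis of \<open>\<hh>\<close> is a finite type \<open>'g\<close>. The prefix \<open>Modules\<close> selects the library's modules
  on a whole type, as opposed to the records with explicit carriers of HOL-Algebra.\<close>


section \<open>Cartan data and multiparameter matrices\<close>

text \<open>The minimal symmetrizer is unique only when \<open>A\<close> is indecomposable, hence it is a parameter:
  every diagonal matrix with coprime positive entries that symmetrizes \<open>A\<close> is allowed.\<close>

definition symmetrizable_gcm :: "int^'i::finite^'i \<Rightarrow> ('i \<Rightarrow> nat) \<Rightarrow> bool" where
  "symmetrizable_gcm A d \<longleftrightarrow>
     (\<forall>i. A $ i $ i = 2) \<and>
     (\<forall>i j. i \<noteq> j \<longrightarrow> A $ i $ j \<le> 0) \<and>
     (\<forall>i j. A $ i $ j = 0 \<longleftrightarrow> A $ j $ i = 0) \<and>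
     (\<forall>i. d i > 0) \<and> Gcd (range d) = 1 \<and>
     (\<forall>i j. int (d i) * A $ i $ j = int (d j) * A $ j $ i)"

definition cartan_type ::
    "int^'i::finite^'i \<Rightarrow> ('i \<Rightarrow> nat) \<Rightarrow> ('k::field_char_0) fps^'i^'i \<Rightarrow> bool" where
  "cartan_type A d P \<longleftrightarrow>
     P + transpose P = (\<chi> i j. 2 * of_nat (d i) * of_int (A $ i $ j))"


section \<open>Realizations\<close>

text \<open>The type \<open>'h\<close> with the scalar multiplication \<open>hscale\<close> is the module \<open>\<hh>\<close>; \<open>root\<close> is the
  family \<open>\<alpha>\<close>, and \<open>Tplus\<close>, \<open>Tminus\<close> are the families \<open>T\<^sup>+\<close>, \<open>T\<^sup>-\<close>.\<close>

record ('k, 'h, 'i) realization =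
  hscale :: "'k fps \<Rightarrow> 'h \<Rightarrow> 'h"
  root   :: "'i \<Rightarrow> 'h \<Rightarrow> 'k fps"
  Tplus  :: "'i \<Rightarrow> 'h"
  Tminus :: "'i \<Rightarrow> 'h"

definition Tmean ::
    "('k::field_char_0, 'h::ab_group_add, 'i) realization \<Rightarrow> 'i \<Rightarrow> 'h" where
  "Tmean R i = hscale R (fps_const (1/2)) (Tplus R i + Tminus R i)"

definition has_rank ::
    "('k::field_char_0, 'h::ab_group_add, 'i) realization \<Rightarrow> nat \<Rightarrow> bool" where
  "has_rank R t \<longleftrightarrow>
     (\<exists>B. finite B \<and> card B = t \<and> \<not> Modules.module.dependent (hscale R) B \<and>
          Modules.module.span (hscale R) B = UNIV)"

definition is_basis ::
    "('k::field_char_0, 'h::ab_group_add, 'i) realization \<Rightarrow> ('g \<Rightarrow> 'h) \<Rightarrow> bool" where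
  "is_basis R H \<longleftrightarrow>
     inj H \<and> \<not> Modules.module.dependent (hscale R) (range H) \<and>
     Modules.module.span (hscale R) (range H) = UNIV"

text \<open>The last clause says that the classes of the \<open>S\<^sub>i\<close> in \<open>\<hh>/\<hbar>\<hh>\<close> are linearly independent
  over \<open>'k\<close>.\<close>

definition is_realization ::
    "('k::field_char_0) fps^'i::finite^'i \<Rightarrow> ('k, 'h::ab_group_add, 'i) realization \<Rightarrow> bool" where
  "is_realization P R \<longleftrightarrow>
     Modules.module (hscale R) \<and> (\<exists>t. has_rank R t) \<and>
     (\<forall>i. Modules.module_hom (hscale R) (*) (root R i)) \<and>
     (\<forall>i j. root R j (Tplus R i) = P $ i $ j) \<and>
     (\<forall>i j. root R j (Tminus R i) = P $ j $ i) \<and>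
     (\<forall>c :: 'i \<Rightarrow> 'k.
        (\<Sum>i\<in>UNIV. hscale R (fps_const (c i)) (Tmean R i)) \<in> range (hscale R fps_X) \<longrightarrow>
        (\<forall>i. c i = 0))"

text \<open>Linear independence over \<open>'k\<close> of the classes of the \<open>\<alpha>\<^sub>i\<close> in \<open>\<hh>\<^sup>*/\<hbar>\<hh>\<^sup>*\<close>.\<close>

definition straight ::
    "('k::field_char_0, 'h::ab_group_add, 'i::finite) realization \<Rightarrow> bool" where
  "straight R \<longleftrightarrow>
     (\<forall>c :: 'i \<Rightarrow> 'k.
        (\<exists>\<beta>. Modules.module_hom (hscale R) (*) \<beta> \<and>
             (\<forall>T. (\<Sum>i\<in>UNIV. fps_const (c i) * root R i T) = fps_X * \<beta> T)) \<longrightarrow>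
        (\<forall>i. c i = 0))"

definition small ::
    "('k::field_char_0, 'h::ab_group_add, 'i) realization \<Rightarrow> bool" where
  "small R \<longleftrightarrow>
     Modules.module.span (hscale R) (range (Tmean R)) =
     Modules.module.span (hscale R) (range (Tplus R) \<union> range (Tminus R))"


section \<open>Twist deformations of realizations\<close>

definition twist_shift ::
    "('k::field_char_0, 'h::ab_group_add, 'i) realization \<Rightarrow> ('g::finite \<Rightarrow> 'h) \<Rightarrow>
     'k fps^'g^'g \<Rightarrow> 'i \<Rightarrow> 'h" where
  "twist_shift R H \<Phi> l =
     (\<Sum>g\<in>UNIV. \<Sum>k\<in>UNIV. hscale R (root R l (H g) * \<Phi> $ k $ g) (H k))"

definition twist_realization ::
    "('k::field_char_0, 'h::ab_group_add, 'i) realization \<Rightarrow> ('g::finite \<Rightarrow> 'h) \<Rightarrow>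
     'k fps^'g^'g \<Rightarrow> ('k, 'h, 'i) realization" where
  "twist_realization R H \<Phi> = R
     \<lparr> Tplus := \<lambda>l. Tplus R l + twist_shift R H \<Phi> l,
       Tminus := \<lambda>l. Tminus R l - twist_shift R H \<Phi> l \<rparr>"

definition root_matrix ::
    "('k::field_char_0, 'h::ab_group_add, 'i::finite) realization \<Rightarrow> ('g::finite \<Rightarrow> 'h) \<Rightarrow>
     'k fps^'g^'i" where
  "root_matrix R H = (\<chi> l g. root R l (H g))"

definition twist_matrix ::
    "('k::field_char_0) fps^'i::finite^'i \<Rightarrow> ('k, 'h::ab_group_add, 'i) realization \<Rightarrow>
     ('g::finite \<Rightarrow> 'h) \<Rightarrow> 'k fps^'g^'g \<Rightarrow> 'k fps^'i^'i" where
  "twist_matrix P R H \<Phi> = P - root_matrix R H ** \<Phi> ** transpose (root_matrix R H)"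


text \<open>Smallness is not inherited by all twist deformations, only by those below.\<close>

lemma small_twist_realization_iff:
  fixes R :: "('k::field_char_0, 'h::ab_group_add, 'i) realization"
  assumes "Modules.module (hscale R)" and "small R"
  shows "small (twist_realization R H \<Phi>) \<longleftrightarrow>
    (\<forall>l. twist_shift R H \<Phi> l \<in> Modules.module.span (hscale R) (range (Tmean R)))"
    (is "_ \<longleftrightarrow> (\<forall>l. ?h l \<in> ?V)")
proof -
  interpret m: Modules.module "hscale R" by fact
  let ?R = "twist_realization R H \<Phi>"
  have T': "Tplus ?R l = Tplus R l + ?h l" "Tminus ?R l = Tminus R l - ?h l"
    "hscale ?R = hscale R" for l
    by (simp_all add: twist_realization_def)
  have S': "Tmean ?R = Tmean R"
    by (simp add: fun_eq_iff Tmean_def T')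
  have V: "?V = m.span (range (Tplus R) \<union> range (Tminus R))"
    using assms(2) by (simp add: small_def)
  have inV: "Tplus R l \<in> ?V" "Tminus R l \<in> ?V" for l
    unfolding V by (auto intro: m.span_base)
  show ?thesis
  proof
    assume "small ?R"
    then have "Tplus ?R l \<in> ?V" for l
      by (simp add: small_def S' T'(3)) (auto intro: m.span_base)
    then have "Tplus ?R l - Tplus R l \<in> ?V" for l
      by (intro m.span_diff inV(1))
    then show "\<forall>l. ?h l \<in> ?V"
      by (simp add: T')
  next
    assume h: "\<forall>l. ?h l \<in> ?V"
    have "m.span (range (Tplus ?R) \<union> range (Tminus ?R)) \<subseteq> ?V"
      by (intro m.span_minimal m.subspace_span)
        (auto simp: T' h inV intro: m.span_add m.span_diff)
    moreover have "Tmean ?R i \<in> m.span (range (Tplus ?R) \<union> range (Tminus ?R))" for i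
      unfolding Tmean_def T'(3) by (intro m.span_scale m.span_add m.span_base) auto
    then have "?V \<subseteq> m.span (range (Tplus ?R) \<union> range (Tminus ?R))"
      by (intro m.span_minimal m.subspace_span) (auto simp: S')
    ultimately show "small ?R"
      by (simp add: small_def S' T'(3))
  qed
qed


section \<open>Complete topological algebras and Hopf algebras over \<open>'k fps\<close>\<close>

text \<open>The \<open>\<hbar>\<close>-adic topology. Quantifying over all \<open>m \<ge> n\<close> makes this a topology for every
  record \<open>M\<close>; in a module it amounts to \<open>x + \<hbar>\<^sup>n M \<subseteq> U\<close>.\<close>

definition hadic_open :: "('k::field_char_0 fps, 'a, 'z) module_scheme \<Rightarrow> 'a set \<Rightarrow> bool" where
  "hadic_open M U \<longleftrightarrow> U \<subseteq> carrier M \<and>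
     (\<forall>x\<in>U. \<exists>n. \<forall>m\<ge>n. \<forall>y\<in>carrier M.
        x \<oplus>\<^bsub>M\<^esub> (fps_X ^ m \<odot>\<^bsub>M\<^esub> y) \<in> U)"

definition hadic :: "('k::field_char_0 fps, 'a, 'z) module_scheme \<Rightarrow> 'a topology" where
  "hadic M = topology (hadic_open M)"

lemma istopology_hadic_open: "istopology (hadic_open M)"
  unfolding istopology_def
proof (intro conjI allI impI)
  fix S T assume S: "hadic_open M S" and T: "hadic_open M T"
  show "hadic_open M (S \<inter> T)"
    unfolding hadic_open_def
  proof (intro conjI ballI)
    show "S \<inter> T \<subseteq> carrier M" using S unfolding hadic_open_def by blast
  next
    fix x assume x: "x \<in> S \<inter> T"
    obtain n where n: "\<forall>m\<ge>n. \<forall>y\<in>carrier M.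
        x \<oplus>\<^bsub>M\<^esub> (fps_X ^ m \<odot>\<^bsub>M\<^esub> y) \<in> S"
      using S x unfolding hadic_open_def by blast
    obtain n' where n': "\<forall>m\<ge>n'. \<forall>y\<in>carrier M.
        x \<oplus>\<^bsub>M\<^esub> (fps_X ^ m \<odot>\<^bsub>M\<^esub> y) \<in> T"
      using T x unfolding hadic_open_def by blast
    show "\<exists>n. \<forall>m\<ge>n. \<forall>y\<in>carrier M.
        x \<oplus>\<^bsub>M\<^esub> (fps_X ^ m \<odot>\<^bsub>M\<^esub> y) \<in> S \<inter> T"
      using n n' by (intro exI[of _ "max n n'"]) auto
  qed
next
  fix K assume K: "\<forall>S\<in>K. hadic_open M S"
  show "hadic_open M (\<Union>K)"
    unfolding hadic_open_def
  proof (intro conjI ballI)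
    show "\<Union>K \<subseteq> carrier M" using K unfolding hadic_open_def by blast
  next
    fix x assume "x \<in> \<Union>K"
    then obtain S where S: "S \<in> K" "x \<in> S" by blast
    then obtain n where "\<forall>m\<ge>n. \<forall>y\<in>carrier M.
        x \<oplus>\<^bsub>M\<^esub> (fps_X ^ m \<odot>\<^bsub>M\<^esub> y) \<in> S"
      using K unfolding hadic_open_def by blast
    with S(1) show "\<exists>n. \<forall>m\<ge>n. \<forall>y\<in>carrier M.
        x \<oplus>\<^bsub>M\<^esub> (fps_X ^ m \<odot>\<^bsub>M\<^esub> y) \<in> \<Union>K"
      by blast
  qed
qed

lemma openin_hadic: "openin (hadic M) U \<longleftrightarrow> hadic_open M U"
  by (simp add: hadic_def topology_inverse' istopology_hadic_open)

definition top_linear ::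
    "('k::field_char_0 fps, 'a, 'y) module_scheme \<Rightarrow> ('k fps, 'b, 'z) module_scheme \<Rightarrow>
     ('a \<Rightarrow> 'b) \<Rightarrow> bool" where
  "top_linear M N f \<longleftrightarrow>
     f \<in> carrier M \<rightarrow> carrier N \<and>
     (\<forall>x\<in>carrier M. \<forall>y\<in>carrier M. f (x \<oplus>\<^bsub>M\<^esub> y) = f x \<oplus>\<^bsub>N\<^esub> f y) \<and>
     (\<forall>c. \<forall>x\<in>carrier M. f (c \<odot>\<^bsub>M\<^esub> x) = c \<odot>\<^bsub>N\<^esub> f x) \<and>
     continuous_map (hadic M) (hadic N) f"

definition top_alg_iso ::
    "('k::field_char_0 fps, 'a, 'y) module_scheme \<Rightarrow> ('k fps, 'b, 'z) module_scheme \<Rightarrow>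
     ('a \<Rightarrow> 'b) \<Rightarrow> bool" where
  "top_alg_iso M N f \<longleftrightarrow>
     f \<in> ring_iso M N \<and>
     (\<forall>c. \<forall>x\<in>carrier M. f (c \<odot>\<^bsub>M\<^esub> x) = c \<odot>\<^bsub>N\<^esub> f x) \<and>
     homeomorphic_map (hadic M) (hadic N) f"

definition complete_subalgebra_gen ::
    "('k::field_char_0 fps, 'a, 'z) module_scheme \<Rightarrow> 'a set \<Rightarrow> 'a set" where
  "complete_subalgebra_gen M S =
     \<Inter>{B. S \<subseteq> B \<and> B \<subseteq> carrier M \<and> \<one>\<^bsub>M\<^esub> \<in> B \<and>
         (\<forall>x\<in>B. \<forall>y\<in>B. x \<oplus>\<^bsub>M\<^esub> y \<in> B \<and> x \<otimes>\<^bsub>M\<^esub> y \<in> B) \<and>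
         (\<forall>c. \<forall>x\<in>B. c \<odot>\<^bsub>M\<^esub> x \<in> B) \<and>
         closedin (hadic M) B}"

text \<open>A topological Hopf algebra \<open>H\<close>, given by its algebra structure, its completed tensor
  square \<open>tsquare\<close> with the canonical bilinear map \<open>tens\<close>, its coproduct and its counit.
  The antipode, being determined by these data, is not a separate field.\<close>

record ('k, 'a, 't) hopf = "('k fps, 'a) module" +
  tsquare :: "('k fps, 't) module"
  tens    :: "'a \<Rightarrow> 'a \<Rightarrow> 't"
  comult  :: "'a \<Rightarrow> 't"
  counit  :: "'a \<Rightarrow> 'k fps"

text \<open>Below, \<open>\<phi>\<close> and \<open>\<psi>\<close> are multiplication composed with \<open>S \<otimes> id\<close> and \<open>id \<otimes> S\<close>,
  extended by continuity to the completed tensor square.\<close>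

definition is_antipode ::
    "('k::field_char_0, 'a, 't) hopf \<Rightarrow> ('a \<Rightarrow> 'a) \<Rightarrow> bool" where
  "is_antipode H S \<longleftrightarrow> top_linear H H S \<and>
     (\<exists>\<phi> \<psi>. top_linear (tsquare H) H \<phi> \<and> top_linear (tsquare H) H \<psi> \<and>
        (\<forall>a\<in>carrier H. \<forall>b\<in>carrier H.
           \<phi> (tens H a b) = S a \<otimes>\<^bsub>H\<^esub> b \<and> \<psi> (tens H a b) = a \<otimes>\<^bsub>H\<^esub> S b) \<and>
        (\<forall>x\<in>carrier H.
           \<phi> (comult H x) = counit H x \<odot>\<^bsub>H\<^esub> \<one>\<^bsub>H\<^esub> \<and>
           \<psi> (comult H x) = counit H x \<odot>\<^bsub>H\<^esub> \<one>\<^bsub>H\<^esub>))"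

text \<open>Below, \<open>f2\<close> is the completed tensor square of \<open>f\<close>. The last clause says that \<open>f\<close>
  carries the antipode of \<open>H\<close> to that of \<open>K\<close>.\<close>

definition top_hopf_iso ::
    "('k::field_char_0, 'a, 't) hopf \<Rightarrow> ('k, 'b, 'u) hopf \<Rightarrow> ('a \<Rightarrow> 'b) \<Rightarrow> bool" where
  "top_hopf_iso H K f \<longleftrightarrow>
     top_alg_iso H K f \<and>
     (\<exists>f2. top_alg_iso (tsquare H) (tsquare K) f2 \<and>
        (\<forall>a\<in>carrier H. \<forall>b\<in>carrier H. f2 (tens H a b) = tens K (f a) (f b)) \<and>
        (\<forall>x\<in>carrier H. f2 (comult H x) = comult K (f x))) \<and>
     (\<forall>x\<in>carrier H. counit K (f x) = counit H x) \<and>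
     (\<forall>S\<in>carrier H \<rightarrow> carrier H. \<forall>S'.
        (\<forall>x\<in>carrier H. f (S x) = S' (f x)) \<longrightarrow> (is_antipode H S \<longleftrightarrow> is_antipode K S'))"

text \<open>The complete Hopf subalgebra generated by \<open>S\<close> (when the coproduct restricts to it). Its
  completed tensor square is realized inside that of \<open>H\<close>, as the closed span of the tensors.\<close>

definition hopf_sub ::
    "('k::field_char_0, 'a, 't) hopf \<Rightarrow> 'a set \<Rightarrow> ('k, 'a, 't) hopf" where
  "hopf_sub H S = (let B = complete_subalgebra_gen H S in
     H \<lparr> carrier := B,
         tsquare := (tsquare H)
           \<lparr> carrier := complete_subalgebra_gen (tsquare H) {tens H a b | a b. a \<in> B \<and> b \<in> B} \<rparr> \<rparr>)"

text \<open>The deformation of \<open>H\<close> by a twist \<open>F\<close>; its antipode is the one determined by the new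
  coproduct.\<close>

definition twist_hopf :: "('k::field_char_0, 'a, 't) hopf \<Rightarrow> 't \<Rightarrow> ('k, 'a, 't) hopf" where
  "twist_hopf H F = H
     \<lparr> comult := \<lambda>x. F \<otimes>\<^bsub>tsquare H\<^esub> comult H x \<otimes>\<^bsub>tsquare H\<^esub> inv\<^bsub>tsquare H\<^esub> F \<rparr>"


section \<open>Completed free algebras and their quotients\<close>

text \<open>For a monoid \<open>'m\<close> written additively, \<^typ>\<open>'m \<Rightarrow>\<^sub>0 'k\<close> is the monoid algebra, and
  \<^typ>\<open>('m \<Rightarrow>\<^sub>0 'k) fps\<close> is the \<open>\<hbar>\<close>-adic completion of the monoid algebra over \<^typ>\<open>'k fps\<close>;
  the library's metric on formal power series induces the \<open>\<hbar>\<close>-adic topology. The free monoid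
  yields the completed free associative algebra, and the product of two free monoids the
  completed tensor square of the latter.\<close>

datatype 'x fmon = FMon (letters: "'x list")

instantiation fmon :: (type) monoid_add
begin
definition zero_fmon :: "'x fmon" where "zero_fmon = FMon []"
definition plus_fmon :: "'x fmon \<Rightarrow> 'x fmon \<Rightarrow> 'x fmon" where
  "plus_fmon u v = FMon (letters u @ letters v)"
instance by standard (simp_all add: zero_fmon_def plus_fmon_def)
end

definition scal :: "('k::field_char_0) fps \<Rightarrow> ('m::monoid_add \<Rightarrow>\<^sub>0 'k) fps" where
  "scal c = Abs_fps (\<lambda>n. Poly_Mapping.single 0 (fps_nth c n))"

definition gen :: "'x \<Rightarrow> ('x fmon \<Rightarrow>\<^sub>0 ('k::field_char_0)) fps" where
  "gen x = fps_const (Poly_Mapping.single (FMon [x]) 1)"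

text \<open>\<open>hexp x\<close> is \<open>exp (\<hbar> x)\<close>.\<close>

definition hexp ::
    "('m::monoid_add \<Rightarrow>\<^sub>0 ('k::field_char_0)) fps \<Rightarrow> ('m \<Rightarrow>\<^sub>0 'k) fps" where
  "hexp x = suminf (\<lambda>n. scal (fps_const (1 / fact n) * fps_X ^ n) * x ^ n)"

text \<open>The continuous linear extension of a map on monomials.\<close>

definition lin_ext ::
    "('m::monoid_add \<Rightarrow> ('n::monoid_add \<Rightarrow>\<^sub>0 ('k::field_char_0)) fps) \<Rightarrow>
     ('m \<Rightarrow>\<^sub>0 'k) fps \<Rightarrow> ('n \<Rightarrow>\<^sub>0 'k) fps" where
  "lin_ext \<psi> x = suminf (\<lambda>n. scal (fps_X ^ n) *
     (\<Sum>w\<in>Poly_Mapping.keys (fps_nth x n).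
        scal (fps_const (Poly_Mapping.lookup (fps_nth x n) w)) * \<psi> w))"

text \<open>The continuous algebra morphism with given values on the generators.\<close>

definition alg_ext ::
    "('x \<Rightarrow> ('n::monoid_add \<Rightarrow>\<^sub>0 ('k::field_char_0)) fps) \<Rightarrow>
     ('x fmon \<Rightarrow>\<^sub>0 'k) fps \<Rightarrow> ('n \<Rightarrow>\<^sub>0 'k) fps" where
  "alg_ext \<phi> = lin_ext (\<lambda>w. prod_list (map \<phi> (letters w)))"

definition ftens ::
    "('m::monoid_add \<Rightarrow>\<^sub>0 ('k::field_char_0)) fps \<Rightarrow> ('n::monoid_add \<Rightarrow>\<^sub>0 'k) fps \<Rightarrow>
     ('m \<times> 'n \<Rightarrow>\<^sub>0 'k) fps" where
  "ftens x y = Abs_fps (\<lambda>n. \<Sum>i\<le>n.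
     \<Sum>u\<in>Poly_Mapping.keys (fps_nth x i). \<Sum>v\<in>Poly_Mapping.keys (fps_nth y (n - i)).
       Poly_Mapping.single (u, v)
         (Poly_Mapping.lookup (fps_nth x i) u * Poly_Mapping.lookup (fps_nth y (n - i)) v))"

definition free_alg :: "('k fps, ('m::monoid_add \<Rightarrow>\<^sub>0 ('k::field_char_0)) fps) module" where
  "free_alg = \<lparr> carrier = UNIV, monoid.mult = (*), one = 1, ring.zero = 0, add = (+),
                smult = (\<lambda>c x. scal c * x) \<rparr>"

definition closed_ideal ::
    "('m::monoid_add \<Rightarrow>\<^sub>0 ('k::field_char_0)) fps set \<Rightarrow> ('m \<Rightarrow>\<^sub>0 'k) fps set" where
  "closed_ideal S = closure (genideal free_alg S)"

definition cls ::
    "('m::monoid_add \<Rightarrow>\<^sub>0 ('k::field_char_0)) fps set \<Rightarrow> ('m \<Rightarrow>\<^sub>0 'k) fps \<Rightarrow>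
     ('m \<Rightarrow>\<^sub>0 'k) fps set" where
  "cls J x = J +>\<^bsub>free_alg\<^esub> x"

definition quot_alg ::
    "('m::monoid_add \<Rightarrow>\<^sub>0 ('k::field_char_0)) fps set \<Rightarrow>
     ('k fps, ('m \<Rightarrow>\<^sub>0 'k) fps set) module" where
  "quot_alg J = ring.extend (free_alg Quot J)
     (module.fields (\<lambda>c C. \<Union>x\<in>C. cls J (scal c * x)))"

text \<open>The closure of \<open>J \<otimes> A + A \<otimes> J\<close> in the completed tensor square of \<open>A\<close>: the quotient by it
  is the completed tensor square of \<open>A/J\<close>.\<close>

definition tens_ideal ::
    "('m::monoid_add \<Rightarrow>\<^sub>0 ('k::field_char_0)) fps set \<Rightarrow> ('m \<times> 'm \<Rightarrow>\<^sub>0 'k) fps set" where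
  "tens_ideal J = closed_ideal {ftens x y | x y. x \<in> J \<or> y \<in> J}"


section \<open>Formal multiparameter quantum universal enveloping algebras\<close>

datatype ('h, 'i) uqgen = Tor 'h | E 'i | F 'i

type_synonym ('k, 'h, 'i) uqfree = "(('h, 'i) uqgen fmon \<Rightarrow>\<^sub>0 'k) fps"
type_synonym ('k, 'h, 'i) uqfree2 =
  "(('h, 'i) uqgen fmon \<times> ('h, 'i) uqgen fmon \<Rightarrow>\<^sub>0 'k) fps"
type_synonym ('k, 'h, 'i) uqhopf =
  "('k, ('k, 'h, 'i) uqfree set, ('k, 'h, 'i) uqfree2 set) hopf"

text \<open>\<open>qexp c\<close> is \<open>exp (\<hbar> c)\<close> for a scalar \<open>c\<close>; thus \<open>q\<^sub>i = qexp d\<^sub>i\<close> and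
  \<open>q\<^sub>i\<^sub>j\<^sup>1\<^sup>/\<^sup>2 = qexp (p\<^sub>i\<^sub>j / 2)\<close>.\<close>

definition qexp :: "('k::field_char_0) fps \<Rightarrow> 'k fps" where
  "qexp c = fps_compose (fps_exp 1) (fps_X * c)"

definition qnum :: "('k::field_char_0) fps \<Rightarrow> nat \<Rightarrow> 'k fps" where
  "qnum q r = (q ^ r - inverse q ^ r) / (q - inverse q)"

definition qbinom :: "('k::field_char_0) fps \<Rightarrow> nat \<Rightarrow> nat \<Rightarrow> 'k fps" where
  "qbinom q n k =
     (\<Prod>s=1..n. qnum q s) / ((\<Prod>s=1..k. qnum q s) * (\<Prod>s=1..n-k. qnum q s))"

definition serre_coeff ::
    "int^'i::finite^'i \<Rightarrow> ('i \<Rightarrow> nat) \<Rightarrow> ('k::field_char_0) fps^'i^'i \<Rightarrow>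
     'i \<Rightarrow> 'i \<Rightarrow> nat \<Rightarrow> 'k fps" where
  "serre_coeff A d P i j k =
     (-1) ^ k * qbinom (qexp (of_nat (d i))) (nat (1 - A $ i $ j)) k *
     qexp (fps_const (1/2) * P $ i $ j) ^ k * inverse (qexp (fps_const (1/2) * P $ j $ i)) ^ k"

text \<open>The first two families make \<open>T \<mapsto> gen (Tor T)\<close> linear. In the relation \<open>EF\<close> the element
  \<open>y\<close> is the quotient of \<open>exp (\<hbar> T\<^sub>i\<^sup>+) - exp (-\<hbar> T\<^sub>i\<^sup>-)\<close> by \<open>q\<^sub>i - q\<^sub>i\<^sup>-\<^sup>1\<close>; it exists and is
  unique because the completed free algebra has no \<open>\<hbar>\<close>-torsion and the numerator is divisible
  by \<open>\<hbar>\<close>.\<close>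

inductive_set uq_rels ::
    "int^'i::finite^'i \<Rightarrow> ('i \<Rightarrow> nat) \<Rightarrow> ('k::field_char_0) fps^'i^'i \<Rightarrow>
     ('k, 'h::ab_group_add, 'i) realization \<Rightarrow> ('k, 'h, 'i) uqfree set"
  for A d P R where
  T_add: "gen (Tor (S + T)) - (gen (Tor S) + gen (Tor T)) \<in> uq_rels A d P R"
| T_scale: "gen (Tor (hscale R c T)) - scal c * gen (Tor T) \<in> uq_rels A d P R"
| TT: "gen (Tor S) * gen (Tor T) - gen (Tor T) * gen (Tor S) \<in> uq_rels A d P R"
| TE: "gen (Tor T) * gen (E j) - gen (E j) * gen (Tor T) - scal (root R j T) * gen (E j)
       \<in> uq_rels A d P R"
| TF: "gen (Tor T) * gen (F j) - gen (F j) * gen (Tor T) + scal (root R j T) * gen (F j)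
       \<in> uq_rels A d P R"
| EF: "scal (qexp (of_nat (d i)) - inverse (qexp (of_nat (d i)))) * y =
         hexp (gen (Tor (Tplus R i))) - hexp (- gen (Tor (Tminus R i))) \<Longrightarrow>
       gen (E i) * gen (F i) - gen (F i) * gen (E i) - y \<in> uq_rels A d P R"
| EF_neq: "i \<noteq> j \<Longrightarrow> gen (E i) * gen (F j) - gen (F j) * gen (E i) \<in> uq_rels A d P R"
| serre_E: "i \<noteq> j \<Longrightarrow> N = nat (1 - A $ i $ j) \<Longrightarrow>
       (\<Sum>k=0..N. scal (serre_coeff A d P i j k) *
          (gen (E i) ^ (N - k) * gen (E j) * gen (E i) ^ k)) \<in> uq_rels A d P R"
| serre_F: "i \<noteq> j \<Longrightarrow> N = nat (1 - A $ i $ j) \<Longrightarrow>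
       (\<Sum>k=0..N. scal (serre_coeff A d P i j k) *
          (gen (F i) ^ k * gen (F j) * gen (F i) ^ (N - k))) \<in> uq_rels A d P R"

definition uq_ideal ::
    "int^'i::finite^'i \<Rightarrow> ('i \<Rightarrow> nat) \<Rightarrow> ('k::field_char_0) fps^'i^'i \<Rightarrow>
     ('k, 'h::ab_group_add, 'i) realization \<Rightarrow> ('k, 'h, 'i) uqfree set" where
  "uq_ideal A d P R = closed_ideal (uq_rels A d P R)"

fun comult_gen ::
    "('k::field_char_0, 'h::ab_group_add, 'i) realization \<Rightarrow> ('h, 'i) uqgen \<Rightarrow>
     ('k, 'h, 'i) uqfree2" where
  "comult_gen R (Tor T) = ftens (gen (Tor T)) 1 + ftens 1 (gen (Tor T))"
| "comult_gen R (E i) = ftens (gen (E i)) 1 + ftens (hexp (gen (Tor (Tplus R i)))) (gen (E i))"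
| "comult_gen R (F i) = ftens (gen (F i)) (hexp (- gen (Tor (Tminus R i)))) + ftens 1 (gen (F i))"

text \<open>The continuous algebra morphism that kills all generators: it extracts the coefficient of
  the empty word.\<close>

definition free_counit :: "('x fmon \<Rightarrow>\<^sub>0 ('k::field_char_0)) fps \<Rightarrow> 'k fps" where
  "free_counit x = Abs_fps (\<lambda>n. Poly_Mapping.lookup (fps_nth x n) 0)"

text \<open>Elements are cosets of \<open>uq_ideal\<close>. Induced maps on cosets are given, as in
  \<^const>\<open>rcoset_mult\<close>, by taking the union over all representatives.\<close>

definition FoMpQUEA ::
    "int^'i::finite^'i \<Rightarrow> ('i \<Rightarrow> nat) \<Rightarrow> ('k::field_char_0) fps^'i^'i \<Rightarrow>
     ('k, 'h::ab_group_add, 'i) realization \<Rightarrow> ('k, 'h, 'i) uqhopf" where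
  "FoMpQUEA A d P R = (let J = uq_ideal A d P R; J2 = tens_ideal J in
     module.extend (quot_alg J)
       (hopf.fields
          (quot_alg J2)
          (\<lambda>C D. \<Union>x\<in>C. \<Union>y\<in>D. cls J2 (ftens x y))
          (\<lambda>C. \<Union>x\<in>C. cls J2 (alg_ext (comult_gen R) x))
          (\<lambda>C. the_elem (free_counit ` C))))"

definition uq ::
    "int^'i::finite^'i \<Rightarrow> ('i \<Rightarrow> nat) \<Rightarrow> ('k::field_char_0) fps^'i^'i \<Rightarrow>
     ('k, 'h::ab_group_add, 'i) realization \<Rightarrow> ('h, 'i) uqgen \<Rightarrow> ('k, 'h, 'i) uqfree set" where
  "uq A d P R x = cls (uq_ideal A d P R) (gen x)"

definition FoMpQUEA_bplus ::
    "int^'i::finite^'i \<Rightarrow> ('i \<Rightarrow> nat) \<Rightarrow> ('k::field_char_0) fps^'i^'i \<Rightarrow>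
     ('k, 'h::ab_group_add, 'i) realization \<Rightarrow> ('k, 'h, 'i) uqhopf" where
  "FoMpQUEA_bplus A d P R =
     hopf_sub (FoMpQUEA A d P R) (uq A d P R ` (range Tor \<union> range E))"

definition FoMpQUEA_bminus ::
    "int^'i::finite^'i \<Rightarrow> ('i \<Rightarrow> nat) \<Rightarrow> ('k::field_char_0) fps^'i^'i \<Rightarrow>
     ('k, 'h::ab_group_add, 'i) realization \<Rightarrow> ('k, 'h, 'i) uqhopf" where
  "FoMpQUEA_bminus A d P R =
     hopf_sub (FoMpQUEA A d P R) (uq A d P R ` (range Tor \<union> range F))"


section \<open>Toral twists\<close>

definition toral_twist ::
    "int^'i::finite^'i \<Rightarrow> ('i \<Rightarrow> nat) \<Rightarrow> ('k::field_char_0) fps^'i^'i \<Rightarrow>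
     ('k, 'h::ab_group_add, 'i) realization \<Rightarrow> ('g::finite \<Rightarrow> 'h) \<Rightarrow> 'k fps^'g^'g \<Rightarrow>
     ('k, 'h, 'i) uqfree2 set" where
  "toral_twist A d P R H \<Phi> = cls (tens_ideal (uq_ideal A d P R))
     (hexp (\<Sum>g\<in>UNIV. \<Sum>k\<in>UNIV.
        scal (fps_const (1/2) * \<Phi> $ g $ k) * ftens (gen (Tor (H g))) (gen (Tor (H k)))))"

definition twist_L ::
    "int^'i::finite^'i \<Rightarrow> ('i \<Rightarrow> nat) \<Rightarrow> ('k::field_char_0) fps^'i^'i \<Rightarrow>
     ('k, 'h::ab_group_add, 'i) realization \<Rightarrow> ('g::finite \<Rightarrow> 'h) \<Rightarrow> 'k fps^'g^'g \<Rightarrow>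
     'i \<Rightarrow> ('k, 'h, 'i) uqfree set" where
  "twist_L A d P R H \<Phi> l = cls (uq_ideal A d P R)
     (hexp (\<Sum>g\<in>UNIV. \<Sum>k\<in>UNIV.
        scal (fps_const (1/2) * root R l (H g) * \<Phi> $ g $ k) * gen (Tor (H k))))"

definition twist_K ::
    "int^'i::finite^'i \<Rightarrow> ('i \<Rightarrow> nat) \<Rightarrow> ('k::field_char_0) fps^'i^'i \<Rightarrow>
     ('k, 'h::ab_group_add, 'i) realization \<Rightarrow> ('g::finite \<Rightarrow> 'h) \<Rightarrow> 'k fps^'g^'g \<Rightarrow>
     'i \<Rightarrow> ('k, 'h, 'i) uqfree set" where
  "twist_K A d P R H \<Phi> l = cls (uq_ideal A d P R)
     (hexp (\<Sum>g\<in>UNIV. \<Sum>k\<in>UNIV.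
        scal (fps_const (1/2) * root R l (H g) * \<Phi> $ k $ g) * gen (Tor (H k))))"

definition twisted_E ::
    "int^'i::finite^'i \<Rightarrow> ('i \<Rightarrow> nat) \<Rightarrow> ('k::field_char_0) fps^'i^'i \<Rightarrow>
     ('k, 'h::ab_group_add, 'i) realization \<Rightarrow> ('g::finite \<Rightarrow> 'h) \<Rightarrow> 'k fps^'g^'g \<Rightarrow>
     'i \<Rightarrow> ('k, 'h, 'i) uqfree set" where
  "twisted_E A d P R H \<Phi> i =
     inv\<^bsub>FoMpQUEA A d P R\<^esub> (twist_L A d P R H \<Phi> i) \<otimes>\<^bsub>FoMpQUEA A d P R\<^esub> uq A d P R (E i)"

definition twisted_F ::
    "int^'i::finite^'i \<Rightarrow> ('i \<Rightarrow> nat) \<Rightarrow> ('k::field_char_0) fps^'i^'i \<Rightarrow>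
     ('k, 'h::ab_group_add, 'i) realization \<Rightarrow> ('g::finite \<Rightarrow> 'h) \<Rightarrow> 'k fps^'g^'g \<Rightarrow>
     'i \<Rightarrow> ('k, 'h, 'i) uqfree set" where
  "twisted_F A d P R H \<Phi> i =
     uq A d P R (F i) \<otimes>\<^bsub>FoMpQUEA A d P R\<^esub> twist_K A d P R H \<Phi> i"

text \<open>Membership, up to isomorphism of topological Hopf algebras, in the class of all \<open>W A d P R\<close>
  (\<open>W\<close> being one of the three constructions above) of Cartan type \<open>A\<close> whose realization
  satisfies \<open>Q\<close>.\<close>

definition in_FoMpQUEA_class ::
    "(int^'i::finite^'i \<Rightarrow> ('i \<Rightarrow> nat) \<Rightarrow> ('k::field_char_0) fps^'i^'i \<Rightarrow>
       ('k, 'h::ab_group_add, 'i) realization \<Rightarrow> ('k, 'h, 'i) uqhopf) \<Rightarrow>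
     int^'i^'i \<Rightarrow> ('i \<Rightarrow> nat) \<Rightarrow> (('k, 'h, 'i) realization \<Rightarrow> bool) \<Rightarrow>
     ('k, 'h, 'i) uqhopf \<Rightarrow> bool" where
  "in_FoMpQUEA_class W A d Q X \<longleftrightarrow>
     (\<exists>P R f. cartan_type A d P \<and> is_realization P R \<and> Q R \<and> top_hopf_iso (W A d P R) X f)"

end

theory Submission
  imports Defs
begin

text \<open>Let \<open>\<ell>\<^sub>i = - 1/2 \<Sum> \<alpha>\<^sub>i(H\<^sub>g) \<phi>\<^sub>g\<^sub>k H\<^sub>k\<close>. On the completed free algebra,
  \<open>T \<mapsto> T\<close>, \<open>E\<^sub>i \<mapsto> exp(\<hbar>\<ell>\<^sub>i) E\<^sub>i\<close>, \<open>F\<^sub>i \<mapsto> F\<^sub>i exp(\<hbar>\<ell>\<^sub>i)\<close> is already an automorphism \<open>f\<close>: its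
  inverse is the same map for \<open>-\<Phi>\<close>. It sends the relations for \<open>(P\<^sub>\<Phi>, R\<^sub>\<Phi>)\<close> into the closed ideal
  of \<open>(P, R)\<close>, since the \<open>exp(\<hbar>\<ell>\<^sub>i)\<close> \<open>q\<close>-commute with the \<open>E\<^sub>j\<close> and \<open>F\<^sub>j\<close> and the matrix
  \<open>\<alpha>\<^sub>j(\<ell>\<^sub>i)\<close> is antisymmetric. As \<open>(P, R)\<close> is the deformation of \<open>(P\<^sub>\<Phi>, R\<^sub>\<Phi>)\<close> by \<open>-\<Phi>\<close>, the two ideals
  correspond exactly, and all the structure is carried over by taking images of cosets under \<open>f\<close>
  and \<open>f \<otimes> f\<close>. The twisted coproduct is matched by comparing both sides on generators, where
  the conjugation by the toral twist \<open>exp(\<hbar>Z)\<close> is computed from the commutators of \<open>Z\<close>. Working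
  with images of arbitrary sets makes it unnecessary to know that the coproduct is compatible
  with the relations.\<close>

text \<open>Calculations are congruences in the completed free algebra, not identities in the
  quotient. Limits are handled algebraically: closed means stable under approximation modulo every
  power of \<hbar>. The obstacle is the relation between \<open>E i\<close> and \<open>F i\<close>,
  whose right side is divided by a multiple of \<hbar>, while the quotient is not known to be free
  of \<hbar>-torsion. Exponentials are therefore divided by \<hbar> in the free algebra first, and
  the congruences are proved for the divided series. The factor 1/2 in the exponent has a simple
  origin: the twist moves the vector of \<open>Tplus R i\<close> by twice the exponent, and
  \<open>E i\<close> and \<open>F i\<close> take one half each. In the Serre relations, moving the
  exponentials to one side turns the coefficients for the deformed matrix into the old ones, up to a
  factor common to all terms. For the Borel parts the inverse of the twist is taken in a smaller
  carrier, which has to be shown to contain it.\<close>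

section \<open>Coefficients of monomials, and scalars in the completed monoid algebra\<close>

lemma single_times_lookup: "Poly_Mapping.lookup (Poly_Mapping.single 0 c * p) w = c * Poly_Mapping.lookup p w"
  for c :: "'a::comm_semiring_1"
  by (simp flip: mult_map_scale_conv_mult add: Poly_Mapping.map.rep_eq when_def)

lemma poly_mapping_sum_singles:
  "p = (\<Sum>w\<in>Poly_Mapping.keys p. Poly_Mapping.single w (Poly_Mapping.lookup p w))"
  for p :: "'m \<Rightarrow>\<^sub>0 'a::comm_monoid_add"
  by (rule poly_mapping_eqI)
    (auto simp: Poly_Mapping.lookup_sum lookup_single when_def in_keys_iff sum.delta)

lemma single_zero_commute:
  "Poly_Mapping.single 0 c * p = p * Poly_Mapping.single (0 :: 'm::monoid_add) (c :: 'a::comm_semiring_1)"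
  by (subst (1 2) poly_mapping_sum_singles[of p])
    (simp add: sum_distrib_left sum_distrib_right mult_single mult.commute)

text \<open>Exchanges the two indices: a series of finitely supported functions becomes a family of
  scalar series. These functionals separate points, so identities can be checked in the commutative
  domain \<open>'k fps\<close>.\<close>

definition coord :: "'m \<Rightarrow> ('m \<Rightarrow>\<^sub>0 'k) fps \<Rightarrow> ('k::field_char_0) fps" where
  "coord w x = Abs_fps (\<lambda>n. Poly_Mapping.lookup (fps_nth x n) w)"

definition mon :: "'m::monoid_add \<Rightarrow> ('m \<Rightarrow>\<^sub>0 ('k::field_char_0)) fps" where
  "mon w = fps_const (Poly_Mapping.single w 1)"

lemma coord_eqI: "(\<And>w. coord w x = coord w y) \<Longrightarrow> x = y"
  by (auto simp: coord_def fps_eq_iff intro!: poly_mapping_eqI)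

lemma coord_add [simp]: "coord w (x + y) = coord w x + coord w y"
  by (auto simp: coord_def fps_eq_iff Poly_Mapping.lookup_add)

lemma coord_scal [simp]: "coord w (scal c * x) = c * coord w x"
  by (auto simp: coord_def fps_eq_iff scal_def fps_mult_nth single_times_lookup Poly_Mapping.lookup_sum)

lemma coord_mon: "coord w (mon v) = (if v = w then 1 else 0)"
  by (auto simp: coord_def mon_def fps_eq_iff lookup_single)

lemma mon_zero: "mon 0 = 1"
  by (auto simp: mon_def)

lemma mon_add: "mon (u + v) = mon u * mon v"
  by (auto simp: mon_def mult_single)

lemma scal_commute: "scal c * x = x * scal c"
proof (rule fps_ext)
  fix n
  have "fps_nth (scal c * x) n = (\<Sum>i\<le>n. fps_nth (scal c) i * fps_nth x (n - i))"
    by (simp add: fps_mult_nth atLeast0AtMost)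
  also have "\<dots> = (\<Sum>i\<le>n. fps_nth x (n - i) * fps_nth (scal c) i)"
    by (simp add: scal_def single_zero_commute)
  also have "\<dots> = fps_nth (x * scal c) n"
    unfolding fps_mult_nth atLeast0AtMost
    by (rule sum.reindex_bij_witness[of _ "\<lambda>i. n - i" "\<lambda>i. n - i"]) auto
  finally show "fps_nth (scal c * x) n = fps_nth (x * scal c) n" .
qed

lemma scal_left_commute: "x * (scal c * y) = scal c * (x * y)"
  by (metis mult.assoc scal_commute)

lemma nth_scal [simp]: "fps_nth (scal c) n = Poly_Mapping.single 0 (fps_nth c n)"
  by (simp add: scal_def)
lemma scal_zero [simp]: "scal 0 = 0"
  by (auto simp: scal_def fps_eq_iff)
lemma scal_one [simp]: "scal 1 = 1"
  by (auto simp: scal_def fps_eq_iff)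
lemma scal_add: "scal (c + d) = scal c + scal d"
  by (auto simp: scal_def fps_eq_iff single_add)
lemma scal_minus: "scal (- c) = - scal c"
  by (auto simp: scal_def fps_eq_iff single_uminus)
lemma scal_mult: "scal (c * d) = scal c * scal d"
proof (rule coord_eqI)
  fix w :: 'a
  have "coord w (scal (c * d) * 1) = coord w (scal c * (scal d * 1))"
    unfolding coord_scal by (simp add: mult.assoc)
  then show "coord w (scal (c * d)) = coord w (scal c * scal d)" by simp
qed
lemma scal_mult_assoc: "scal c * (scal d * x) = scal (c * d) * x"
  by (simp add: scal_mult mult.assoc)
lemma scal_power: "scal (c ^ n) = scal c ^ n"
  by (induction n) (simp_all add: scal_mult)

lemma nth_scal_X: "fps_nth (scal (fps_X ^ k) * x) n = (if n < k then 0 else fps_nth x (n - k))"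
proof (rule poly_mapping_eqI)
  fix w
  have "Poly_Mapping.lookup (fps_nth (scal (fps_X ^ k) * x) n) w = fps_nth (coord w (scal (fps_X ^ k) * x)) n"
    by (simp add: coord_def)
  also have "\<dots> = (if n < k then 0 else fps_nth (coord w x) (n - k))"
    unfolding coord_scal by (simp add: fps_X_power_mult_nth)
  finally show "Poly_Mapping.lookup (fps_nth (scal (fps_X ^ k) * x) n) w =
      Poly_Mapping.lookup (if n < k then 0 else fps_nth x (n - k)) w"
    by (simp add: coord_def)
qed

lemma nth_scal_X1: "fps_nth (scal fps_X * x) n = (if n = 0 then 0 else fps_nth x (n - 1))"
  using nth_scal_X[of 1 x n] by simp

text \<open>Coordinatewise this is cancellation in the domain \<open>'k fps\<close>. It expresses
  that the completed monoid algebra has no torsion, which a quotient of it may have.\<close>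

lemma scal_cancel: "c \<noteq> 0 \<Longrightarrow> scal c * x = scal c * y \<Longrightarrow> x = y"
proof (rule coord_eqI)
  fix w assume "c \<noteq> 0" "scal c * x = scal c * y"
  then show "coord w x = coord w y"
    by (metis coord_scal mult_left_cancel)
qed

text \<open>Bridge between divisibility by powers of \<hbar> and the cutoffs that describe the
  topology of the library.\<close>

lemma eq_mod_X_iff: "(\<exists>r. x = y + scal (fps_X ^ n) * r) \<longleftrightarrow> fps_cutoff n x = fps_cutoff n y"
proof
  assume "\<exists>r. x = y + scal (fps_X ^ n) * r"
  then show "fps_cutoff n x = fps_cutoff n y"
    by (auto simp: fps_eq_iff nth_scal_X)
next
  assume *: "fps_cutoff n x = fps_cutoff n y"
  have "x = y + scal (fps_X ^ n) * Abs_fps (\<lambda>k. fps_nth (x - y) (k + n))"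
  proof (rule fps_ext)
    fix k
    show "fps_nth x k = fps_nth (y + scal (fps_X ^ n) * Abs_fps (\<lambda>k. fps_nth (x - y) (k + n))) k"
      using fun_cong[OF arg_cong[OF *, of fps_nth], of k] by (auto simp: nth_scal_X)
  qed
  then show "\<exists>r. x = y + scal (fps_X ^ n) * r" by blast
qed

text \<open>The \<hbar>-adic topology is separated; limits are identified by this.\<close>

lemma eq_zero_mod_X: "(\<And>n. \<exists>r. x = scal (fps_X ^ n) * r) \<Longrightarrow> x = 0"
proof (rule fps_ext)
  fix n assume "\<And>n. \<exists>r. x = scal (fps_X ^ n) * r"
  then obtain r where "x = scal (fps_X ^ Suc n) * r" by blast
  then show "fps_nth x n = fps_nth 0 n" by (simp only: nth_scal_X) simp
qed

section \<open>Closed submodules and linear maps\<close>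

text \<open>Topological closedness in algebraic form: a point that can be approximated modulo every
  power of \<hbar> belongs to the set.\<close>

definition h_closed :: "('m::monoid_add \<Rightarrow>\<^sub>0 ('k::field_char_0)) fps set \<Rightarrow> bool" where
  "h_closed S \<longleftrightarrow> (\<forall>x. (\<forall>n. \<exists>y\<in>S. \<exists>r. x = y + scal (fps_X ^ n) * r) \<longrightarrow> x \<in> S)"

definition closed_submodule :: "('m::monoid_add \<Rightarrow>\<^sub>0 ('k::field_char_0)) fps set \<Rightarrow> bool" where
  "closed_submodule S \<longleftrightarrow> 0 \<in> S \<and> (\<forall>x\<in>S. \<forall>y\<in>S. x + y \<in> S) \<and> (\<forall>c. \<forall>x\<in>S. scal c * x \<in> S) \<and> h_closed S"

definition is_closed_ideal :: "('m::monoid_add \<Rightarrow>\<^sub>0 ('k::field_char_0)) fps set \<Rightarrow> bool" where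
  "is_closed_ideal J \<longleftrightarrow> 0 \<in> J \<and> (\<forall>x\<in>J. \<forall>y\<in>J. x + y \<in> J) \<and> (\<forall>a. \<forall>x\<in>J. a * x \<in> J \<and> x * a \<in> J) \<and> h_closed J"

text \<open>Linearity over \<open>'k fps\<close> carries \<hbar>-adic continuity with it, since an
  error \<open>scal (fps_X ^ n) * r\<close> is sent to
  \<open>scal (fps_X ^ n) * g r\<close>.\<close>

definition is_linear :: "(('m::monoid_add \<Rightarrow>\<^sub>0 ('k::field_char_0)) fps \<Rightarrow> ('n::monoid_add \<Rightarrow>\<^sub>0 'k) fps) \<Rightarrow> bool" where
  "is_linear g \<longleftrightarrow> (\<forall>x y. g (x + y) = g x + g y) \<and> (\<forall>c x. g (scal c * x) = scal c * g x)"

definition is_alg_hom :: "(('m::monoid_add \<Rightarrow>\<^sub>0 ('k::field_char_0)) fps \<Rightarrow> ('n::monoid_add \<Rightarrow>\<^sub>0 'k) fps) \<Rightarrow> bool" where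
  "is_alg_hom g \<longleftrightarrow> is_linear g \<and> g 1 = 1 \<and> (\<forall>x y. g (x * y) = g x * g y)"

lemma closed_submodule_hclosedD: "closed_submodule S \<Longrightarrow> (\<And>n. \<exists>y\<in>S. \<exists>r. x = y + scal (fps_X ^ n) * r) \<Longrightarrow> x \<in> S"
  by (auto simp: closed_submodule_def h_closed_def)

lemma closed_submodule_zero: "closed_submodule S \<Longrightarrow> 0 \<in> S"
  and closed_submodule_add: "closed_submodule S \<Longrightarrow> x \<in> S \<Longrightarrow> y \<in> S \<Longrightarrow> x + y \<in> S"
  and closed_submodule_scal: "closed_submodule S \<Longrightarrow> x \<in> S \<Longrightarrow> scal c * x \<in> S"
  by (auto simp: closed_submodule_def)

lemma closed_submodule_uminus: "closed_submodule S \<Longrightarrow> x \<in> S \<Longrightarrow> - x \<in> S"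
  using closed_submodule_scal[of S x "-1"] by (simp add: scal_minus)

lemma closed_submodule_diff: "closed_submodule S \<Longrightarrow> x \<in> S \<Longrightarrow> y \<in> S \<Longrightarrow> x - y \<in> S"
  using closed_submodule_add[of S x "- y"] closed_submodule_uminus[of S y] by simp

lemma closed_submodule_sum: "closed_submodule S \<Longrightarrow> (\<And>i. i \<in> I \<Longrightarrow> f i \<in> S) \<Longrightarrow> sum f I \<in> S"
  by (induction I rule: infinite_finite_induct) (auto intro: closed_submodule_add closed_submodule_zero)

lemma is_closed_ideal_closed_submodule: "is_closed_ideal J \<Longrightarrow> closed_submodule J"
  by (auto simp: is_closed_ideal_def closed_submodule_def)

lemma is_closed_ideal_mult: "is_closed_ideal J \<Longrightarrow> x \<in> J \<Longrightarrow> a * x \<in> J" "is_closed_ideal J \<Longrightarrow> x \<in> J \<Longrightarrow> x * a \<in> J"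
  by (auto simp: is_closed_ideal_def)

lemma closed_submodule_singleton_zero: "closed_submodule {0}"
  by (auto simp: closed_submodule_def h_closed_def intro: eq_zero_mod_X)

lemma is_closed_ideal_singleton_zero: "is_closed_ideal {0}"
  using closed_submodule_singleton_zero by (auto simp: closed_submodule_def is_closed_ideal_def)

lemma is_linearD:
  assumes "is_linear g"
  shows "g (x + y) = g x + g y" "g (scal c * x) = scal c * g x" "g 0 = 0" "g (- x) = - g x"
    "g (x - y) = g x - g y" "g (sum h I) = (\<Sum>i\<in>I. g (h i))"
proof -
  show a: "g (x + y) = g x + g y" "g (scal c * x) = scal c * g x" for x y c
    using assms by (auto simp: is_linear_def)
  show z: "g 0 = 0" using a(1)[of 0 0] by simp
  show m: "g (- x) = - g x" for x using a(1)[of x "- x"] z by (simp add: minus_unique)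
  show "g (x - y) = g x - g y" using a(1)[of x "- y"] m[of y] by simp
  show "g (sum h I) = (\<Sum>i\<in>I. g (h i))"
    by (induction I rule: infinite_finite_induct) (auto simp: a z)
qed

lemma is_alg_homD:
  assumes "is_alg_hom g"
  shows "is_linear g" "g 1 = 1" "g (x * y) = g x * g y" "g (x ^ n) = g x ^ n" "g (scal c) = scal c"
proof -
  show a: "is_linear g" "g 1 = 1" "g (x * y) = g x * g y" for x y using assms by (auto simp: is_alg_hom_def)
  show "g (x ^ n) = g x ^ n" by (induction n) (auto simp: a)
  show "g (scal c) = scal c" using is_linearD(2)[OF a(1), of c 1] a(2) by simp
qed

lemma lin_compose: "is_linear f \<Longrightarrow> is_linear g \<Longrightarrow> is_linear (\<lambda>x. f (g x))"
  by (auto simp: is_linear_def)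

lemma alg_compose: "is_alg_hom f \<Longrightarrow> is_alg_hom g \<Longrightarrow> is_alg_hom (\<lambda>x. f (g x))"
  by (auto simp: is_alg_hom_def intro: lin_compose)

lemma lin_diff: "is_linear f \<Longrightarrow> is_linear g \<Longrightarrow> is_linear (\<lambda>x. f x - g x)"
  by (auto simp: is_linear_def algebra_simps)

lemma lin_ident: "is_linear (\<lambda>x. x)"
  and lin_mult_left: "is_linear (\<lambda>x. a * x)"
  and lin_mult_right: "is_linear (\<lambda>x. x * a)"
  by (auto simp: is_linear_def algebra_simps scal_left_commute)

lemma closed_submodule_vimage: "is_linear g \<Longrightarrow> closed_submodule S \<Longrightarrow> closed_submodule (g -` S)"
proof -
  assume g: "is_linear g" and S: "closed_submodule S"
  have "g x \<in> S" if x: "\<And>n. \<exists>y\<in>g -` S. \<exists>r. x = y + scal (fps_X ^ n) * r" for x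
  proof (rule closed_submodule_hclosedD[OF S])
    fix n
    from x[of n] obtain y r where "g y \<in> S" "x = y + scal (fps_X ^ n) * r" by blast
    then show "\<exists>y\<in>S. \<exists>r. g x = y + scal (fps_X ^ n) * r"
      by (auto simp: is_linearD[OF g])
  qed
  then show ?thesis
    using S by (simp add: closed_submodule_def h_closed_def is_linearD[OF g])
qed

lemma is_closed_ideal_vimage: "is_alg_hom g \<Longrightarrow> is_closed_ideal J \<Longrightarrow> is_closed_ideal (g -` J)"
  using closed_submodule_vimage[of g J] is_closed_ideal_closed_submodule[of J] is_alg_homD(1)[of g]
  by (auto simp: is_closed_ideal_def closed_submodule_def is_alg_homD)

text \<open>Basis of the density arguments: two linear maps that agree on a topologically spanning
  set agree everywhere.\<close>

lemma closed_submodule_equalizer: "is_linear f \<Longrightarrow> is_linear g \<Longrightarrow> closed_submodule {x. f x = g x}"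
  using closed_submodule_vimage[OF lin_diff[of f g] closed_submodule_singleton_zero] by (simp add: vimage_def)

section \<open>Series in h\<close>

text \<open>The series \<open>\<Sum> \<hbar>\<^sup>n a\<^sub>n\<close>, which converges for every sequence \<open>a\<close>.\<close>

definition hsum :: "(nat \<Rightarrow> ('m::monoid_add \<Rightarrow>\<^sub>0 ('k::field_char_0)) fps) \<Rightarrow> ('m \<Rightarrow>\<^sub>0 'k) fps" where
  "hsum a = Abs_fps (\<lambda>N. \<Sum>n\<le>N. fps_nth (a n) (N - n))"

lemma hsum_Suc: "hsum a = a 0 + scal fps_X * hsum (\<lambda>n. a (Suc n))"
proof (rule fps_ext)
  fix N show "fps_nth (hsum a) N = fps_nth (a 0 + scal fps_X * hsum (\<lambda>n. a (Suc n))) N"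
    by (cases N) (simp_all add: hsum_def nth_scal_X1 sum.atMost_Suc_shift del: sum.atMost_Suc)
qed

text \<open>The remainder after \<open>N\<close> terms is explicitly a multiple of the
  \<open>N\<close>-th power of \<hbar>; the convergence arguments for these series rest on this
  formula.\<close>

lemma hsum_split: "hsum a = (\<Sum>n<N. scal (fps_X ^ n) * a n) + scal (fps_X ^ N) * hsum (\<lambda>n. a (n + N))"
proof (induction N)
  case (Suc N)
  show ?case
    by (subst Suc, subst hsum_Suc) (simp add: distrib_left scal_mult_assoc mult.commute[of fps_X])
qed simp

lemma hsum_add: "hsum (\<lambda>n. a n + b n) = hsum a + hsum b"
  by (auto simp: hsum_def fps_eq_iff sum.distrib)

lemma hsum_zero: "hsum (\<lambda>n. 0) = 0"
  by (simp add: hsum_def fps_eq_iff)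

lemma suminf_hsum: "suminf (\<lambda>n. scal (fps_X ^ n) * a n) = hsum a"
proof -
  have "(\<lambda>n. scal (fps_X ^ n) * a n) sums hsum a"
    unfolding sums_def tendsto_fps_iff
  proof (intro allI eventually_sequentiallyI)
    fix n N :: nat assume "N \<ge> Suc n"
    then show "fps_nth (\<Sum>k<N. scal (fps_X ^ k) * a k) n = fps_nth (hsum a) n"
      by (subst hsum_split[of a N]) (simp add: nth_scal_X)
  qed
  then show ?thesis by (simp add: sums_iff)
qed

lemma closed_submodule_hsum: "closed_submodule S \<Longrightarrow> (\<And>n. a n \<in> S) \<Longrightarrow> hsum a \<in> S"
  by (rule closed_submodule_hclosedD, assumption)
    (rule bexI, rule exI, rule hsum_split, intro closed_submodule_sum closed_submodule_scal, simp_all)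

text \<open>Both sides have the same first \<open>N\<close> terms, so their difference is divisible
  by every power of \<hbar>.\<close>

lemma lin_hsum: assumes g: "is_linear g" shows "g (hsum a) = hsum (\<lambda>n. g (a n))"
proof -
  have "g (hsum a) - hsum (\<lambda>n. g (a n)) = 0"
  proof (rule eq_zero_mod_X)
    fix N
    have "g (hsum a) - hsum (\<lambda>n. g (a n)) =
       scal (fps_X ^ N) * (g (hsum (\<lambda>n. a (n + N))) - hsum (\<lambda>n. g (a (n + N))))"
      by (subst (1 2) hsum_split[where N = N]) (simp add: is_linearD[OF g] right_diff_distrib)
    then show "\<exists>r. g (hsum a) - hsum (\<lambda>n. g (a n)) = scal (fps_X ^ N) * r" by blast
  qed
  then show ?thesis by simp
qed

lemma hsum_mult_left: "x * hsum a = hsum (\<lambda>n. x * a n)"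
  and hsum_mult_right: "hsum a * x = hsum (\<lambda>n. a n * x)"
  and hsum_diff: "hsum (\<lambda>n. a n - b n) = hsum a - hsum b"
    apply (rule lin_hsum[OF lin_mult_left])
   apply (rule lin_hsum[OF lin_mult_right])
  using hsum_add[of "\<lambda>n. a n - b n" b] by simp

lemma hsum_mult: "hsum a * hsum b = hsum (\<lambda>n. \<Sum>i\<le>n. a i * b (n - i))"
proof -
  have "fps_nth (hsum a * hsum b) N = fps_nth (hsum (\<lambda>n. \<Sum>i\<le>n. a i * b (n - i))) N" for N
  \<comment> \<open>Split off the first term of the left factor. What remains carries a factor
    \<hbar>, so that its coefficient at \<open>N\<close> is one at \<open>N - 1\<close> for the
    shifted sequence; hence \<open>a\<close> must be arbitrary.\<close>
  proof (induction N arbitrary: a rule: less_induct)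
    case (less N)
    let ?c = "\<lambda>n. \<Sum>i\<le>n. a i * b (n - i)" and ?c' = "\<lambda>n. \<Sum>i\<le>n. a (Suc i) * b (n - i)"
    let ?e = "\<lambda>n. if n = 0 then 0 else ?c' (n - 1)"
    have *: "?c = (\<lambda>n. a 0 * b n + ?e n)"
    proof
      fix n show "?c n = a 0 * b n + ?e n"
        by (cases n) (simp_all add: sum.atMost_Suc_shift del: sum.atMost_Suc)
    qed
    have "hsum ?c = a 0 * hsum b + hsum ?e"
      unfolding * hsum_add hsum_mult_left ..
    also have "hsum ?e = scal fps_X * hsum ?c'"
      by (subst hsum_Suc) simp
    finally have c: "hsum ?c = a 0 * hsum b + scal fps_X * hsum ?c'" .
    have ab: "hsum a * hsum b = a 0 * hsum b + scal fps_X * (hsum (\<lambda>n. a (Suc n)) * hsum b)"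
      by (subst hsum_Suc) (simp add: algebra_simps)
    show ?case
      unfolding c ab using less[of "N - 1" "\<lambda>n. a (Suc n)"] by (cases N) (simp_all add: nth_scal_X1)
  qed
  then show ?thesis by (rule fps_ext)
qed

lemma hsum_const: "hsum (\<lambda>n. fps_const (fps_nth x n)) = x"
  by (rule fps_ext) (simp add: hsum_def if_distrib sum.delta cong: if_cong)

lemma scal_const: "scal (fps_const c) = fps_const (Poly_Mapping.single 0 c)"
  by (auto simp: scal_def fps_eq_iff)

lemma scal_hsum: "scal c = hsum (\<lambda>n. scal (fps_const (fps_nth c n)))"
  unfolding scal_const by (subst hsum_const[symmetric]) (simp add: scal_def)

lemma fps_const_mon_expansion:
  "fps_const p = (\<Sum>w\<in>Poly_Mapping.keys p. scal (fps_const (Poly_Mapping.lookup p w)) * mon w)"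
proof (rule fps_ext)
  fix n
  show "fps_nth (fps_const p) n =
      fps_nth (\<Sum>w\<in>Poly_Mapping.keys p. scal (fps_const (Poly_Mapping.lookup p w)) * mon w) n"
    using poly_mapping_sum_singles[of p]
    by (cases n) (simp_all add: fps_sum_nth scal_const mon_def mult_single)
qed

text \<open>Monomials span topologically: each coefficient is a finite combination of them, and a
  series is the \<open>hsum\<close> of its coefficients.\<close>

lemma closed_submodule_mon_UNIV:
  assumes "closed_submodule S" "\<And>w. mon w \<in> S"
  shows "x \<in> S"
proof -
  have "fps_const p \<in> S" for p
    unfolding fps_const_mon_expansion by (intro closed_submodule_sum closed_submodule_scal assms)
  then show ?thesis
    using closed_submodule_hsum[OF assms(1), of "\<lambda>n. fps_const (fps_nth x n)"] by (simp add: hsum_const)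
qed

lemma lin_eqI: "is_linear f \<Longrightarrow> is_linear g \<Longrightarrow> (\<And>w. f (mon w) = g (mon w)) \<Longrightarrow> f x = g x"
  using closed_submodule_mon_UNIV[OF closed_submodule_equalizer, of f g x] by blast

lemma gen_mon: "gen x = mon (FMon [x])"
  by (simp add: gen_def mon_def)

lemma closed_submodule_gen_UNIV:
  assumes "closed_submodule S" "1 \<in> S" "\<And>x. gen x \<in> S" "\<And>x y. x \<in> S \<Longrightarrow> y \<in> S \<Longrightarrow> x * y \<in> S"
  shows "x \<in> S"
proof (rule closed_submodule_mon_UNIV[OF assms(1)])
  fix w :: "'a fmon"
  have "mon (FMon ws) \<in> S" for ws :: "'a list"
  proof (induction ws)
    case Nil
    then show ?case using assms(2) by (simp add: mon_zero flip: zero_fmon_def)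
  next
    case (Cons a ws)
    have "FMon (a # ws) = FMon [a] + FMon ws" by (simp add: plus_fmon_def)
    then show ?case using assms(3,4) Cons by (simp add: mon_add flip: gen_mon)
  qed
  then show "mon w \<in> S" by (cases w) simp
qed

section \<open>Linear extension\<close>

definition pm_ext where
  "pm_ext \<psi> p = (\<Sum>w\<in>Poly_Mapping.keys p. scal (fps_const (Poly_Mapping.lookup p w)) * \<psi> w)"

text \<open>Cancellation can shrink the support of a sum, so additivity is read off only after
  summing over a common larger set.\<close>

lemma pm_ext_superset: "finite A \<Longrightarrow> Poly_Mapping.keys p \<subseteq> A \<Longrightarrow>
    pm_ext \<psi> p = (\<Sum>w\<in>A. scal (fps_const (Poly_Mapping.lookup p w)) * \<psi> w)"
  unfolding pm_ext_def by (rule sum.mono_neutral_left) (auto simp: in_keys_iff)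

lemma pm_ext_add: "pm_ext \<psi> (p + q) = pm_ext \<psi> p + pm_ext \<psi> q"
proof -
  let ?A = "Poly_Mapping.keys p \<union> Poly_Mapping.keys q"
  have *: "finite ?A" "Poly_Mapping.keys (p + q) \<subseteq> ?A" "Poly_Mapping.keys p \<subseteq> ?A" "Poly_Mapping.keys q \<subseteq> ?A"
    using Poly_Mapping.keys_add[of p q] by auto
  show ?thesis
    unfolding pm_ext_superset[OF *(1,2)] pm_ext_superset[OF *(1,3)] pm_ext_superset[OF *(1,4)]
    by (simp add: Poly_Mapping.lookup_add scal_add algebra_simps sum.distrib flip: fps_const_add)
qed

lemma pm_ext_zero: "pm_ext \<psi> 0 = 0"
  by (simp add: pm_ext_def)

lemma pm_ext_sum: "pm_ext \<psi> (sum f I) = (\<Sum>i\<in>I. pm_ext \<psi> (f i))"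
  by (induction I rule: infinite_finite_induct) (simp_all add: pm_ext_add pm_ext_zero)

lemma pm_ext_scale: "pm_ext \<psi> (Poly_Mapping.single 0 c * p) = scal (fps_const c) * pm_ext \<psi> p"
proof -
  have k: "Poly_Mapping.keys (Poly_Mapping.single 0 c * p) \<subseteq> Poly_Mapping.keys p"
    by (auto simp: in_keys_iff single_times_lookup)
  show ?thesis
    unfolding pm_ext_superset[OF finite_keys k] single_times_lookup
    by (simp add: pm_ext_def sum_distrib_left scal_mult mult.assoc flip: fps_const_mult)
qed

lemma lin_ext_hsum: "lin_ext \<psi> x = hsum (\<lambda>n. pm_ext \<psi> (fps_nth x n))"
  unfolding lin_ext_def pm_ext_def[symmetric] suminf_hsum ..

text \<open>A scalar series is itself an \<open>hsum\<close> of constants. Linearity over series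
  thus follows from linearity over the field and the Cauchy product.\<close>

lemma lin_lin_ext: "is_linear (lin_ext \<psi>)"
proof -
  have "lin_ext \<psi> (scal c * x) = scal c * lin_ext \<psi> x" for c x
  proof -
    have "scal c * lin_ext \<psi> x =
        hsum (\<lambda>n. \<Sum>i\<le>n. scal (fps_const (fps_nth c i)) * pm_ext \<psi> (fps_nth x (n - i)))"
      by (subst scal_hsum) (simp add: lin_ext_hsum hsum_mult)
    moreover have "fps_nth (scal c * x) n = (\<Sum>i\<le>n. Poly_Mapping.single 0 (fps_nth c i) * fps_nth x (n - i))" for n
      by (simp add: fps_mult_nth atLeast0AtMost scal_def)
    ultimately show ?thesis
      by (simp add: lin_ext_hsum pm_ext_sum pm_ext_scale)
  qed
  then show ?thesis
    by (simp add: is_linear_def lin_ext_hsum pm_ext_add hsum_add)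
qed

lemma lin_ext_mon [simp]: "lin_ext \<psi> (mon w) = \<psi> w"
proof -
  have "pm_ext \<psi> (fps_nth (mon w) n) = (if n = 0 then \<psi> w else 0)" for n
    by (cases n) (simp_all add: mon_def pm_ext_def)
  then show ?thesis by (simp add: lin_ext_hsum) (subst hsum_Suc, simp add: hsum_zero)
qed

lemma bilin_eqI:
  assumes "\<And>y. is_linear (\<lambda>x. f x y)" "\<And>x. is_linear (f x)" "\<And>y. is_linear (\<lambda>x. g x y)" "\<And>x. is_linear (g x)"
    "\<And>u v. f (mon u) (mon v) = g (mon u) (mon v)"
  shows "f x y = g x y"
proof -
  have "f (mon u) y = g (mon u) y" for u
    using lin_eqI[of "f (mon u)" "g (mon u)"] assms by blast
  then show ?thesis
    using lin_eqI[of "\<lambda>x. f x y" "\<lambda>x. g x y"] assms by blast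
qed

lemma alg_linI:
  assumes "is_linear g" "g 1 = 1" "\<And>u v. g (mon u * mon v) = g (mon u) * g (mon v)"
  shows "is_alg_hom g"
proof -
  have "g (x * y) = g x * g y" for x y
    by (rule bilin_eqI[of "\<lambda>x y. g (x * y)" "\<lambda>x y. g x * g y"])
      (use assms in \<open>auto simp: is_linear_def algebra_simps scal_left_commute\<close>)
  then show ?thesis using assms by (auto simp: is_alg_hom_def)
qed

lemma alg_alg_ext: "is_alg_hom (alg_ext \<phi>)"
proof (rule alg_linI)
  show "is_linear (alg_ext \<phi>)" by (simp add: alg_ext_def lin_lin_ext)
  show "alg_ext \<phi> 1 = 1"
    by (simp add: alg_ext_def mon_zero[symmetric] del: mon_zero) (simp add: zero_fmon_def mon_zero)
  show "alg_ext \<phi> (mon u * mon v) = alg_ext \<phi> (mon u) * alg_ext \<phi> (mon v)" for u v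
    by (simp add: alg_ext_def flip: mon_add) (simp add: plus_fmon_def)
qed

lemma alg_ext_gen [simp]: "alg_ext \<phi> (gen x) = \<phi> x"
  by (simp add: alg_ext_def gen_mon)

lemma alg_eqI:
  assumes "is_alg_hom f" "is_alg_hom g" "\<And>x. f (gen x) = g (gen x)"
  shows "f x = g x"
  using closed_submodule_gen_UNIV[of "{x. f x = g x}" x] closed_submodule_equalizer[of f g] assms
  by (auto simp: is_alg_homD)

section \<open>Tensors\<close>

text \<open>The coordinates of a tensor are products of coordinates, which reduces bilinearity and
  the values on monomials to identities of scalar series.\<close>

lemma coord_ftens [simp]:
  fixes x :: "('m::monoid_add \<Rightarrow>\<^sub>0 'k::field_char_0) fps" and y :: "('n::monoid_add \<Rightarrow>\<^sub>0 'k) fps"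
  shows "coord (u, v) (ftens x y) = coord u x * coord v y"
proof (rule fps_ext)
  fix N
  have "Poly_Mapping.lookup (\<Sum>a\<in>Poly_Mapping.keys p. \<Sum>b\<in>Poly_Mapping.keys q.
       Poly_Mapping.single (a, b) (Poly_Mapping.lookup p a * Poly_Mapping.lookup q b)) (u, v) =
     Poly_Mapping.lookup p u * Poly_Mapping.lookup q v" for p :: "'m \<Rightarrow>\<^sub>0 'k" and q :: "'n \<Rightarrow>\<^sub>0 'k"
  proof -
    have "(\<Sum>a\<in>Poly_Mapping.keys p. \<Sum>b\<in>Poly_Mapping.keys q.
       Poly_Mapping.lookup p a * Poly_Mapping.lookup q b when (a, b) = (u, v)) =
       (\<Sum>a\<in>Poly_Mapping.keys p. if a = u then Poly_Mapping.lookup p u * Poly_Mapping.lookup q v else 0)"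
    proof (rule sum.cong[OF refl])
      fix a
      show "(\<Sum>b\<in>Poly_Mapping.keys q. Poly_Mapping.lookup p a * Poly_Mapping.lookup q b when (a, b) = (u, v)) =
          (if a = u then Poly_Mapping.lookup p u * Poly_Mapping.lookup q v else 0)"
        by (cases "a = u") (simp_all add: when_def in_keys_iff sum.delta)
    qed
    also have "\<dots> = Poly_Mapping.lookup p u * Poly_Mapping.lookup q v"
      by (auto simp: in_keys_iff)
    finally show ?thesis by (simp add: Poly_Mapping.lookup_sum lookup_single)
  qed
  then show "fps_nth (coord (u, v) (ftens x y)) N = fps_nth (coord u x * coord v y) N"
    by (simp add: coord_def ftens_def Poly_Mapping.lookup_sum[of _ "{..N}"] fps_mult_nth atLeast0AtMost)
qed

lemma coord_pair_eqI: "(\<And>u v. coord (u, v) x = coord (u, v) y) \<Longrightarrow> x = y"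
  by (rule coord_eqI) auto

lemma ftens_bilinear:
  "ftens (x + x') y = ftens x y + ftens x' y" "ftens x (y + y') = ftens x y + ftens x y'"
  "ftens (scal c * x) y = scal c * ftens x y" "ftens x (scal c * y) = scal c * ftens x y"
  by (rule coord_pair_eqI; simp add: algebra_simps)+

lemma lin_ftens: "is_linear (\<lambda>x. ftens x y)" "is_linear (ftens x)"
  by (simp_all add: is_linear_def ftens_bilinear)

lemma ftens_mon: "ftens (mon u) (mon v) = mon (u, v)"
  by (rule coord_pair_eqI) (simp add: coord_mon)

lemma ftens_one: "ftens 1 1 = 1"
  by (simp add: ftens_mon zero_prod_def[symmetric] flip: mon_zero) 

lemma ftens_mult: "ftens x y * ftens x' y' = ftens (x * x') (y * y')"
proof -
  have 1: "ftens (mon u) (mon v) * ftens x' y' = ftens (mon u * x') (mon v * y')" for u v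
    by (rule bilin_eqI[of "\<lambda>x' y'. ftens (mon u) (mon v) * ftens x' y'" "\<lambda>x' y'. ftens (mon u * x') (mon v * y')"])
      (auto simp: is_linear_def ftens_bilinear algebra_simps scal_left_commute ftens_mon simp flip: mon_add)
  show ?thesis
    by (rule bilin_eqI[of "\<lambda>x y. ftens x y * ftens x' y'" "\<lambda>x y. ftens (x * x') (y * y')"])
      (auto simp: 1, auto simp: is_linear_def ftens_bilinear algebra_simps)
qed

lemma alg_ftens_left: "is_alg_hom (\<lambda>x. ftens x 1)"
  and alg_ftens_right: "is_alg_hom (ftens 1)"
  by (auto simp: is_alg_hom_def lin_ftens ftens_one ftens_mult)

text \<open>The completed tensor square of \<open>f\<close>, prescribed on pairs of words;
  \<open>tmap_ftens\<close> gives the expected formula on all tensors when \<open>f\<close> is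
  linear.\<close>

definition tmap where "tmap f = lin_ext (\<lambda>(u, v). ftens (f (mon u)) (f (mon v)))"

lemma lin_tmap: "is_linear (tmap f)"
  by (simp add: tmap_def lin_lin_ext)

lemma tmap_ftens: assumes f: "is_linear f" shows "tmap f (ftens x y) = ftens (f x) (f y)"
  by (rule bilin_eqI[of "\<lambda>x y. tmap f (ftens x y)" "\<lambda>x y. ftens (f x) (f y)"])
    (auto simp: is_linear_def ftens_bilinear is_linearD[OF f] is_linearD[OF lin_tmap], simp add: ftens_mon tmap_def)

lemma alg_tmap: assumes f: "is_alg_hom f" shows "is_alg_hom (tmap f)"
proof (rule alg_linI)
  note [simp] = tmap_ftens[OF is_alg_homD(1)[OF f]]
  show "tmap f 1 = 1" by (simp add: is_alg_homD[OF f] flip: ftens_one) 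
  show "tmap f (mon u * mon v) = tmap f (mon u) * tmap f (mon v)" for u v
    by (cases u; cases v) (simp add: ftens_mult is_alg_homD[OF f] flip: ftens_mon)
qed (rule lin_tmap)

lemma tmap_inverse:
  assumes "is_linear f" "is_linear g" "\<And>x. f (g x) = x"
  shows "tmap f (tmap g x) = x"
proof (rule lin_eqI[of "\<lambda>x. tmap f (tmap g x)"])
  show "tmap f (tmap g (mon w)) = mon w" for w
    by (cases w) (simp add: tmap_ftens assms flip: ftens_mon)
qed (auto intro: lin_ident lin_compose lin_tmap)

section \<open>The exponential series\<close>

lemma hexp_hsum: "hexp x = hsum (\<lambda>n. scal (fps_const (1 / fact n)) * x ^ n)"
  unfolding hexp_def suminf_hsum[symmetric] by (simp add: scal_mult_assoc mult.commute)

text \<open>The divided difference \<open>(exp (\<hbar> x) - 1) / \<hbar>\<close>.\<close>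

definition hexp_quot where "hexp_quot x = hsum (\<lambda>n. scal (fps_const (1 / fact (Suc n))) * x ^ Suc n)"

lemma hexp_hexp_quot: "hexp x = 1 + scal fps_X * hexp_quot x"
  unfolding hexp_hsum hexp_quot_def by (subst hsum_Suc) simp

lemma alg_hexp: "is_alg_hom g \<Longrightarrow> g (hexp x) = hexp (g x)"
  by (simp add: hexp_hsum lin_hsum is_alg_homD is_linearD)

lemma closed_submodule_hexp: "closed_submodule S \<Longrightarrow> (\<And>n. x ^ n \<in> S) \<Longrightarrow> hexp x \<in> S"
  unfolding hexp_hsum by (intro closed_submodule_hsum closed_submodule_scal)

lemma single_sum: "Poly_Mapping.single w (\<Sum>i\<in>I. f i) = (\<Sum>i\<in>I. Poly_Mapping.single w (f i))"
  by (induction I rule: infinite_finite_induct) (simp_all add: single_add)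

text \<open>Identifies the factors produced by exchanging exponentials and generators with the
  \<open>q\<close>-powers that occur in the Serre coefficients.\<close>

lemma hexp_scal: "hexp (scal c) = scal (qexp c)"
proof (rule fps_ext)
  fix n
  have "fps_nth (qexp c) n = (\<Sum>i\<le>n. (1 / fact i) * fps_nth (c ^ i) (n - i))"
    by (auto simp: qexp_def fps_compose_nth atLeast0AtMost power_mult_distrib fps_X_power_mult_nth intro!: sum.cong)
  then show "fps_nth (hexp (scal c)) n = fps_nth (scal (qexp c)) n"
    by (simp add: hexp_hsum hsum_def single_sum flip: scal_power scal_mult)
qed

section \<open>Congruence modulo a closed ideal\<close>

locale mod_closed_ideal =
  fixes J :: "('m::monoid_add \<Rightarrow>\<^sub>0 ('k::field_char_0)) fps set"
  assumes J: "is_closed_ideal J"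
begin

definition eqv (infix "\<doteq>" 50) where "x \<doteq> y \<longleftrightarrow> x - y \<in> J"

lemmas closed_submodule = is_closed_ideal_closed_submodule[OF J]

lemma eqv_refl [simp]: "x \<doteq> x"
  by (simp add: eqv_def closed_submodule_zero[OF closed_submodule])
lemma eqv_sym: "x \<doteq> y \<Longrightarrow> y \<doteq> x"
  using closed_submodule_uminus[OF closed_submodule, of "x - y"] by (simp add: eqv_def)
lemma eqv_trans [trans]: "x \<doteq> y \<Longrightarrow> y \<doteq> z \<Longrightarrow> x \<doteq> z"
  using closed_submodule_add[OF closed_submodule, of "x - y" "y - z"] by (simp add: eqv_def)
lemma eqv_eq_trans [trans]: "x \<doteq> y \<Longrightarrow> y = z \<Longrightarrow> x \<doteq> z"
  "x = y \<Longrightarrow> y \<doteq> z \<Longrightarrow> x \<doteq> z" by auto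
lemma eqv_add: "x \<doteq> y \<Longrightarrow> x' \<doteq> y' \<Longrightarrow> x + x' \<doteq> y + y'"
  using closed_submodule_add[OF closed_submodule, of "x - y" "x' - y'"] by (simp add: eqv_def algebra_simps)
lemma eqv_diff: "x \<doteq> y \<Longrightarrow> x' \<doteq> y' \<Longrightarrow> x - x' \<doteq> y - y'"
  using closed_submodule_diff[OF closed_submodule, of "x - y" "x' - y'"] by (simp add: eqv_def algebra_simps)
lemma eqv_uminus: "x \<doteq> y \<Longrightarrow> - x \<doteq> - y"
  using eqv_diff[of 0 0 x y] by simp
lemma eqv_mult: "x \<doteq> y \<Longrightarrow> x' \<doteq> y' \<Longrightarrow> x * x' \<doteq> y * y'"
  using closed_submodule_add[OF closed_submodule is_closed_ideal_mult(2)[OF J, of "x - y" x'] is_closed_ideal_mult(1)[OF J, of "x' - y'" y]]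
  by (simp add: eqv_def algebra_simps)
lemma eqv_sum: "(\<And>i. i \<in> I \<Longrightarrow> f i \<doteq> g i) \<Longrightarrow> sum f I \<doteq> sum g I"
  using closed_submodule_sum[OF closed_submodule, of I "\<lambda>i. f i - g i"] by (simp add: eqv_def sum_subtractf)
lemma eqv_power: "x \<doteq> y \<Longrightarrow> x ^ n \<doteq> y ^ n"
  by (induction n) (auto intro: eqv_mult)
text \<open>Here the closedness of \<open>J\<close> enters: termwise congruent series are congruent,
  and so exponentials respect congruence.\<close>

lemma eqv_hsum: "(\<And>n. a n \<doteq> b n) \<Longrightarrow> hsum a \<doteq> hsum b"
  using closed_submodule_hsum[OF closed_submodule, of "\<lambda>n. a n - b n"] by (simp add: eqv_def hsum_diff)
lemma eqv_hexp: "x \<doteq> y \<Longrightarrow> hexp x \<doteq> hexp y"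
  unfolding hexp_hsum by (intro eqv_hsum eqv_mult eqv_power eqv_refl)
lemma eqv_hexp_quot: "x \<doteq> y \<Longrightarrow> hexp_quot x \<doteq> hexp_quot y"
  unfolding hexp_quot_def by (intro eqv_hsum eqv_mult eqv_power eqv_refl)

lemma eqv_mult_left: "x \<doteq> y \<Longrightarrow> z * x \<doteq> z * y"
  and eqv_mult_right: "x \<doteq> y \<Longrightarrow> x * z \<doteq> y * z"
  by (auto intro: eqv_mult)

lemma intertwine_power: "A * X \<doteq> Y * A \<Longrightarrow> A * X ^ n \<doteq> Y ^ n * A"
proof (induction n)
  case (Suc n)
  have "A * X ^ Suc n = (A * X ^ n) * X" by (simp only: power_Suc2 mult.assoc)
  also have "\<dots> \<doteq> (Y ^ n * A) * X" by (intro eqv_mult_right Suc)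
  also have "\<dots> = Y ^ n * (A * X)" by (simp only: mult.assoc)
  also have "\<dots> \<doteq> Y ^ n * (Y * A)" by (intro eqv_mult_left Suc)
  also have "\<dots> = Y ^ Suc n * A" by (simp only: power_Suc2 mult.assoc)
  finally show ?case .
qed simp

text \<open>Holds term by term in the exponential series. It is the source of all commutation rules
  with exponentials below, including those of the toral twist.\<close>

lemma intertwine_hexp: "A * X \<doteq> Y * A \<Longrightarrow> A * hexp X \<doteq> hexp Y * A"
  unfolding hexp_hsum hsum_mult_left hsum_mult_right
  by (intro eqv_hsum)
    (simp add: mult.assoc scal_left_commute, intro eqv_mult_left intertwine_power)

text \<open>The binomial theorem for elements that commute only modulo \<open>J\<close>. In divided
  powers it has no binomial coefficients and matches the Cauchy product of two exponential
  series.\<close>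

lemma binomial_divided_powers:
  assumes XY: "X * Y \<doteq> Y * X"
  shows "scal (fps_const (1 / fact n)) * (X + Y) ^ n \<doteq>
    (\<Sum>i\<le>n. (scal (fps_const (1 / fact i)) * X ^ i) * (scal (fps_const (1 / fact (n - i))) * Y ^ (n - i)))"
proof (induction n)
  case (Suc n)
  define c :: "nat \<Rightarrow> ('m \<Rightarrow>\<^sub>0 'k) fps" where "c n = scal (fps_const (of_nat n))" for n
  define a b where "a i = scal (fps_const (1 / fact i)) * X ^ i"
    and "b i = scal (fps_const (1 / fact i)) * Y ^ i" for i
  have cmul: "scal (fps_const (1 / fact (Suc n))) = scal (fps_const (inverse (of_nat (Suc n)))) * scal (fps_const (1 / fact n))" for n
    by (simp flip: scal_mult add: field_simps)
  have ccancel: "scal (fps_const (inverse (of_nat (Suc n)))) * (c (Suc n) * x) = x" for x n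
    unfolding c_def scal_mult_assoc by (simp flip: of_nat_Suc)
  have cS: "c (Suc i) * (scal (fps_const (1 / fact (Suc i))) * x) = scal (fps_const (1 / fact i)) * x" for i x
    unfolding c_def scal_mult_assoc by (simp flip: of_nat_Suc)
  \<comment> \<open>Multiplying the divided power \<open>a i\<close> by \<open>X\<close> raises its
    index at the cost of the integer \<open>Suc i\<close>; the same holds for \<open>b\<close> and
    \<open>Y\<close>.\<close>
  have Xa: "X * a i = c (Suc i) * a (Suc i)" for i
    unfolding a_def cS by (simp add: scal_left_commute)
  have Yb: "Y * b i = c (Suc i) * b (Suc i)" for i
    unfolding b_def cS by (simp add: scal_left_commute)
  have Ya: "Y * a i \<doteq> a i * Y" for i
  proof -
    have "Y * a i = scal (fps_const (1 / fact i)) * (Y * X ^ i)" by (simp add: a_def scal_left_commute)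
    also have "\<dots> \<doteq> scal (fps_const (1 / fact i)) * (X ^ i * Y)"
      by (rule eqv_mult_left[OF intertwine_power[OF eqv_sym[OF XY]]])
    finally show ?thesis by (simp add: a_def mult.assoc)
  qed
  have c_add: "c (i + j) * x = c i * x + c j * x" for i j x
    by (simp add: c_def scal_add distrib_right flip: fps_const_add)
  have "(X + Y) * (\<Sum>i\<le>n. a i * b (n - i)) = (\<Sum>i\<le>n. X * a i * b (n - i)) + (\<Sum>i\<le>n. (Y * a i) * b (n - i))"
    by (simp add: algebra_simps sum_distrib_left sum.distrib)
  also have "\<dots> \<doteq> (\<Sum>i\<le>n. X * a i * b (n - i)) + (\<Sum>i\<le>n. (a i * Y) * b (n - i))"
    by (intro eqv_add eqv_sum eqv_mult_right Ya eqv_refl)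
  also have "(\<Sum>i\<le>n. X * a i * b (n - i)) = (\<Sum>i\<le>n. c (Suc i) * (a (Suc i) * b (Suc n - Suc i)))"
    by (simp add: Xa mult.assoc)
  also have "\<dots> = (\<Sum>i\<le>Suc n. c i * (a i * b (Suc n - i)))"
    by (simp only: sum.atMost_Suc_shift[of "\<lambda>i. c i * (a i * b (Suc n - i))"]) (simp add: c_def)
  also have "(\<Sum>i\<le>n. (a i * Y) * b (n - i)) = (\<Sum>i\<le>n. c (Suc n - i) * (a i * b (Suc n - i)))"
  proof (rule sum.cong[OF refl])
    fix i assume "i \<in> {..n}"
    then have "Suc n - i = Suc (n - i)" by auto
    then show "(a i * Y) * b (n - i) = c (Suc n - i) * (a i * b (Suc n - i))"
      by (simp add: mult.assoc Yb c_def scal_left_commute)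
  qed
  also have "\<dots> = (\<Sum>i\<le>Suc n. c (Suc n - i) * (a i * b (Suc n - i)))"
    by (simp add: c_def)
  \<comment> \<open>Both sums now run up to \<open>Suc n\<close>, the added terms having coefficient
    \<open>c 0\<close>, which vanishes. The weights \<open>i\<close> and \<open>Suc n - i\<close>
    add up to \<open>Suc n\<close>, and this cancels the new factor of the factorial.\<close>
  also have "(\<Sum>i\<le>Suc n. c i * (a i * b (Suc n - i))) + \<dots> = c (Suc n) * (\<Sum>i\<le>Suc n. a i * b (Suc n - i))"
    by (simp only: sum.distrib[symmetric] c_add[symmetric] sum_distrib_left) (auto intro!: sum.cong)
  finally have step: "(X + Y) * (\<Sum>i\<le>n. a i * b (n - i)) \<doteq> c (Suc n) * (\<Sum>i\<le>Suc n. a i * b (Suc n - i))" .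
  let ?d = "scal (fps_const (inverse (of_nat (Suc n)))) :: ('m \<Rightarrow>\<^sub>0 'k) fps"
  have "scal (fps_const (1 / fact (Suc n))) * (X + Y) ^ Suc n =
      ?d * ((X + Y) * (scal (fps_const (1 / fact n)) * (X + Y) ^ n))"
    unfolding cmul by (simp only: power_Suc mult.assoc scal_left_commute[of "X + Y"])
  also have "\<dots> \<doteq> ?d * ((X + Y) * (\<Sum>i\<le>n. a i * b (n - i)))"
    using Suc unfolding a_def b_def by (intro eqv_mult_left)
  also have "\<dots> \<doteq> ?d * (c (Suc n) * (\<Sum>i\<le>Suc n. a i * b (Suc n - i)))"
    by (intro eqv_mult_left step)
  finally show ?case unfolding ccancel a_def b_def .
qed simp

text \<open>The factor \<open>\<hbar>\<close> may be cancelled in the completed free algebra, but not modulo \<open>J\<close>. For this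
  reason the addition formula is proved for the divided difference \<open>hexp_quot\<close>.\<close>

lemma hexp_quot_add:
  assumes XY: "X * Y \<doteq> Y * X"
  shows "hexp_quot (X + Y) \<doteq> hexp_quot X + hexp X * hexp_quot Y"
proof -
  define u where "u n = (\<Sum>i\<le>n. (scal (fps_const (1 / fact i)) * X ^ i) * (scal (fps_const (1 / fact (n - i))) * Y ^ (n - i)))" for n
  \<comment> \<open>This computation with \<open>u\<close> is an exact equality in the free algebra,
    where \<hbar> may be cancelled. Only the comparison of the powers of \<open>X + Y\<close> with
    \<open>u\<close> is a congruence.\<close>
  have "scal fps_X * hsum (\<lambda>n. u (Suc n)) = hsum u - u 0"
    by (subst (2) hsum_Suc) simp
  also have "\<dots> = hexp X * hexp Y - 1"
    by (simp add: hexp_hsum hsum_mult u_def[abs_def])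
  also have "\<dots> = scal fps_X * (hexp_quot X + hexp X * hexp_quot Y)"
    unfolding hexp_hexp_quot[of Y] distrib_left
    by (simp add: scal_left_commute hexp_hexp_quot[of X])
  finally have "hsum (\<lambda>n. u (Suc n)) = hexp_quot X + hexp X * hexp_quot Y"
    by (rule scal_cancel[rotated]) simp
  moreover have "hexp_quot (X + Y) \<doteq> hsum (\<lambda>n. u (Suc n))"
    unfolding hexp_quot_def u_def by (intro eqv_hsum binomial_divided_powers XY)
  ultimately show ?thesis by simp
qed

lemma hexp_add:
  assumes XY: "X * Y \<doteq> Y * X"
  shows "hexp (X + Y) \<doteq> hexp X * hexp Y"
proof -
  have "hexp (X + Y) \<doteq> 1 + scal fps_X * (hexp_quot X + hexp X * hexp_quot Y)"
    unfolding hexp_hexp_quot[of "X + Y"] by (intro eqv_add eqv_mult_left hexp_quot_add XY eqv_refl)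
  also have "\<dots> = hexp X * hexp Y"
    unfolding hexp_hexp_quot[of Y] by (simp add: distrib_left scal_left_commute add.assoc[symmetric] hexp_hexp_quot[of X, symmetric])
  finally show ?thesis .
qed

end

text \<open>The instance \<open>J = {0}\<close>, where congruence is equality.\<close>

lemmas hexp_add_eq = mod_closed_ideal.hexp_add[OF mod_closed_ideal.intro[OF is_closed_ideal_singleton_zero],
  unfolded mod_closed_ideal.eqv_def[OF mod_closed_ideal.intro[OF is_closed_ideal_singleton_zero]], simplified]

lemma hexp_zero [simp]: "hexp 0 = 1"
  using hexp_scal[of 0] by (simp add: qexp_def)

lemma hexp_minus_inverse: "hexp x * hexp (- x) = 1" "hexp (- x) * hexp x = 1"
  using hexp_add_eq[of x "- x"] hexp_add_eq[of "- x" x] by simp_all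

lemma scal_inject: "scal c = (scal d :: ('m::monoid_add \<Rightarrow>\<^sub>0 'k::field_char_0) fps) \<longleftrightarrow> c = d"
proof
  assume "scal c = (scal d :: ('m \<Rightarrow>\<^sub>0 'k) fps)"
  then have "coord 0 (scal c * mon (0::'m)) = coord 0 (scal d * mon (0::'m))"
    by (simp only:)
  then show "c = d" unfolding coord_scal coord_mon by simp
qed simp

text \<open>Scalars are embedded by \<open>scal\<close> into an auxiliary completed monoid algebra,
  where the addition formula for \<open>hexp\<close> is available, and \<open>scal\<close> is
  injective.\<close>

lemma qexp_add: "qexp (a + b) = qexp a * qexp (b :: 'k::field_char_0 fps)"
proof -
  have "scal (qexp (a + b)) = (scal (qexp a * qexp b) :: (nat \<Rightarrow>\<^sub>0 'k) fps)"
    unfolding scal_mult hexp_scal[symmetric] scal_add by (rule hexp_add_eq) (simp flip: scal_mult add: mult.commute)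
  then show ?thesis by (simp only: scal_inject)
qed

lemma qexp_zero [simp]: "qexp 0 = 1"
  by (simp add: qexp_def)

lemma qexp_minus: "qexp (- a) = inverse (qexp a)"
  using qexp_add[of a "- a"] fps_inverse_unique[of "qexp a" "qexp (- a)"] by simp

section \<open>Ideals and quotients\<close>

text \<open>The sets of series with a prescribed cutoff are open and form a neighbourhood basis, so
  closure means approximation modulo every power of \<hbar>.\<close>

lemma closure_fps_iff: "x \<in> closure K \<longleftrightarrow> (\<forall>n. \<exists>y\<in>K. \<exists>r. x = y + scal (fps_X ^ n) * r)"
proof -
  let ?U = "\<lambda>n. {G. fps_cutoff n G = fps_cutoff n x}"
  have "(\<forall>n. \<exists>y\<in>K. fps_cutoff n x = fps_cutoff n y)" if "x \<in> closure K"
  proof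
    fix n
    have "?U n \<inter> closure K \<noteq> {}" using that by blast
    then have "?U n \<inter> K \<noteq> {}" using open_Int_closure_eq_empty[OF open_fps_cutoff, of n x K] by blast
    then show "\<exists>y\<in>K. fps_cutoff n x = fps_cutoff n y" by force
  qed
  moreover have "x \<in> closure K" if *: "\<forall>n. \<exists>y\<in>K. fps_cutoff n x = fps_cutoff n y"
  proof (rule ccontr)
    assume "x \<notin> closure K"
    then obtain n where "?U n \<subseteq> - closure K"
      using open_fps_iff[of "- closure K"] by auto
    moreover obtain y where "y \<in> K" "fps_cutoff n x = fps_cutoff n y" using * by blast
    ultimately show False using closure_subset[of K] by auto
  qed
  ultimately show ?thesis unfolding eq_mod_X_iff by blast
qed

lemma free_alg_simps [simp]:
  "carrier free_alg = UNIV" "monoid.mult free_alg = (*)" "one free_alg = 1" "zero free_alg = 0"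
  "add free_alg = (+)" "module.smult free_alg = (\<lambda>c x. scal c * x)"
  by (simp_all add: free_alg_def)

lemma ring_free_alg: "ring free_alg"
proof (rule ringI)
  show "abelian_group free_alg"
    by (rule abelian_groupI) (auto simp: algebra_simps intro: exI[of _ "- _"] left_minus)
  show "monoid free_alg" by (rule monoidI) (auto simp: algebra_simps)
qed (auto simp: algebra_simps)

lemma ideal_free_algI:
  assumes "0 \<in> I" "\<And>x y. x \<in> I \<Longrightarrow> y \<in> I \<Longrightarrow> x + y \<in> I" "\<And>a x. x \<in> I \<Longrightarrow> a * x \<in> I \<and> x * a \<in> I"
  shows "ideal I free_alg"
proof (rule idealI[OF ring_free_alg])
  interpret ring free_alg by (rule ring_free_alg)
  show "subgroup I (add_monoid free_alg)"
  proof (rule add.subgroupI)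
    fix a assume a: "a \<in> I"
    have "\<ominus>\<^bsub>free_alg\<^esub> a = - 1 * a"
      by (rule minus_equality) auto
    then show "\<ominus>\<^bsub>free_alg\<^esub> a \<in> I" using assms(3)[OF a, of "-1"] by simp
  qed (use assms in auto)
qed (use assms in auto)

lemma ideal_free_algD:
  assumes "ideal I free_alg"
  shows "0 \<in> I" "x \<in> I \<Longrightarrow> y \<in> I \<Longrightarrow> x + y \<in> I" "x \<in> I \<Longrightarrow> a * x \<in> I" "x \<in> I \<Longrightarrow> x * a \<in> I"
  using assms additive_subgroup.zero_closed[OF ideal.axioms(1)[OF assms]]
    additive_subgroup.a_closed[OF ideal.axioms(1)[OF assms], of x y]
    ideal.I_l_closed[OF assms, of x a] ideal.I_r_closed[OF assms, of x a] by auto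

text \<open>Powers of \<hbar> are central, so an approximation error stays a multiple of the same
  power under sums and under multiplication from either side.\<close>

lemma is_closed_ideal_closed_ideal: "is_closed_ideal (closed_ideal S)"
proof -
  interpret ring free_alg by (rule ring_free_alg)
  have I: "ideal (genideal free_alg S) free_alg" by (rule genideal_ideal) simp
  note D = ideal_free_algD[OF I]
  show ?thesis
    unfolding is_closed_ideal_def
  proof (intro conjI ballI allI)
    show "0 \<in> closed_ideal S"
      unfolding closed_ideal_def using D(1) closure_subset by blast
    show "x + y \<in> closed_ideal S" if "x \<in> closed_ideal S" "y \<in> closed_ideal S" for x y
      unfolding closed_ideal_def closure_fps_iff
    proof
      fix n
      from that obtain x' r y' r' where "x' \<in> genideal free_alg S" "x = x' + scal (fps_X ^ n) * r"
        "y' \<in> genideal free_alg S" "y = y' + scal (fps_X ^ n) * r'"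
        unfolding closed_ideal_def closure_fps_iff by meson
      then show "\<exists>z\<in>genideal free_alg S. \<exists>r. x + y = z + scal (fps_X ^ n) * r"
        by (intro bexI[of _ "x' + y'"] exI[of _ "r + r'"] D(2)) (auto simp: algebra_simps)
    qed
    show "a * x \<in> closed_ideal S" if "x \<in> closed_ideal S" for a x
      unfolding closed_ideal_def closure_fps_iff
    proof
      fix n
      from that obtain x' r where "x' \<in> genideal free_alg S" "x = x' + scal (fps_X ^ n) * r"
        unfolding closed_ideal_def closure_fps_iff by meson
      then show "\<exists>z\<in>genideal free_alg S. \<exists>r. a * x = z + scal (fps_X ^ n) * r"
        by (intro bexI[of _ "a * x'"] exI[of _ "a * r"] D) (auto simp: distrib_left scal_left_commute)
    qed
    show "x * a \<in> closed_ideal S" if "x \<in> closed_ideal S" for a x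
      unfolding closed_ideal_def closure_fps_iff
    proof
      fix n
      from that obtain x' r where "x' \<in> genideal free_alg S" "x = x' + scal (fps_X ^ n) * r"
        unfolding closed_ideal_def closure_fps_iff by meson
      then show "\<exists>z\<in>genideal free_alg S. \<exists>r. x * a = z + scal (fps_X ^ n) * r"
        by (intro bexI[of _ "x' * a"] exI[of _ "r * a"] D) (auto simp: distrib_right mult.assoc)
    qed
    show "h_closed (closed_ideal S)"
      unfolding h_closed_def
    proof (intro allI impI)
      fix x assume x: "\<forall>n. \<exists>y\<in>closed_ideal S. \<exists>r. x = y + scal (fps_X ^ n) * r"
      show "x \<in> closed_ideal S"
        unfolding closed_ideal_def closure_fps_iff
      proof
        fix n
        from x obtain y r where y: "y \<in> closed_ideal S" "x = y + scal (fps_X ^ n) * r" by blast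
        then obtain z r' where "z \<in> genideal free_alg S" "y = z + scal (fps_X ^ n) * r'"
          unfolding closed_ideal_def closure_fps_iff by blast
        with y show "\<exists>z\<in>genideal free_alg S. \<exists>r. x = z + scal (fps_X ^ n) * r"
          by (intro bexI[of _ z] exI[of _ "r' + r"]) (auto simp: distrib_left)
      qed
    qed
  qed
qed

lemma closed_ideal_superset: "S \<subseteq> closed_ideal S"
  using ring.genideal_self[OF ring_free_alg, of S] closure_subset by (auto simp: closed_ideal_def)

lemma closed_ideal_minimal: "is_closed_ideal J \<Longrightarrow> S \<subseteq> J \<Longrightarrow> closed_ideal S \<subseteq> J"
proof -
  assume J: "is_closed_ideal J" and S: "S \<subseteq> J"
  have "ideal J free_alg" using J by (intro ideal_free_algI) (auto simp: is_closed_ideal_def)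
  then have "genideal free_alg S \<subseteq> J" using S ring.genideal_minimal[OF ring_free_alg] by blast
  then have "\<And>x n. x \<in> closure (genideal free_alg S) \<Longrightarrow> \<exists>y\<in>J. \<exists>r. x = y + scal (fps_X ^ n) * r"
    unfolding closure_fps_iff by (metis subsetD)
  then show ?thesis
    unfolding closed_ideal_def by (intro subsetI, rule closed_submodule_hclosedD[OF is_closed_ideal_closed_submodule[OF J]]) simp
qed

text \<open>The preimage of a closed ideal under an algebra morphism is a closed ideal, hence it is
  enough to test the generators.\<close>

lemma closed_ideal_image_subset:
  assumes "is_alg_hom f" "\<And>x. x \<in> S \<Longrightarrow> f x \<in> closed_ideal S'" "x \<in> closed_ideal S"
  shows "f x \<in> closed_ideal S'"
  using closed_ideal_minimal[OF is_closed_ideal_vimage[OF assms(1) is_closed_ideal_closed_ideal], of S S'] assms(2,3) by auto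

section \<open>Arithmetic of cosets\<close>

lemma cls_eq: "cls J x = (\<lambda>h. h + x) ` J"
  by (auto simp: cls_def a_r_coset_def r_coset_def)

lemma quot_alg_simps:
  "carrier (quot_alg J) = range (cls J)"
  "C \<otimes>\<^bsub>quot_alg J\<^esub> D = (\<Union>x\<in>C. \<Union>y\<in>D. cls J (x * y))"
  "C \<oplus>\<^bsub>quot_alg J\<^esub> D = (\<Union>x\<in>C. \<Union>y\<in>D. {x + y})"
  "\<one>\<^bsub>quot_alg J\<^esub> = cls J 1"
  "\<zero>\<^bsub>quot_alg J\<^esub> = J"
  "c \<odot>\<^bsub>quot_alg J\<^esub> C = (\<Union>x\<in>C. cls J (scal c * x))"
  by (auto simp: quot_alg_def ring.defs module.defs FactRing_def A_RCOSETS_def RCOSETS_def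
    rcoset_mult_def cls_def a_r_coset_def set_add_def set_mult_def)

context mod_closed_ideal
begin

lemma cls_mem_iff: "y \<in> cls J x \<longleftrightarrow> y \<doteq> x"
  by (force simp: cls_eq eqv_def image_iff algebra_simps)

lemma cls_eq_iff: "cls J x = cls J y \<longleftrightarrow> x \<doteq> y"
proof
  assume "cls J x = cls J y"
  then show "x \<doteq> y" by (metis cls_mem_iff eqv_refl)
next
  assume "x \<doteq> y"
  then have "z \<doteq> x \<longleftrightarrow> z \<doteq> y" for z
    using eqv_trans[of z x y] eqv_trans[of z y x] eqv_sym[of x y] by blast
  then show "cls J x = cls J y"
    by (simp add: set_eq_iff cls_mem_iff)
qed

lemma quot_mult: "cls J x \<otimes>\<^bsub>quot_alg J\<^esub> cls J y = cls J (x * y)"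
proof -
  have "(\<Union>a\<in>cls J x. \<Union>b\<in>cls J y. cls J (a * b)) = (\<Union>a\<in>cls J x. \<Union>b\<in>cls J y. cls J (x * y))"
    by (intro SUP_cong refl) (simp add: cls_eq_iff cls_mem_iff eqv_mult)
  also have "\<dots> = cls J (x * y)"
    using cls_mem_iff[of x x] cls_mem_iff[of y y] by auto
  finally show ?thesis by (simp add: quot_alg_simps)
qed

lemma quot_add: "cls J x \<oplus>\<^bsub>quot_alg J\<^esub> cls J y = cls J (x + y)"
proof -
  have "\<exists>a. a \<doteq> x \<and> (\<exists>b. b \<doteq> y \<and> z = a + b)" if "z \<doteq> x + y" for z
    using that by (intro exI[of _ "z - y"] conjI exI[of _ y]) (auto simp: eqv_def algebra_simps)
  then show ?thesis
    by (auto simp: quot_alg_simps set_eq_iff Bex_def cls_mem_iff intro: eqv_add)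
qed

lemma quot_smult: "c \<odot>\<^bsub>quot_alg J\<^esub> cls J x = cls J (scal c * x)"
proof -
  have "(\<Union>a\<in>cls J x. cls J (scal c * a)) = (\<Union>a\<in>cls J x. cls J (scal c * x))"
    by (intro SUP_cong refl) (simp add: cls_eq_iff cls_mem_iff eqv_mult_left)
  also have "\<dots> = cls J (scal c * x)"
    using cls_mem_iff[of x x] by auto
  finally show ?thesis by (simp add: quot_alg_simps)
qed

text \<open>\<open>m_inv\<close> depends on the carrier. The lemma allows a smaller carrier
  \<open>M\<close>, because the twist of a Borel part is inverted inside the tensor square of that
  part.\<close>

lemma quot_inv:
  assumes M: "monoid.mult M = monoid.mult (quot_alg J)" "one M = one (quot_alg J)"
    "carrier M \<subseteq> range (cls J)" "cls J y \<in> carrier M"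
    and xy: "x * y \<doteq> 1" "y * x \<doteq> 1"
  shows "inv\<^bsub>M\<^esub> (cls J x) = cls J y"
proof -
  have *: "cls J a \<otimes>\<^bsub>M\<^esub> cls J b = \<one>\<^bsub>M\<^esub> \<longleftrightarrow> a * b \<doteq> 1" for a b
    by (simp add: M quot_mult quot_alg_simps(4) cls_eq_iff)
  show ?thesis
    unfolding m_inv_def
  proof (rule the_equality)
    show "cls J y \<in> carrier M \<and> cls J x \<otimes>\<^bsub>M\<^esub> cls J y = \<one>\<^bsub>M\<^esub> \<and> cls J y \<otimes>\<^bsub>M\<^esub> cls J x = \<one>\<^bsub>M\<^esub>"
      unfolding * using xy M by blast
    fix C assume C: "C \<in> carrier M \<and> cls J x \<otimes>\<^bsub>M\<^esub> C = \<one>\<^bsub>M\<^esub> \<and> C \<otimes>\<^bsub>M\<^esub> cls J x = \<one>\<^bsub>M\<^esub>"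
    then obtain z where z: "C = cls J z" using M by blast
    with C have zx: "z * x \<doteq> 1" by (simp add: *)
    have "z = z * 1" by simp
    also have "\<dots> \<doteq> z * (x * y)" by (rule eqv_mult_left[OF eqv_sym[OF xy(1)]])
    also have "\<dots> = z * x * y" by (simp add: mult.assoc)
    also have "\<dots> \<doteq> 1 * y" by (intro eqv_mult_right zx)
    finally show "C = cls J y" by (simp add: z cls_eq_iff)
  qed
qed

end

abbreviation tor :: "'h \<Rightarrow> ('k::field_char_0, 'h, 'i) uqfree" where
  "tor T \<equiv> gen (Tor T)"

section \<open>The twisting automorphism of the free algebra\<close>

text \<open>The element \<open>\<ell>\<^sub>i\<close> in two versions, in \<open>\<hh>\<close> and in the free algebra; they agree only modulo the
  relations. The second one changes sign with \<open>\<Phi>\<close>, hence \<open>twist_map\<close> is invertible before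
  passing to the quotient.\<close>

definition twist_elt where
  "twist_elt R H \<Phi> i = (\<Sum>g\<in>UNIV. \<Sum>k\<in>UNIV. hscale R (- (fps_const (1/2) * root R i (H g) * \<Phi> $ g $ k)) (H k))"

definition twist_exponent :: "('k::field_char_0, 'h::ab_group_add, 'i) realization \<Rightarrow> ('g::finite \<Rightarrow> 'h) \<Rightarrow> 'k fps^'g^'g \<Rightarrow> 'i \<Rightarrow> ('k, 'h, 'i) uqfree" where
  "twist_exponent R H \<Phi> i = (\<Sum>g\<in>UNIV. \<Sum>k\<in>UNIV. scal (- (fps_const (1/2) * root R i (H g) * \<Phi> $ g $ k)) * tor (H k))"

text \<open>For antisymmetric \<Phi> the one exponential
  \<open>hexp (twist_exponent R H \<Phi> i)\<close> represents both the inverse of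
  \<open>twist_L\<close> and \<open>twist_K\<close>.\<close>

fun twist_gen :: "('k::field_char_0, 'h::ab_group_add, 'i) realization \<Rightarrow> ('g::finite \<Rightarrow> 'h) \<Rightarrow> 'k fps^'g^'g \<Rightarrow> ('h, 'i) uqgen \<Rightarrow> ('k, 'h, 'i) uqfree" where
  "twist_gen R H \<Phi> (Tor T) = tor T"
| "twist_gen R H \<Phi> (E i) = hexp (twist_exponent R H \<Phi> i) * gen (E i)"
| "twist_gen R H \<Phi> (F i) = gen (F i) * hexp (twist_exponent R H \<Phi> i)"

definition twist_map where "twist_map R H \<Phi> = alg_ext (twist_gen R H \<Phi>)"

lemma alg_twist_map: "is_alg_hom (twist_map R H \<Phi>)"
  by (simp add: twist_map_def alg_alg_ext)

lemma twist_map_gen [simp]: "twist_map R H \<Phi> (gen x) = twist_gen R H \<Phi> x"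
  by (simp add: twist_map_def)

lemma twist_map_exponent: "twist_map R H \<Phi> (twist_exponent R' H' \<Phi>' i) = twist_exponent R' H' \<Phi>' i"
  by (simp add: twist_exponent_def is_linearD[OF is_alg_homD(1)[OF alg_twist_map]])

lemma twist_exponent_minus: "twist_exponent R H (- \<Phi>) i = - twist_exponent R H \<Phi> i"
  by (simp add: twist_exponent_def scal_minus sum_negf)

text \<open>The exponents contain only generators \<open>Tor\<close>, so the map fixes them, and
  exponentials of opposite elements cancel exactly.\<close>

lemma twist_map_inverse: "twist_map R H \<Phi> (twist_map R H (- \<Phi>) x) = x"
proof (rule alg_eqI[of "\<lambda>x. twist_map R H \<Phi> (twist_map R H (- \<Phi>) x)"])
  note a = alg_twist_map[of R H \<Phi>]
  fix x show "twist_map R H \<Phi> (twist_map R H (- \<Phi>) (gen x)) = gen x"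
    by (cases x) (simp_all add: is_alg_homD[OF a] alg_hexp[OF a] is_linearD[OF is_alg_homD(1)[OF a]] twist_map_exponent
      twist_exponent_minus mult.assoc hexp_minus_inverse, simp_all add: hexp_minus_inverse flip: mult.assoc)
qed (rule alg_compose[OF alg_twist_map alg_twist_map], simp add: is_alg_hom_def lin_ident)

text \<open>The difference is \<hbar> times a series with constant term \<open>2 * r\<close>, a unit
  in characteristic zero. Dividing by it amounts to dividing by \<hbar>.\<close>

lemma qexp_diff_factor:
  fixes r :: "'k::field_char_0"
  assumes "r \<noteq> 0"
  obtains u :: "'k fps" where "qexp (fps_const r) - inverse (qexp (fps_const r)) = fps_X * u" "u * inverse u = 1"
proof -
  let ?k = "qexp (fps_const r) - inverse (qexp (fps_const r))"
  have "fps_nth (qexp c) 0 = 1" "fps_nth (qexp c) 1 = fps_nth c 0" for c :: "'k fps"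
    by (simp_all add: qexp_def fps_compose_nth)
  then have k: "fps_nth ?k 0 = 0" "fps_nth ?k 1 = 2 * r"
    by (simp_all flip: qexp_minus)
  have "?k = fps_X * fps_shift 1 ?k"
  proof (rule fps_ext)
    fix n show "fps_nth ?k n = fps_nth (fps_X * fps_shift 1 ?k) n"
      using k(1) by (cases n) simp_all
  qed
  moreover have "fps_shift 1 ?k * inverse (fps_shift 1 ?k) = 1"
    by (rule inverse_mult_eq_1') (use k(2) assms in simp)
  ultimately show ?thesis by (rule that)
qed

section \<open>Compatibility with the defining relations\<close>

text \<open>The assumptions concern \<open>d\<close>, the module structure and the roots, which a
  twist leaves unchanged; they transfer to the deformed data at once.\<close>

locale uq_data =
  fixes A :: "int^'i::finite^'i" and d :: "'i \<Rightarrow> nat"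
    and P :: "('k::field_char_0) fps^'i^'i"
    and R :: "('k, 'h::ab_group_add, 'i) realization"
  assumes d_pos: "\<And>i. d i > 0"
    and module_hscale: "Modules.module (hscale R)"
    and root_hom: "\<And>i. Modules.module_hom (hscale R) (*) (root R i)"
begin

sublocale J: mod_closed_ideal "uq_ideal A d P R"
  by (simp add: mod_closed_ideal_def uq_ideal_def is_closed_ideal_closed_ideal)

abbreviation ueq (infix "\<doteq>" 50) where "x \<doteq> y \<equiv> J.eqv x y"

lemma rel: "x - y \<in> uq_rels A d P R \<Longrightarrow> x \<doteq> y"
  using closed_ideal_superset[of "uq_rels A d P R", folded uq_ideal_def] by (auto simp: J.eqv_def)

lemma rootD: "root R i (S + T) = root R i S + root R i T" "root R i (hscale R c T) = c * root R i T"
  "root R i 0 = 0" "root R i (- T) = - root R i T" "root R i (S - T) = root R i S - root R i T"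
  "root R i (sum f I) = (\<Sum>j\<in>I. root R i (f j))"
proof -
  interpret h: Modules.module_hom "hscale R" "(*)" "root R i" by (rule root_hom)
  show "root R i (S + T) = root R i S + root R i T" "root R i (hscale R c T) = c * root R i T"
    "root R i 0 = 0" "root R i (- T) = - root R i T" "root R i (S - T) = root R i S - root R i T"
    "root R i (sum f I) = (\<Sum>j\<in>I. root R i (f j))"
    by (simp_all add: h.add h.scale h.zero h.neg h.diff h.sum)
qed

lemma hscale_minus: "hscale R (- c) T = - hscale R c T" "hscale R 0 T = 0"
proof -
  interpret m: Modules.module "hscale R" by (rule module_hscale)
  show "hscale R (- c) T = - hscale R c T" "hscale R 0 T = 0" by simp_all
qed

lemma tor_add: "tor (S + T) \<doteq> tor S + tor T"
  by (rule rel) (rule T_add)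
lemma tor_scale: "tor (hscale R c T) \<doteq> scal c * tor T"
  by (rule rel) (rule T_scale)
lemma tor_zero: "tor 0 \<doteq> 0"
  using tor_scale[of 0 0] by (simp add: hscale_minus)
lemma tor_minus: "tor (- T) \<doteq> - tor T"
proof -
  interpret m: Modules.module "hscale R" by (rule module_hscale)
  show ?thesis using tor_scale[of "-1" T] by (simp add: scal_minus)
qed
lemma tor_sum: "tor (sum f I) \<doteq> (\<Sum>i\<in>I. tor (f i))"
  by (induction I rule: infinite_finite_induct)
    (simp_all add: tor_zero J.eqv_trans[OF tor_add J.eqv_add[OF J.eqv_refl]])

lemma tor_commute: "tor S * tor T \<doteq> tor T * tor S"
  by (rule rel) (rule TT)
lemma tor_E: "tor T * gen (E j) \<doteq> gen (E j) * (tor T + scal (root R j T))"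
  using rel[of "tor T * gen (E j) - gen (E j) * tor T", OF TE]
  by (simp add: J.eqv_def algebra_simps scal_commute)
lemma tor_F: "tor T * gen (F j) \<doteq> gen (F j) * (tor T - scal (root R j T))"
  using rel[of "tor T * gen (F j) - gen (F j) * tor T" "- scal (root R j T) * gen (F j)"] TF[of T j R A d P]
  by (simp add: J.eqv_def algebra_simps scal_commute)
lemma E_tor: "gen (E j) * tor T \<doteq> (tor T + scal (- root R j T)) * gen (E j)"
  using J.eqv_sym[OF tor_E[of T j]] by (simp add: J.eqv_def algebra_simps scal_commute scal_minus)
lemma F_tor: "gen (F j) * tor T \<doteq> (tor T + scal (root R j T)) * gen (F j)"
  using J.eqv_sym[OF tor_F[of T j]] by (simp add: J.eqv_def algebra_simps scal_commute scal_minus)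

lemma hexp_add_scal: "hexp (x + scal c) = scal (qexp c) * hexp x"
  using hexp_add_eq[of x "scal c"] by (simp add: scal_commute hexp_scal)

text \<open>Passing \<open>gen (E j)\<close> shifts \<open>tor T\<close> by a scalar, and the
  exponential of that scalar splits off as a factor. For \<open>F\<close> the shift has the opposite
  sign.\<close>

lemma E_hexp: "gen (E j) * hexp (tor T) \<doteq> scal (qexp (- root R j T)) * (hexp (tor T) * gen (E j))"
  using J.intertwine_hexp[OF E_tor[of j T]] by (simp add: hexp_add_scal mult.assoc)
lemma F_hexp: "gen (F j) * hexp (tor T) \<doteq> scal (qexp (root R j T)) * (hexp (tor T) * gen (F j))"
  using J.intertwine_hexp[OF F_tor[of j T]] by (simp add: hexp_add_scal mult.assoc)
lemma tor_hexp: "tor S * hexp (tor T) \<doteq> hexp (tor T) * tor S"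
  by (rule J.intertwine_hexp[OF tor_commute])
lemma hexp_tor_add: "hexp (tor (S + T)) \<doteq> hexp (tor S) * hexp (tor T)"
  by (rule J.eqv_trans[OF J.eqv_hexp[OF tor_add] J.hexp_add[OF tor_commute]])
lemma hexp_tor_commute: "hexp (tor S) * hexp (tor T) \<doteq> hexp (tor T) * hexp (tor S)"
  by (rule J.intertwine_hexp[OF J.eqv_sym[OF J.intertwine_hexp[OF tor_commute]]])
lemma hexp_tor_minus: "hexp (- tor T) \<doteq> hexp (tor (- T))"
  by (rule J.eqv_hexp[OF J.eqv_sym[OF tor_minus]])

lemma power_q_commute:
  assumes "G * Y \<doteq> scal c * (Y * G)"
  shows "G ^ m * Y ^ n \<doteq> scal (c ^ (m * n)) * (Y ^ n * G ^ m)"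
proof -
  have "G ^ m * Y \<doteq> (scal (c ^ m) * Y) * G ^ m"
  proof (induction m)
    case (Suc m)
    have "G ^ Suc m * Y = G * (G ^ m * Y)" by (simp add: mult.assoc)
    also have "\<dots> \<doteq> G * ((scal (c ^ m) * Y) * G ^ m)" by (rule J.eqv_mult_left[OF Suc])
    also have "\<dots> = scal (c ^ m) * (G * Y) * G ^ m" by (simp only: mult.assoc scal_left_commute[of G])
    also have "\<dots> \<doteq> scal (c ^ m) * (scal c * (Y * G)) * G ^ m"
      by (rule J.eqv_mult_right[OF J.eqv_mult_left[OF assms]])
    also have "\<dots> = (scal (c ^ Suc m) * Y) * G ^ Suc m"
      by (simp add: scal_mult mult.assoc scal_left_commute[of "scal c" "c ^ m"])
    finally show ?case .
  qed simp
  then have "G ^ m * Y ^ n \<doteq> (scal (c ^ m) * Y) ^ n * G ^ m"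
    by (rule J.intertwine_power)
  also have "(scal (c ^ m) * Y) ^ n = scal (c ^ (m * n)) * Y ^ n"
  proof (induction n)
    case (Suc n)
    have "(scal (c ^ m) * Y) ^ Suc n = scal (c ^ m) * (Y * (scal (c ^ (m * n)) * Y ^ n))"
      by (simp only: power_Suc Suc mult.assoc)
    also have "\<dots> = scal (c ^ m * c ^ (m * n)) * Y ^ Suc n"
      by (simp only: scal_left_commute[of Y] scal_mult_assoc power_Suc)
    finally show ?case by (simp add: power_add)
  qed simp
  finally show ?thesis by (simp add: mult.assoc)
qed

text \<open>Collects the exponentials of a Serre monomial on the left. Each of the \<open>a\<close>
  left copies of \<open>Gi\<close> passes \<open>Xj\<close> with a factor \<open>c\<close>, and
  \<open>Gj\<close> passes \<open>b\<close> copies of \<open>Xi\<close> with a factor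
  \<open>c'\<close> each. The abstract form serves both \<open>E\<close> and
  \<open>F\<close>.\<close>

lemma serre_term:
  assumes ii: "Gi * Xi \<doteq> Xi * Gi" and ij: "Gi * Xj \<doteq> scal c * (Xj * Gi)"
    and ji: "Gj * Xi \<doteq> scal c' * (Xi * Gj)" and XX: "Xj * Xi \<doteq> Xi * Xj"
  shows "(Xi * Gi) ^ a * (Xj * Gj) * (Xi * Gi) ^ b \<doteq>
    scal (c ^ a * c' ^ b) * (Xi ^ (a + b) * Xj * (Gi ^ a * Gj * Gi ^ b))"
proof -
  note L = J.eqv_mult_left and Rt = J.eqv_mult_right
  have pow: "(Xi * Gi) ^ n \<doteq> Xi ^ n * Gi ^ n" for n
  proof (induction n)
    case (Suc n)
    have "(Xi * Gi) ^ Suc n = Xi * Gi * (Xi * Gi) ^ n" by simp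
    also have "\<dots> \<doteq> Xi * Gi * (Xi ^ n * Gi ^ n)" by (rule L[OF Suc])
    also have "\<dots> = Xi * (Gi * Xi ^ n) * Gi ^ n" by (simp only: mult.assoc)
    also have "\<dots> \<doteq> Xi * (Xi ^ n * Gi) * Gi ^ n" by (rule Rt[OF L[OF J.intertwine_power[OF ii]]])
    also have "\<dots> = Xi ^ Suc n * Gi ^ Suc n" by (simp add: mult.assoc)
    finally show ?case .
  qed simp
  have ii': "Gi ^ a * Xi ^ b \<doteq> Xi ^ b * Gi ^ a"
    using power_q_commute[of Gi Xi 1 a b] ii by simp
  have ij': "Gi ^ a * Xj \<doteq> scal (c ^ a) * (Xj * Gi ^ a)"
    using power_q_commute[OF ij, of a 1] by simp
  have ji': "Gj * Xi ^ b \<doteq> scal (c' ^ b) * (Xi ^ b * Gj)"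
    using power_q_commute[OF ji, of 1 b] by simp
  have "(Xi * Gi) ^ a * (Xj * Gj) * (Xi * Gi) ^ b \<doteq> (Xi ^ a * Gi ^ a) * (Xj * Gj) * (Xi ^ b * Gi ^ b)"
    by (intro J.eqv_mult pow J.eqv_refl)
  also have "\<dots> = Xi ^ a * (Gi ^ a * Xj) * (Gj * Xi ^ b) * Gi ^ b" by (simp only: mult.assoc)
  also have "\<dots> \<doteq> Xi ^ a * (scal (c ^ a) * (Xj * Gi ^ a)) * (scal (c' ^ b) * (Xi ^ b * Gj)) * Gi ^ b"
    by (intro J.eqv_mult ij' ji' J.eqv_refl)
  also have "\<dots> = scal (c ^ a * c' ^ b) * (Xi ^ a * Xj * (Gi ^ a * Xi ^ b) * Gj * Gi ^ b)"
    by (simp only: mult.assoc scal_left_commute[of "Xi ^ a"] scal_left_commute[of "Xj"]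
       scal_left_commute[of "Gi ^ a"] scal_mult_assoc)
  also have "\<dots> \<doteq> scal (c ^ a * c' ^ b) * (Xi ^ a * Xj * (Xi ^ b * Gi ^ a) * Gj * Gi ^ b)"
    by (intro J.eqv_mult ii' J.eqv_refl)
  also have "\<dots> = scal (c ^ a * c' ^ b) * (Xi ^ a * (Xj * Xi ^ b) * (Gi ^ a * Gj * Gi ^ b))"
    by (simp only: mult.assoc)
  also have "\<dots> \<doteq> scal (c ^ a * c' ^ b) * (Xi ^ a * (Xi ^ b * Xj) * (Gi ^ a * Gj * Gi ^ b))"
    by (intro L Rt J.intertwine_power[OF XX])
  finally show ?thesis by (simp only: mult.assoc power_add)
qed

end

section \<open>The deformed data and the images of the defining relations\<close>

locale uq_twist = uq_data A d P R
  for A :: "int^'i::finite^'i" and d :: "'i \<Rightarrow> nat"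
    and P :: "('k::field_char_0) fps^'i^'i"
    and R :: "('k, 'h::ab_group_add, 'i) realization" +
  fixes H :: "'g::finite \<Rightarrow> 'h" and \<Phi> :: "'k fps^'g^'g"
  assumes skew: "\<And>g k. \<Phi> $ k $ g = - \<Phi> $ g $ k"
begin

abbreviation "P' \<equiv> twist_matrix P R H \<Phi>"
abbreviation "R' \<equiv> twist_realization R H \<Phi>"
abbreviation "M \<equiv> twist_elt R H \<Phi>"
abbreviation "l \<equiv> twist_exponent R H \<Phi>"
abbreviation "f \<equiv> twist_map R H \<Phi>"
abbreviation "X i \<equiv> hexp (tor (M i))"

lemma exponent_eqv: "l i \<doteq> tor (M i)"
  unfolding twist_exponent_def twist_elt_def
  by (rule J.eqv_sym, rule J.eqv_trans[OF tor_sum], rule J.eqv_sum,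
      rule J.eqv_trans[OF tor_sum], rule J.eqv_sum, rule tor_scale)

lemma hexp_exponent: "hexp (l i) \<doteq> X i"
  by (rule J.eqv_hexp[OF exponent_eqv])

lemma root_twist_elt: "root R j (M i) =
   (\<Sum>g\<in>UNIV. \<Sum>k\<in>UNIV. - (fps_const (1/2) * root R i (H g) * \<Phi> $ g $ k * root R j (H k)))"
  by (simp add: twist_elt_def rootD)

lemma root_skew: "root R j (M i) = - root R i (M j)"
proof -
  have "root R j (M i) =
     (\<Sum>k\<in>UNIV. \<Sum>g\<in>UNIV. - (fps_const (1/2) * root R i (H g) * \<Phi> $ g $ k * root R j (H k)))"
    unfolding root_twist_elt by (rule sum.swap)
  also have "\<dots> = - root R i (M j)"
    unfolding root_twist_elt sum_negf[symmetric]
    by (intro sum.cong refl) (subst skew, simp add: mult_ac)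
  finally show ?thesis .
qed

lemma root_diag: "root R i (M i) = 0"
  using root_skew[of i i] by (simp add: eq_neg_iff_add_eq_0 flip: mult_2)

text \<open>The vector \<open>T\<close> is shifted by twice the exponent: antisymmetry exchanges the
  indices of \<Phi> and accounts for the sign in \<open>M i\<close>.\<close>

lemma shift_eq: "twist_shift R H \<Phi> i = M i + M i"
proof -
  interpret m: Modules.module "hscale R" by (rule module_hscale)
  have "fps_const (1/2) * c + fps_const (1/2) * c = (c :: 'k fps)" for c
    by (simp flip: distrib_right)
  then have *: "- (fps_const (1/2) * a * b) - fps_const (1/2) * a * b = - (a * b)" for a b :: "'k fps"
    by (metis minus_add_distrib mult.assoc diff_conv_add_uminus)
  show ?thesis
    unfolding twist_shift_def twist_elt_def sum.distrib[symmetric]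
    by (intro sum.cong refl, subst skew) (simp flip: m.scale_left_distrib m.scale_left_diff_distrib m.scale_minus_left add: *)
qed

lemma R'_simps: "hscale R' = hscale R" "root R' = root R"
  "Tplus R' i = Tplus R i + (M i + M i)" "Tminus R' i = Tminus R i - (M i + M i)"
  by (simp_all add: twist_realization_def shift_eq)

lemma twist_matrix_eq: "P' $ i $ j = P $ i $ j + 2 * root R j (M i)"
proof -
  have "(root_matrix R H ** \<Phi> ** transpose (root_matrix R H)) $ i $ j
    = (\<Sum>k\<in>UNIV. \<Sum>g\<in>UNIV. root R i (H g) * \<Phi> $ g $ k * root R j (H k))"
    by (simp add: matrix_matrix_mult_def root_matrix_def transpose_def sum_distrib_right)
  also have "\<dots> = (\<Sum>g\<in>UNIV. \<Sum>k\<in>UNIV. root R i (H g) * \<Phi> $ g $ k * root R j (H k))"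
    by (rule sum.swap)
  also have "\<dots> = - 2 * root R j (M i)"
  proof -
    have "2 * (fps_const (1/2) * a * b * c) = a * b * c" for a b c :: "'k fps"
      by (simp add: numeral_fps_const mult.assoc[symmetric])
    then show ?thesis
      by (simp only: root_twist_elt sum_negf sum_distrib_left mult_minus_left mult_minus_right minus_minus)
  qed
  finally show ?thesis by (simp add: twist_matrix_def)
qed

lemma f_E: "f (gen (E i)) \<doteq> X i * gen (E i)"
  using J.eqv_mult_right[OF hexp_exponent] by simp
lemma f_F: "f (gen (F i)) \<doteq> gen (F i) * X i"
  using J.eqv_mult_left[OF hexp_exponent] by simp
text \<open>The exponential may stand on either side of \<open>F i\<close>, because the factor of
  the exchange is the exponential of \<open>root R i (M i)\<close>, which is zero. So
  \<open>E\<close> and \<open>F\<close> can be treated alike.\<close>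

lemma f_F': "f (gen (F i)) \<doteq> X i * gen (F i)"
  using J.eqv_trans[OF f_F F_hexp] by (simp add: root_diag)

lemmas f_simps = is_alg_homD[OF alg_twist_map] is_linearD[OF is_alg_homD(1)[OF alg_twist_map]] alg_hexp[OF alg_twist_map]

lemma f_TE: "tor T * f (gen (E j)) - f (gen (E j)) * tor T \<doteq> scal (root R j T) * f (gen (E j))"
proof -
  have "tor T * f (gen (E j)) - f (gen (E j)) * tor T \<doteq>
      tor T * (X j * gen (E j)) - (X j * gen (E j)) * tor T"
    by (intro J.eqv_diff J.eqv_mult f_E J.eqv_refl)
  also have "\<dots> = tor T * X j * gen (E j) - X j * (gen (E j) * tor T)" by (simp only: mult.assoc)
  also have "\<dots> \<doteq> X j * tor T * gen (E j) - X j * ((tor T + scal (- root R j T)) * gen (E j))"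
    by (intro J.eqv_diff J.eqv_mult tor_hexp E_tor J.eqv_refl)
  also have "\<dots> = scal (root R j T) * (X j * gen (E j))"
    by (simp add: algebra_simps scal_minus scal_left_commute)
  also have "\<dots> \<doteq> scal (root R j T) * f (gen (E j))"
    by (rule J.eqv_mult_left[OF J.eqv_sym[OF f_E]])
  finally show ?thesis .
qed

lemma f_TF: "tor T * f (gen (F j)) - f (gen (F j)) * tor T \<doteq> - scal (root R j T) * f (gen (F j))"
proof -
  have "tor T * f (gen (F j)) - f (gen (F j)) * tor T \<doteq>
      tor T * (X j * gen (F j)) - (X j * gen (F j)) * tor T"
    by (intro J.eqv_diff J.eqv_mult f_F' J.eqv_refl)
  also have "\<dots> = tor T * X j * gen (F j) - X j * (gen (F j) * tor T)" by (simp only: mult.assoc)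
  also have "\<dots> \<doteq> X j * tor T * gen (F j) - X j * ((tor T + scal (root R j T)) * gen (F j))"
    by (intro J.eqv_diff J.eqv_mult tor_hexp F_tor J.eqv_refl)
  also have "\<dots> = - scal (root R j T) * (X j * gen (F j))"
    by (simp add: algebra_simps scal_left_commute)
  also have "\<dots> \<doteq> - scal (root R j T) * f (gen (F j))"
    by (rule J.eqv_mult_left[OF J.eqv_sym[OF f_F']])
  finally show ?thesis .
qed

text \<open>Moving \<open>X i\<close> left past \<open>F j\<close> and \<open>X j\<close> right past
  \<open>E i\<close> produces factors that are inverse to each other by \<open>root_skew\<close>.
  Both the diagonal and the off-diagonal relations follow from this.\<close>

lemma f_EF_commutator:
  "f (gen (E i)) * f (gen (F j)) - f (gen (F j)) * f (gen (E i)) \<doteq>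
    X i * (gen (E i) * gen (F j) - gen (F j) * gen (E i)) * X j"
proof -
  let ?c = "root R j (M i)"
  have EX: "X j * gen (E i) \<doteq> scal (qexp (- ?c)) * (gen (E i) * X j)"
  proof -
    have "X j * gen (E i) = scal (qexp (- ?c) * qexp ?c) * (X j * gen (E i))"
      by (simp flip: qexp_add)
    also have "\<dots> = scal (qexp (- ?c)) * (scal (qexp (- root R i (M j))) * (X j * gen (E i)))"
      by (simp add: scal_mult_assoc root_skew[of j i])
    also have "\<dots> \<doteq> scal (qexp (- ?c)) * (gen (E i) * X j)"
      by (rule J.eqv_mult_left[OF J.eqv_sym[OF E_hexp]])
    finally show ?thesis .
  qed
  have "f (gen (F j)) * f (gen (E i)) \<doteq> (gen (F j) * X j) * (X i * gen (E i))"
    by (intro J.eqv_mult f_E f_F)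
  also have "\<dots> = gen (F j) * (X j * X i) * gen (E i)" by (simp only: mult.assoc)
  also have "\<dots> \<doteq> gen (F j) * (X i * X j) * gen (E i)"
    by (intro J.eqv_mult hexp_tor_commute J.eqv_refl)
  also have "\<dots> = (gen (F j) * X i) * (X j * gen (E i))" by (simp only: mult.assoc)
  also have "\<dots> \<doteq> scal (qexp ?c) * (X i * gen (F j)) * (scal (qexp (- ?c)) * (gen (E i) * X j))"
    by (intro J.eqv_mult F_hexp EX)
  also have "\<dots> = scal (qexp ?c * qexp (- ?c)) * (X i * gen (F j) * (gen (E i) * X j))"
    by (simp only: mult.assoc scal_left_commute[of "X i"] scal_left_commute[of "gen (F j)"] scal_mult_assoc)
  also have "\<dots> = X i * (gen (F j) * gen (E i)) * X j"
    by (simp add: mult.assoc flip: qexp_add)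
  finally have FE: "f (gen (F j)) * f (gen (E i)) \<doteq> X i * (gen (F j) * gen (E i)) * X j" .
  have "f (gen (E i)) * f (gen (F j)) \<doteq> X i * gen (E i) * (gen (F j) * X j)"
    by (intro J.eqv_mult f_E f_F)
  from J.eqv_diff[OF this FE] show ?thesis
    by (simp add: algebra_simps)
qed

text \<open>The addition formula turns each divided exponential on the right into
  \<open>hexp_quot\<close> of the shift plus a conjugated term. The former is common to both and
  drops out of the difference; the exponential of the shift is \<open>X i * X i\<close>, one factor
  for each side.\<close>

lemma f_hexp_diff:
  "X i * (hexp_quot (tor (Tplus R i)) - hexp_quot (- tor (Tminus R i))) * X i \<doteq>
     hexp_quot (tor (Tplus R' i)) - hexp_quot (- tor (Tminus R' i))"
proof -
  let ?S = "M i + M i" and ?T = "tor (Tplus R i)" and ?U = "- tor (Tminus R i)"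
  \<comment> \<open>The sign \<open>s\<close> treats the plus vector and the negative of the minus
    vector at once.\<close>
  have comm_hexp_quot: "hexp_quot (s * tor T) * X i \<doteq> X i * hexp_quot (s * tor T)" if s: "s = 1 \<or> s = - 1" for s T
  proof -
    have "X i * (s * tor T) \<doteq> (s * tor T) * X i"
      using s J.eqv_sym[OF tor_hexp[of T "M i"]] J.eqv_uminus[OF J.eqv_sym[OF tor_hexp[of T "M i"]]] by auto
    then show ?thesis
      unfolding hexp_quot_def hsum_mult_left hsum_mult_right mult.assoc[of "scal _"] scal_left_commute[of "X i"]
      by (intro J.eqv_hsum J.eqv_mult_left J.eqv_sym[OF J.intertwine_power])
  qed
  have main: "hexp_quot (tor ?S + s * tor T) - hexp_quot (tor ?S) \<doteq> X i * hexp_quot (s * tor T) * X i"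
    if s: "s = 1 \<or> s = - 1" for s T
  proof -
    have "tor ?S * (s * tor T) \<doteq> (s * tor T) * tor ?S"
      using s tor_commute[of ?S T] J.eqv_uminus[OF tor_commute[of ?S T]] by auto
    from J.eqv_diff[OF J.hexp_quot_add[OF this] J.eqv_refl[of "hexp_quot (tor ?S)"]]
    have "hexp_quot (tor ?S + s * tor T) - hexp_quot (tor ?S) \<doteq> hexp (tor ?S) * hexp_quot (s * tor T)" by simp
    also have "\<dots> \<doteq> (X i * X i) * hexp_quot (s * tor T)"
      by (rule J.eqv_mult_right[OF hexp_tor_add])
    also have "\<dots> = X i * (X i * hexp_quot (s * tor T))" by (simp only: mult.assoc)
    also have "\<dots> \<doteq> X i * (hexp_quot (s * tor T) * X i)"
      by (rule J.eqv_mult_left[OF J.eqv_sym[OF comm_hexp_quot[OF s]]])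
    finally show ?thesis by (simp add: mult.assoc)
  qed
  have plus: "hexp_quot (tor (Tplus R' i)) \<doteq> hexp_quot (tor ?S + 1 * ?T)"
    unfolding R'_simps by (rule J.eqv_hexp_quot) (use tor_add[of ?S "Tplus R i"] in \<open>simp add: add.commute\<close>)
  have minus: "hexp_quot (- tor (Tminus R' i)) \<doteq> hexp_quot (tor ?S + (- 1) * tor (Tminus R i))"
  proof (rule J.eqv_hexp_quot)
    have "tor (Tminus R' i) \<doteq> tor (Tminus R i) + tor (- ?S)"
      unfolding R'_simps using tor_add[of "Tminus R i" "- ?S"] by (simp only: add_uminus_conv_diff)
    also have "\<dots> \<doteq> tor (Tminus R i) + - tor ?S"
      by (rule J.eqv_add[OF J.eqv_refl tor_minus])
    finally show "- tor (Tminus R' i) \<doteq> tor ?S + (- 1) * tor (Tminus R i)"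
      by (rule J.eqv_eq_trans(1)[OF J.eqv_uminus]) simp
  qed
  have "hexp_quot (tor (Tplus R' i)) - hexp_quot (- tor (Tminus R' i)) \<doteq>
      hexp_quot (tor ?S + 1 * ?T) - hexp_quot (tor ?S + (- 1) * tor (Tminus R i))"
    by (rule J.eqv_diff[OF plus minus])
  also have "\<dots> = (hexp_quot (tor ?S + 1 * ?T) - hexp_quot (tor ?S)) - (hexp_quot (tor ?S + (- 1) * tor (Tminus R i)) - hexp_quot (tor ?S))"
    by simp
  also have "\<dots> \<doteq> X i * hexp_quot (1 * ?T) * X i - X i * hexp_quot ((- 1) * tor (Tminus R i)) * X i"
    by (intro J.eqv_diff main) auto
  finally have "hexp_quot (tor (Tplus R' i)) - hexp_quot (- tor (Tminus R' i)) \<doteq>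
      X i * hexp_quot (1 * ?T) * X i - X i * hexp_quot ((- 1) * tor (Tminus R i)) * X i" .
  from J.eqv_sym[OF this] show ?thesis
    by (simp add: algebra_simps)
qed

lemma f_EF:
  assumes y: "scal (qexp (of_nat (d i)) - inverse (qexp (of_nat (d i)))) * y =
         hexp (tor (Tplus R' i)) - hexp (- tor (Tminus R' i))"
  shows "f (gen (E i)) * f (gen (F i)) - f (gen (F i)) * f (gen (E i)) \<doteq> f y"
proof -
  have d: "(of_nat (d i) :: 'k) \<noteq> 0" using d_pos[of i] by simp
  obtain u :: "'k fps" where u: "qexp (of_nat (d i)) - inverse (qexp (of_nat (d i))) = fps_X * u" "u * inverse u = 1"
    using qexp_diff_factor[OF d] by (auto simp: fps_of_nat)
  \<comment> \<open>Cancelling \<hbar> and the unit \<open>u\<close> in the free algebra determines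
    \<open>y\<close>. The relation is thereby rewritten with divided exponentials before any
    congruence is used.\<close>
  have div: "y = scal (inverse u) * (hexp_quot a - hexp_quot b)"
    if "scal (qexp (of_nat (d i)) - inverse (qexp (of_nat (d i)))) * y = hexp a - hexp b" for y a b :: "('k, 'h, 'i) uqfree"
  proof -
    have "scal fps_X * (scal u * y) = scal fps_X * (hexp_quot a - hexp_quot b)"
      using that by (simp add: u hexp_hexp_quot scal_mult_assoc right_diff_distrib)
    then have "scal u * y = hexp_quot a - hexp_quot b" by (rule scal_cancel[rotated]) simp
    then have "scal (inverse u) * (scal u * y) = scal (inverse u) * (hexp_quot a - hexp_quot b)" by simp
    then show ?thesis using u(2) by (simp add: scal_mult_assoc mult.commute)
  qed
  let ?y = "scal (inverse u) * (hexp_quot (tor (Tplus R i)) - hexp_quot (- tor (Tminus R i))) :: ('k, 'h, 'i) uqfree"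
  have "scal (fps_X * u) * ?y = scal fps_X * (scal (u * inverse u) * (hexp_quot (tor (Tplus R i)) - hexp_quot (- tor (Tminus R i))))"
    by (simp only: scal_mult_assoc mult.assoc)
  also have "\<dots> = hexp (tor (Tplus R i)) - hexp (- tor (Tminus R i))"
    by (simp add: u hexp_hexp_quot right_diff_distrib)
  finally have EF': "gen (E i) * gen (F i) - gen (F i) * gen (E i) \<doteq> ?y"
    using u by (intro rel EF) simp
  have hexp_quotf: "f (hexp_quot x) = hexp_quot (f x)" for x
    by (simp add: hexp_quot_def lin_hsum is_alg_homD[OF alg_twist_map] is_linearD[OF is_alg_homD(1)[OF alg_twist_map]] del: power_Suc)
  have "f (gen (E i)) * f (gen (F i)) - f (gen (F i)) * f (gen (E i)) \<doteq>
      X i * (gen (E i) * gen (F i) - gen (F i) * gen (E i)) * X i"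
    by (rule f_EF_commutator)
  also have "\<dots> \<doteq> X i * ?y * X i"
    by (intro J.eqv_mult EF' J.eqv_refl)
  also have "\<dots> = scal (inverse u) * (X i * (hexp_quot (tor (Tplus R i)) - hexp_quot (- tor (Tminus R i))) * X i)"
    by (simp only: mult.assoc scal_left_commute[of "X i"])
  also have "\<dots> \<doteq> scal (inverse u) * (hexp_quot (tor (Tplus R' i)) - hexp_quot (- tor (Tminus R' i)))"
    by (rule J.eqv_mult_left[OF f_hexp_diff])
  also have "\<dots> = f y"
    unfolding div[OF y] by (simp add: f_simps hexp_quotf)
  finally show ?thesis .
qed

text \<open>With \<open>b = root R j (M i)\<close>, the deformed entries of the matrix contribute
  \<open>qexp b\<close> to the power \<open>2 * k\<close>, and reordering contributes it to the
  power \<open>N - 2 * k\<close>. The total exponent \<open>N\<close> is independent of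
  \<open>k\<close>.\<close>

lemma serre_coeff_twist:
  assumes "k \<le> N"
  shows "serre_coeff A d P' i j k * (qexp (root R j (M i)) ^ (N - k) * qexp (- root R j (M i)) ^ k) =
    serre_coeff A d P i j k * qexp (root R j (M i)) ^ N"
proof -
  let ?b = "root R j (M i)"
  have half: "fps_const (1/2) * (2 * c) = (c :: 'k fps)" for c
    by (simp add: numeral_fps_const flip: mult.assoc)
  have 1: "qexp (fps_const (1/2) * P' $ i $ j) = qexp (fps_const (1/2) * P $ i $ j) * qexp ?b"
    by (simp add: twist_matrix_eq distrib_left half qexp_add)
  have 2: "inverse (qexp (fps_const (1/2) * P' $ j $ i)) = inverse (qexp (fps_const (1/2) * P $ j $ i)) * qexp ?b"
  proof -
    have "qexp (fps_const (1/2) * P' $ j $ i) = qexp (fps_const (1/2) * P $ j $ i) * qexp (- ?b)"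
      by (simp only: twist_matrix_eq distrib_left half qexp_add root_skew[of i j])
    then show ?thesis using qexp_minus[of "- ?b"] by (simp add: fps_inverse_mult)
  qed
  have 3: "qexp ?b ^ k * qexp (- ?b) ^ k = 1"
    by (simp flip: power_mult_distrib qexp_add)
  have 4: "qexp ?b ^ N = qexp ?b ^ k * qexp ?b ^ (N - k)"
    using assms by (simp flip: power_add)
  have "s * (x * a) * (y * a) * (e * g) = s * x * y * q" if "a * g = 1" "q = a * e" for s x y a e g q :: "'k fps"
  proof -
    have "s * (x * a) * (y * a) * (e * g) = s * x * y * (a * g) * (a * e)" by (simp only: mult_ac)
    then show ?thesis using that by simp
  qed
  from this[OF 3 4] show ?thesis
    unfolding serre_coeff_def 1 2 power_mult_distrib .
qed

text \<open>As the factor is common to all terms, the deformed relation is sent to a multiple of the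
  original one, modulo the ideal.\<close>

lemma f_serre:
  assumes "\<And>k. k \<le> N \<Longrightarrow> f (t k) \<doteq>
      scal (qexp (root R j (M i)) ^ (N - k) * qexp (- root R j (M i)) ^ k) * (W * t k)"
    and "(\<Sum>k=0..N. scal (serre_coeff A d P i j k) * t k) \<in> uq_rels A d P R"
  shows "f (\<Sum>k=0..N. scal (serre_coeff A d P' i j k) * t k) \<doteq> 0"
proof -
  let ?q = "qexp (root R j (M i)) ^ N"
  have "f (\<Sum>k=0..N. scal (serre_coeff A d P' i j k) * t k) =
      (\<Sum>k=0..N. scal (serre_coeff A d P' i j k) * f (t k))"
    by (simp add: f_simps)
  also have "\<dots> \<doteq> (\<Sum>k=0..N. scal (serre_coeff A d P' i j k) *
      (scal (qexp (root R j (M i)) ^ (N - k) * qexp (- root R j (M i)) ^ k) * (W * t k)))"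
    by (intro J.eqv_sum J.eqv_mult_left assms(1)) simp
  also have "\<dots> = (\<Sum>k=0..N. scal (?q * serre_coeff A d P i j k) * (W * t k))"
    by (intro sum.cong refl) (simp only: scal_mult_assoc serre_coeff_twist atLeastAtMost_iff mult.commute[of ?q])
  also have "\<dots> = (scal ?q * W) * (\<Sum>k=0..N. scal (serre_coeff A d P i j k) * t k)"
    by (simp add: sum_distrib_left scal_mult mult.assoc scal_left_commute[of W])
  also have "\<dots> \<doteq> (scal ?q * W) * 0"
    by (rule J.eqv_mult_left, rule rel) (use assms(2) in simp)
  finally show ?thesis by simp
qed

lemma f_rels: "x \<in> uq_rels A d P' R' \<Longrightarrow> f x \<in> uq_ideal A d P R"
proof (induction rule: uq_rels.induct)
  case (T_add S T)
  then show ?case using tor_add[of S T] by (simp add: f_simps J.eqv_def)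
next
  case (T_scale c T)
  then show ?case using tor_scale[of c T] by (simp add: f_simps J.eqv_def R'_simps)
next
  case (TT S T)
  then show ?case using tor_commute[of S T] by (simp add: f_simps J.eqv_def)
next
  case (TE T j)
  then show ?case using f_TE[of T j] by (simp add: f_simps J.eqv_def R'_simps del: twist_gen.simps(2))
next
  case (TF T j)
  then show ?case using f_TF[of T j] by (simp add: f_simps J.eqv_def R'_simps del: twist_gen.simps(3))
next
  case (EF i y)
  then show ?case using f_EF[of i y] by (simp add: f_simps J.eqv_def del: twist_gen.simps(2,3))
next
  case (EF_neq i j)
  have "X i * (gen (E i) * gen (F j) - gen (F j) * gen (E i)) * X j \<doteq> X i * 0 * X j"
    by (intro J.eqv_mult J.eqv_refl rel) (simp add: uq_rels.EF_neq EF_neq)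
  from J.eqv_trans[OF f_EF_commutator this]
  show ?case by (simp add: f_simps J.eqv_def del: twist_gen.simps(2,3))
next
  case (serre_E i j N)
  have "f (\<Sum>k=0..N. scal (serre_coeff A d P' i j k) * (gen (E i) ^ (N - k) * gen (E j) * gen (E i) ^ k)) \<doteq> 0"
  proof (rule f_serre[where W = "X i ^ N * X j"])
    fix k assume k: "k \<le> N"
    have "f (gen (E i) ^ (N - k) * gen (E j) * gen (E i) ^ k) =
        f (gen (E i)) ^ (N - k) * f (gen (E j)) * f (gen (E i)) ^ k"
      by (simp only: f_simps)
    also have "\<dots> \<doteq> (X i * gen (E i)) ^ (N - k) * (X j * gen (E j)) * (X i * gen (E i)) ^ k"
      by (intro J.eqv_mult J.eqv_power f_E)
    also have "\<dots> \<doteq> scal (qexp (root R j (M i)) ^ (N - k) * qexp (- root R j (M i)) ^ k) *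
       (X i ^ (N - k + k) * X j * (gen (E i) ^ (N - k) * gen (E j) * gen (E i) ^ k))"
      using E_hexp[of i "M i"] E_hexp[of i "M j"] E_hexp[of j "M i"]
      by (intro serre_term hexp_tor_commute) (simp_all add: root_diag root_skew[of i j])
    finally show "f (gen (E i) ^ (N - k) * gen (E j) * gen (E i) ^ k) \<doteq>
       scal (qexp (root R j (M i)) ^ (N - k) * qexp (- root R j (M i)) ^ k) *
       (X i ^ N * X j * (gen (E i) ^ (N - k) * gen (E j) * gen (E i) ^ k))"
      using k by simp
  qed (rule uq_rels.serre_E[OF serre_E])
  then show ?case by (simp add: J.eqv_def)
next
  case (serre_F i j N)
  have "f (\<Sum>k=0..N. scal (serre_coeff A d P' i j k) * (gen (F i) ^ k * gen (F j) * gen (F i) ^ (N - k))) \<doteq> 0"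
  proof (rule f_serre[where W = "X i ^ N * X j"])
    fix k assume k: "k \<le> N"
    have "f (gen (F i) ^ k * gen (F j) * gen (F i) ^ (N - k)) =
        f (gen (F i)) ^ k * f (gen (F j)) * f (gen (F i)) ^ (N - k)"
      by (simp only: f_simps)
    also have "\<dots> \<doteq> (X i * gen (F i)) ^ k * (X j * gen (F j)) * (X i * gen (F i)) ^ (N - k)"
      by (intro J.eqv_mult J.eqv_power f_F')
    also have "\<dots> \<doteq> scal (qexp (- root R j (M i)) ^ k * qexp (root R j (M i)) ^ (N - k)) *
       (X i ^ (k + (N - k)) * X j * (gen (F i) ^ k * gen (F j) * gen (F i) ^ (N - k)))"
      using F_hexp[of i "M i"] F_hexp[of i "M j"] F_hexp[of j "M i"]
      by (intro serre_term hexp_tor_commute) (simp_all add: root_diag root_skew[of i j])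
    finally show "f (gen (F i) ^ k * gen (F j) * gen (F i) ^ (N - k)) \<doteq>
       scal (qexp (root R j (M i)) ^ (N - k) * qexp (- root R j (M i)) ^ k) *
       (X i ^ N * X j * (gen (F i) ^ k * gen (F j) * gen (F i) ^ (N - k)))"
      using k by (simp add: mult.commute[of "qexp _ ^ k"])
  qed (rule uq_rels.serre_F[OF serre_F])
  then show ?case by (simp add: J.eqv_def)
qed

lemma f_ideal: "x \<in> uq_ideal A d P' R' \<Longrightarrow> f x \<in> uq_ideal A d P R"
  unfolding uq_ideal_def
  by (rule closed_ideal_image_subset[OF alg_twist_map f_rels[unfolded uq_ideal_def]])

end

section \<open>The twisted coproduct\<close>

definition toral_exponent :: "('g::finite \<Rightarrow> 'h) \<Rightarrow> 'k fps^'g^'g \<Rightarrow> ('k::field_char_0, 'h, 'i) uqfree2" where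
  "toral_exponent H \<Phi> = (\<Sum>g\<in>UNIV. \<Sum>k\<in>UNIV.
        scal (fps_const (1/2) * \<Phi> $ g $ k) * ftens (tor (H g)) (tor (H k)))"

definition free_comult where "free_comult R = alg_ext (comult_gen R)"

lemma alg_free_comult: "is_alg_hom (free_comult R)"
  by (simp add: free_comult_def alg_alg_ext)

lemma free_comult_gen [simp]: "free_comult R (gen x) = comult_gen R x"
  by (simp add: free_comult_def)

context uq_data
begin

sublocale K: mod_closed_ideal "tens_ideal (uq_ideal A d P R)"
  by (simp add: mod_closed_ideal_def tens_ideal_def is_closed_ideal_closed_ideal)

abbreviation teq (infix "\<doteqdot>" 50) where "x \<doteqdot> y \<equiv> K.eqv x y"

lemma ftens_eqv: "x \<doteq> x' \<Longrightarrow> y \<doteq> y' \<Longrightarrow> ftens x y \<doteqdot> ftens x' y'"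
proof -
  assume x: "x \<doteq> x'" and y: "y \<doteq> y'"
  have "ftens x y - ftens x' y' = ftens (x - x') y + ftens x' (y - y')"
    using is_linearD(5)[OF lin_ftens(1), of x x' y] is_linearD(5)[OF lin_ftens(2), of x' y y'] by simp
  moreover have "ftens (x - x') y \<in> tens_ideal (uq_ideal A d P R)" "ftens x' (y - y') \<in> tens_ideal (uq_ideal A d P R)"
    using x y unfolding tens_ideal_def J.eqv_def by (auto intro!: subsetD[OF closed_ideal_superset])
  ultimately show ?thesis by (simp add: K.eqv_def closed_submodule_add[OF K.closed_submodule])
qed

end

context uq_twist
begin

abbreviation "Z \<equiv> toral_exponent H \<Phi> :: ('k, 'h, 'i) uqfree2"
abbreviation "W \<equiv> hexp Z"
abbreviation "Y i \<equiv> hexp (tor (- M i)) :: ('k, 'h, 'i) uqfree"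

lemma toral_exponent_act:
  assumes "\<And>g k. B * ftens (tor (H g)) (tor (H k)) \<doteqdot> (ftens (tor (H g)) (tor (H k)) + y g k) * B"
  shows "B * Z \<doteqdot> (Z + (\<Sum>g\<in>UNIV. \<Sum>k\<in>UNIV. scal (fps_const (1/2) * \<Phi> $ g $ k) * y g k)) * B"
proof -
  have "B * Z = (\<Sum>g\<in>UNIV. \<Sum>k\<in>UNIV. scal (fps_const (1/2) * \<Phi> $ g $ k) * (B * ftens (tor (H g)) (tor (H k))))"
    by (simp add: toral_exponent_def sum_distrib_left scal_left_commute[of B])
  also have "\<dots> \<doteqdot> (\<Sum>g\<in>UNIV. \<Sum>k\<in>UNIV. scal (fps_const (1/2) * \<Phi> $ g $ k) * ((ftens (tor (H g)) (tor (H k)) + y g k) * B))"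
    by (intro K.eqv_sum K.eqv_mult_left assms)
  also have "\<dots> = (Z + (\<Sum>g\<in>UNIV. \<Sum>k\<in>UNIV. scal (fps_const (1/2) * \<Phi> $ g $ k) * y g k)) * B"
    by (simp add: toral_exponent_def sum_distrib_right distrib_right distrib_left sum.distrib mult.assoc)
  finally show ?thesis .
qed

lemma toral_exponent_tor:
  "ftens (tor T) 1 * Z \<doteqdot> Z * ftens (tor T) 1" "ftens 1 (tor T) * Z \<doteqdot> Z * ftens 1 (tor T)"
  using toral_exponent_act[of "ftens (tor T) 1" "\<lambda>_ _. 0"] toral_exponent_act[of "ftens 1 (tor T)" "\<lambda>_ _. 0"]
  by (simp_all add: ftens_mult ftens_eqv tor_commute)

lemma toral_twist_commute_left: "ftens (hexp (tor S)) 1 * W \<doteqdot> W * ftens (hexp (tor S)) 1"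
  unfolding alg_hexp[OF alg_ftens_left]
  by (rule K.intertwine_hexp[OF K.eqv_sym[OF K.intertwine_hexp[OF K.eqv_sym[OF toral_exponent_tor(1)]]]])

lemma toral_twist_commute_right: "ftens 1 (hexp (tor T)) * W \<doteqdot> W * ftens 1 (hexp (tor T))"
  unfolding alg_hexp[OF alg_ftens_right]
  by (rule K.intertwine_hexp[OF K.eqv_sym[OF K.intertwine_hexp[OF K.eqv_sym[OF toral_exponent_tor(2)]]]])

lemma toral_twist_commute:
  "ftens (hexp (tor S)) (hexp (tor T)) * W \<doteqdot> W * ftens (hexp (tor S)) (hexp (tor T))"
proof -
  note 1 = toral_twist_commute_left[of S] and 2 = toral_twist_commute_right[of T]
  have *: "ftens (hexp (tor S)) (hexp (tor T)) = ftens (hexp (tor S)) 1 * ftens 1 (hexp (tor T))"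
    by (simp add: ftens_mult)
  have "ftens (hexp (tor S)) 1 * ftens 1 (hexp (tor T)) * W \<doteqdot> ftens (hexp (tor S)) 1 * (W * ftens 1 (hexp (tor T)))"
    unfolding mult.assoc by (rule K.eqv_mult_left[OF 2])
  also have "\<dots> = (ftens (hexp (tor S)) 1 * W) * ftens 1 (hexp (tor T))" by (simp only: mult.assoc)
  also have "\<dots> \<doteqdot> (W * ftens (hexp (tor S)) 1) * ftens 1 (hexp (tor T))" by (rule K.eqv_mult_right[OF 1])
  finally show ?thesis by (simp only: * mult.assoc)
qed

text \<open>The map \<open>i\<close> is one of the two embeddings into the tensor square. A shift of
  \<open>Z\<close> in a single leg commutes with \<open>Z\<close>, hence it leaves the exponential
  as a separate factor.\<close>

lemma toral_twist_conj:
  assumes i: "is_alg_hom i" and comm: "i (tor N) * Z \<doteqdot> Z * i (tor N)" and B: "B * Z \<doteqdot> (Z + i (tor N)) * B"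
  shows "B * W \<doteqdot> i (hexp (tor N)) * W * B"
proof -
  have "B * W \<doteqdot> hexp (Z + i (tor N)) * B" by (rule K.intertwine_hexp[OF B])
  also have "\<dots> = hexp (i (tor N) + Z) * B" by (simp only: add.commute)
  also have "\<dots> \<doteqdot> (hexp (i (tor N)) * W) * B" by (rule K.eqv_mult_right[OF K.hexp_add[OF comm]])
  finally show ?thesis by (simp only: alg_hexp[OF i])
qed

lemma minus_exponent_eqv: "- l i \<doteq> tor (- M i)"
  by (rule J.eqv_trans[OF J.eqv_uminus[OF exponent_eqv] J.eqv_sym[OF tor_minus]])

text \<open>Contracting one leg of \<open>Z\<close> with the root leaves the exponent
  \<open>l i\<close> in the other leg, with opposite signs for the two legs because \<Phi> is
  antisymmetric.\<close>

lemma exponent_ftens: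
  "(\<Sum>g\<in>UNIV. \<Sum>k\<in>UNIV. scal (fps_const (1/2) * \<Phi> $ g $ k) * (scal (s * root R i (H g)) * ftens 1 (tor (H k)))) = ftens 1 (scal (- s) * l i)"
  "(\<Sum>g\<in>UNIV. \<Sum>k\<in>UNIV. scal (fps_const (1/2) * \<Phi> $ g $ k) * (scal (s * root R i (H k)) * ftens (tor (H g)) 1)) = ftens (scal s * l i) 1"
proof -
  have a: "ftens 1 (scal (- s) * l i) = (\<Sum>g\<in>UNIV. \<Sum>k\<in>UNIV. scal ((- s) * (- (fps_const (1/2) * root R i (H g) * \<Phi> $ g $ k))) * ftens 1 (tor (H k)))"
    by (simp add: twist_exponent_def ftens_bilinear is_linearD[OF lin_ftens(2)] sum_distrib_left scal_mult_assoc)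
  show "(\<Sum>g\<in>UNIV. \<Sum>k\<in>UNIV. scal (fps_const (1/2) * \<Phi> $ g $ k) * (scal (s * root R i (H g)) * ftens 1 (tor (H k)))) = ftens 1 (scal (- s) * l i)"
    unfolding a scal_mult_assoc by (intro sum.cong refl) (simp add: mult_ac)
  have b: "ftens (scal s * l i) 1 = (\<Sum>k\<in>UNIV. \<Sum>g\<in>UNIV. scal (s * (- (fps_const (1/2) * root R i (H k) * \<Phi> $ k $ g))) * ftens (tor (H g)) 1)"
    by (simp add: twist_exponent_def ftens_bilinear is_linearD[OF lin_ftens(1)] sum_distrib_left scal_mult_assoc)
  show "(\<Sum>g\<in>UNIV. \<Sum>k\<in>UNIV. scal (fps_const (1/2) * \<Phi> $ g $ k) * (scal (s * root R i (H k)) * ftens (tor (H g)) 1)) = ftens (scal s * l i) 1"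
    unfolding b scal_mult_assoc
  proof (subst sum.swap, intro sum.cong refl)
    fix g k
    show "scal (fps_const (1/2) * \<Phi> $ g $ k * (s * root R i (H k))) * ftens (tor (H g)) 1 =
      scal (s * (- (fps_const (1/2) * root R i (H k) * \<Phi> $ k $ g))) * ftens (tor (H g)) 1"
      using skew[of g k] by (simp add: mult_ac)
  qed
qed

text \<open>The sign \<open>s\<close> is the one in \<open>E_tor\<close> and \<open>F_tor\<close>:
  \<open>-1\<close> for \<open>E i\<close> and \<open>1\<close> for \<open>F i\<close>. Commuting
  \<open>B\<close> with the first leg of \<open>Z\<close> leaves a correction in the second leg
  only.\<close>

lemma twist_conj_left:
  assumes B: "\<And>T. B * tor T \<doteq> (tor T + scal (s * root R i T)) * B" and s: "s = 1 \<or> s = -1"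
  shows "ftens B 1 * W \<doteqdot> ftens 1 (hexp (tor (if s = 1 then - M i else M i))) * W * ftens B 1"
proof -
  let ?N = "if s = 1 then - M i else M i"
  have N: "scal (- s) * l i \<doteq> tor ?N"
    using s exponent_eqv minus_exponent_eqv by (auto simp: scal_minus)
  have "ftens B 1 * ftens (tor (H g)) (tor (H k)) \<doteqdot>
      (ftens (tor (H g)) (tor (H k)) + scal (s * root R i (H g)) * ftens 1 (tor (H k))) * ftens B 1" for g k
  proof -
    have "ftens B 1 * ftens (tor (H g)) (tor (H k)) = ftens (B * tor (H g)) (tor (H k))"
      by (simp add: ftens_mult)
    also have "\<dots> \<doteqdot> ftens ((tor (H g) + scal (s * root R i (H g))) * B) (tor (H k))"
      by (intro ftens_eqv B J.eqv_refl)
    also have "\<dots> = (ftens (tor (H g)) (tor (H k)) + scal (s * root R i (H g)) * ftens 1 (tor (H k))) * ftens B 1"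
      by (simp add: distrib_right ftens_bilinear ftens_mult mult.assoc)
    finally show ?thesis .
  qed
  from toral_exponent_act[OF this]
  have "ftens B 1 * Z \<doteqdot> (Z + ftens 1 (scal (- s) * l i)) * ftens B 1"
    by (simp only: exponent_ftens)
  also have "\<dots> \<doteqdot> (Z + ftens 1 (tor ?N)) * ftens B 1"
    by (intro K.eqv_mult K.eqv_add K.eqv_refl ftens_eqv J.eqv_refl N)
  finally show ?thesis
    by (rule toral_twist_conj[OF alg_ftens_right toral_exponent_tor(2)])
qed

lemma twist_conj_right:
  assumes B: "\<And>T. B * tor T \<doteq> (tor T + scal (s * root R i T)) * B" and s: "s = 1 \<or> s = -1"
  shows "ftens 1 B * W \<doteqdot> ftens (hexp (tor (if s = 1 then M i else - M i))) 1 * W * ftens 1 B"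
proof -
  let ?N = "if s = 1 then M i else - M i"
  have N: "scal s * l i \<doteq> tor ?N"
    using s exponent_eqv minus_exponent_eqv by (auto simp: scal_minus)
  have "ftens 1 B * ftens (tor (H g)) (tor (H k)) \<doteqdot>
      (ftens (tor (H g)) (tor (H k)) + scal (s * root R i (H k)) * ftens (tor (H g)) 1) * ftens 1 B" for g k
  proof -
    have "ftens 1 B * ftens (tor (H g)) (tor (H k)) = ftens (tor (H g)) (B * tor (H k))"
      by (simp add: ftens_mult)
    also have "\<dots> \<doteqdot> ftens (tor (H g)) ((tor (H k) + scal (s * root R i (H k))) * B)"
      by (intro ftens_eqv B J.eqv_refl)
    also have "\<dots> = (ftens (tor (H g)) (tor (H k)) + scal (s * root R i (H k)) * ftens (tor (H g)) 1) * ftens 1 B"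
      by (simp add: distrib_right ftens_bilinear ftens_mult mult.assoc)
    finally show ?thesis .
  qed
  from toral_exponent_act[OF this]
  have "ftens 1 B * Z \<doteqdot> (Z + ftens (scal s * l i) 1) * ftens 1 B"
    by (simp only: exponent_ftens)
  also have "\<dots> \<doteqdot> (Z + ftens (tor ?N) 1) * ftens 1 B"
    by (intro K.eqv_mult K.eqv_add K.eqv_refl ftens_eqv J.eqv_refl N)
  finally show ?thesis
    by (rule toral_twist_conj[OF alg_ftens_left toral_exponent_tor(1)])
qed

lemma conj_E:
  "ftens (gen (E i)) 1 * W \<doteqdot> ftens 1 (X i) * W * ftens (gen (E i)) 1"
  "ftens 1 (gen (E i)) * W \<doteqdot> ftens (Y i) 1 * W * ftens 1 (gen (E i))"
  using twist_conj_left[of "gen (E i)" "-1" i] twist_conj_right[of "gen (E i)" "-1" i] E_tor by simp_all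

lemma conj_F:
  "ftens (gen (F i)) 1 * W \<doteqdot> ftens 1 (Y i) * W * ftens (gen (F i)) 1"
  "ftens 1 (gen (F i)) * W \<doteqdot> ftens (X i) 1 * W * ftens 1 (gen (F i))"
  using twist_conj_left[of "gen (F i)" 1 i] twist_conj_right[of "gen (F i)" 1 i] F_tor by simp_all

lemma comult_exponent: "free_comult R (l i) = ftens (l i) 1 + ftens 1 (l i)"
  by (simp add: twist_exponent_def is_linearD[OF is_alg_homD(1)[OF alg_free_comult]] is_linearD[OF lin_ftens(1)] is_linearD[OF lin_ftens(2)]
    distrib_left sum.distrib)

text \<open>The exponent is primitive and its two summands commute exactly, so its exponential is
  grouplike.\<close>

lemma comult_hexp_exponent: "free_comult R (hexp (l i)) \<doteqdot> ftens (X i) (X i)"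
proof -
  have "free_comult R (hexp (l i)) = hexp (ftens (l i) 1 + ftens 1 (l i))"
    by (simp add: alg_hexp[OF alg_free_comult] comult_exponent)
  also have "\<dots> = ftens (hexp (l i)) 1 * ftens 1 (hexp (l i))"
    by (simp add: hexp_add_eq ftens_mult alg_hexp[OF alg_ftens_left] alg_hexp[OF alg_ftens_right])
  also have "\<dots> \<doteqdot> ftens (X i) (X i)"
    by (simp add: ftens_mult ftens_eqv hexp_exponent)
  finally show ?thesis .
qed

text \<open>Half of the shift is undone: \<open>Tplus R' i - M i\<close> equals
  \<open>Tplus R i + M i\<close>. \<open>Tminus_twist\<close> is the analogue with the opposite
  shift.\<close>

lemma Tplus_twist: "hexp (tor (Tplus R' i)) * Y i \<doteq> X i * hexp (tor (Tplus R i))"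
proof -
  have "hexp (tor (Tplus R' i)) * Y i \<doteq> hexp (tor (Tplus R' i + - M i))"
    by (rule J.eqv_sym[OF hexp_tor_add])
  also have "\<dots> = hexp (tor (M i + Tplus R i))" by (simp add: R'_simps algebra_simps)
  also have "\<dots> \<doteq> X i * hexp (tor (Tplus R i))" by (rule hexp_tor_add)
  finally show ?thesis .
qed

lemma Tminus_twist: "Y i * hexp (- tor (Tminus R' i)) \<doteq> hexp (- tor (Tminus R i)) * X i"
proof -
  have "Y i * hexp (- tor (Tminus R' i)) \<doteq> Y i * hexp (tor (- Tminus R' i))"
    by (rule J.eqv_mult_left[OF hexp_tor_minus])
  also have "\<dots> \<doteq> hexp (tor (- M i + - Tminus R' i))"
    by (rule J.eqv_sym[OF hexp_tor_add])
  also have "\<dots> = hexp (tor (- Tminus R i + M i))" by (simp add: R'_simps algebra_simps)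
  also have "\<dots> \<doteq> hexp (tor (- Tminus R i)) * X i" by (rule hexp_tor_add)
  also have "\<dots> \<doteq> hexp (- tor (Tminus R i)) * X i"
    by (rule J.eqv_mult_right[OF J.eqv_sym[OF hexp_tor_minus]])
  finally show ?thesis .
qed

lemma f_hexp_tor: "f (hexp (tor T)) = hexp (tor T)" "f (hexp (- tor T)) = hexp (- tor T)"
  by (simp_all add: alg_hexp[OF alg_twist_map] is_linearD[OF is_alg_homD(1)[OF alg_twist_map]])

text \<open>Moving \<open>W\<close> past \<open>E i\<close> in one leg creates an exponential in the
  other. In the first summand it completes \<open>ftens (X i) (X i)\<close>; in the second it
  converts the deformed \<open>Tplus\<close> into the original one times \<open>X i\<close>. Both
  summands thus contain the coproduct of the exponential.\<close>

lemma comult_twist_E: "tmap f (comult_gen R' (E i)) * W \<doteqdot> W * free_comult R (f (gen (E i)))"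
proof -
  let ?T = "hexp (tor (Tplus R i))" and ?T' = "hexp (tor (Tplus R' i))" and ?E = "gen (E i)"
  note lin_f = is_alg_homD(1)[OF alg_twist_map]
  have 1: "ftens (f ?E) 1 * W \<doteqdot> W * ftens (X i) (X i) * ftens ?E 1"
  proof -
    have "ftens (f ?E) 1 * W \<doteqdot> ftens (X i * ?E) 1 * W"
      by (intro K.eqv_mult_right ftens_eqv f_E J.eqv_refl)
    also have "\<dots> = ftens (X i) 1 * (ftens ?E 1 * W)"
      by (simp add: ftens_mult flip: mult.assoc)
    also have "\<dots> \<doteqdot> ftens (X i) 1 * (ftens 1 (X i) * W * ftens ?E 1)"
      by (rule K.eqv_mult_left[OF conj_E(1)])
    also have "\<dots> = (ftens (X i) (X i) * W) * ftens ?E 1"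
      by (simp add: ftens_mult flip: mult.assoc)
    also have "\<dots> \<doteqdot> (W * ftens (X i) (X i)) * ftens ?E 1"
      by (rule K.eqv_mult_right[OF toral_twist_commute])
    finally show ?thesis .
  qed
  have 2: "ftens ?T' (f ?E) * W \<doteqdot> W * ftens (X i) (X i) * ftens ?T ?E"
  proof -
    have "ftens ?T' (f ?E) * W \<doteqdot> ftens ?T' (X i * ?E) * W"
      by (intro K.eqv_mult_right ftens_eqv f_E J.eqv_refl)
    also have "\<dots> = ftens ?T' (X i) * (ftens 1 ?E * W)"
      by (simp add: ftens_mult flip: mult.assoc)
    also have "\<dots> \<doteqdot> ftens ?T' (X i) * (ftens (Y i) 1 * W * ftens 1 ?E)"
      by (rule K.eqv_mult_left[OF conj_E(2)])
    also have "\<dots> = ftens (?T' * Y i) (X i) * (W * ftens 1 ?E)"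
      by (simp add: ftens_mult flip: mult.assoc)
    also have "\<dots> \<doteqdot> ftens (X i * ?T) (X i) * (W * ftens 1 ?E)"
      by (intro K.eqv_mult_right ftens_eqv Tplus_twist J.eqv_refl)
    also have "\<dots> \<doteqdot> ftens (hexp (tor (M i + Tplus R i))) (X i) * (W * ftens 1 ?E)"
      by (intro K.eqv_mult_right ftens_eqv J.eqv_sym[OF hexp_tor_add] J.eqv_refl)
    also have "\<dots> = (ftens (hexp (tor (M i + Tplus R i))) (X i) * W) * ftens 1 ?E"
      by (simp only: mult.assoc)
    also have "\<dots> \<doteqdot> (W * ftens (hexp (tor (M i + Tplus R i))) (X i)) * ftens 1 ?E"
      by (rule K.eqv_mult_right[OF toral_twist_commute])
    also have "\<dots> \<doteqdot> (W * ftens (X i * ?T) (X i)) * ftens 1 ?E"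
      by (intro K.eqv_mult ftens_eqv hexp_tor_add J.eqv_refl K.eqv_refl)
    also have "\<dots> = W * ftens (X i) (X i) * ftens ?T ?E"
      by (simp add: ftens_mult mult.assoc)
    finally show ?thesis .
  qed
  have "tmap f (comult_gen R' (E i)) * W = ftens (f ?E) 1 * W + ftens ?T' (f ?E) * W"
    by (simp add: is_linearD[OF lin_tmap] tmap_ftens[OF lin_f] is_alg_homD(2)[OF alg_twist_map] f_hexp_tor distrib_right)
  also have "\<dots> \<doteqdot> W * ftens (X i) (X i) * ftens ?E 1 + W * ftens (X i) (X i) * ftens ?T ?E"
    by (rule K.eqv_add[OF 1 2])
  also have "\<dots> = W * (ftens (X i) (X i) * free_comult R ?E)"
    by (simp add: algebra_simps)
  also have "\<dots> \<doteqdot> W * (free_comult R (hexp (l i)) * free_comult R ?E)"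
    by (intro K.eqv_mult_left K.eqv_mult_right K.eqv_sym[OF comult_hexp_exponent])
  also have "\<dots> = W * free_comult R (f ?E)"
    by (simp add: is_alg_homD(3)[OF alg_free_comult])
  finally show ?thesis .
qed

text \<open>Mirror image of the argument for \<open>E\<close>: the exponential stands to the right
  of \<open>F i\<close>, and the first summand uses \<open>Tminus_twist\<close>.\<close>

lemma comult_twist_F: "tmap f (comult_gen R' (F i)) * W \<doteqdot> W * free_comult R (f (gen (F i)))"
proof -
  let ?T = "hexp (- tor (Tminus R i))" and ?T' = "hexp (- tor (Tminus R' i))" and ?F = "gen (F i)"
  note lin_f = is_alg_homD(1)[OF alg_twist_map]
  have 1: "ftens (f ?F) ?T' * W \<doteqdot> W * (ftens ?F ?T * ftens (X i) (X i))"
  proof -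
    let ?N = "hexp (tor (- Tminus R' i))"
    have "ftens (f ?F) ?T' * W \<doteqdot> ftens (?F * X i) ?N * W"
      by (intro K.eqv_mult_right ftens_eqv f_F hexp_tor_minus)
    also have "\<dots> = ftens ?F 1 * (ftens (X i) ?N * W)"
      by (simp add: ftens_mult flip: mult.assoc)
    also have "\<dots> \<doteqdot> ftens ?F 1 * (W * ftens (X i) ?N)"
      by (rule K.eqv_mult_left[OF toral_twist_commute])
    also have "\<dots> = (ftens ?F 1 * W) * ftens (X i) ?N" by (simp only: mult.assoc)
    also have "\<dots> \<doteqdot> (ftens 1 (Y i) * W * ftens ?F 1) * ftens (X i) ?N"
      by (rule K.eqv_mult_right[OF conj_F(1)])
    also have "\<dots> \<doteqdot> (W * ftens 1 (Y i) * ftens ?F 1) * ftens (X i) ?N"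
      by (intro K.eqv_mult_right toral_twist_commute_right)
    also have "\<dots> = W * ftens (?F * X i) (Y i * ?N)" by (simp add: ftens_mult mult.assoc)
    also have "\<dots> \<doteqdot> W * ftens (?F * X i) (Y i * ?T')"
      by (intro K.eqv_mult_left ftens_eqv J.eqv_refl J.eqv_mult_left J.eqv_sym[OF hexp_tor_minus])
    also have "\<dots> \<doteqdot> W * ftens (?F * X i) (?T * X i)"
      by (intro K.eqv_mult_left ftens_eqv J.eqv_refl Tminus_twist)
    finally show ?thesis by (simp add: ftens_mult)
  qed
  have 2: "ftens 1 (f ?F) * W \<doteqdot> W * (ftens 1 ?F * ftens (X i) (X i))"
  proof -
    have "ftens 1 (f ?F) * W \<doteqdot> ftens 1 (?F * X i) * W"
      by (intro K.eqv_mult_right ftens_eqv f_F J.eqv_refl)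
    also have "\<dots> = ftens 1 ?F * (ftens 1 (X i) * W)"
      by (simp add: ftens_mult flip: mult.assoc)
    also have "\<dots> \<doteqdot> ftens 1 ?F * (W * ftens 1 (X i))"
      by (rule K.eqv_mult_left[OF toral_twist_commute_right])
    also have "\<dots> = (ftens 1 ?F * W) * ftens 1 (X i)" by (simp only: mult.assoc)
    also have "\<dots> \<doteqdot> (ftens (X i) 1 * W * ftens 1 ?F) * ftens 1 (X i)"
      by (rule K.eqv_mult_right[OF conj_F(2)])
    also have "\<dots> \<doteqdot> (W * ftens (X i) 1 * ftens 1 ?F) * ftens 1 (X i)"
      by (intro K.eqv_mult_right toral_twist_commute_left)
    also have "\<dots> = W * (ftens 1 ?F * ftens (X i) (X i))"
      by (simp add: ftens_mult mult.assoc)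
    finally show ?thesis .
  qed
  have "tmap f (comult_gen R' (F i)) * W = ftens (f ?F) ?T' * W + ftens 1 (f ?F) * W"
    by (simp add: is_linearD[OF lin_tmap] tmap_ftens[OF lin_f] is_alg_homD(2)[OF alg_twist_map] f_hexp_tor distrib_right)
  also have "\<dots> \<doteqdot> W * (ftens ?F ?T * ftens (X i) (X i)) + W * (ftens 1 ?F * ftens (X i) (X i))"
    by (rule K.eqv_add[OF 1 2])
  also have "\<dots> = W * (free_comult R ?F * ftens (X i) (X i))"
    by (simp add: algebra_simps)
  also have "\<dots> \<doteqdot> W * (free_comult R ?F * free_comult R (hexp (l i)))"
    by (intro K.eqv_mult_left K.eqv_sym[OF comult_hexp_exponent])
  also have "\<dots> = W * free_comult R (f ?F)"
    by (simp add: is_alg_homD(3)[OF alg_free_comult])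
  finally show ?thesis .
qed

lemma comult_twist_Tor: "tmap f (comult_gen R' (Tor T)) * W \<doteqdot> W * free_comult R (f (gen (Tor T)))"
proof -
  have "ftens (tor T) 1 * W + ftens 1 (tor T) * W \<doteqdot> W * ftens (tor T) 1 + W * ftens 1 (tor T)"
    by (intro K.eqv_add K.intertwine_hexp toral_exponent_tor)
  then show ?thesis
    by (simp add: is_linearD[OF lin_tmap] tmap_ftens[OF is_alg_homD(1)[OF alg_twist_map]] is_alg_homD(2)[OF alg_twist_map]
      distrib_left distrib_right)
qed

text \<open>As an intertwining relation, instead of a conjugation, the claim is linear in
  \<open>x\<close> and passes to products by moving \<open>W\<close> through one factor at a
  time.\<close>

lemma comult_twist: "tmap f (free_comult R' x) * W \<doteqdot> W * free_comult R (f x)"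
proof -
  note a = alg_compose[OF alg_tmap[OF alg_twist_map] alg_free_comult]
    and b = alg_compose[OF alg_free_comult alg_twist_map]
  let ?g = "\<lambda>x. tmap f (free_comult R' x)" and ?h = "\<lambda>x. free_comult R (f x)"
  let ?S = "{x. ?g x * W \<doteqdot> W * ?h x}"
  have is_linear: "is_linear (\<lambda>x. ?g x * W - W * ?h x)"
    by (rule lin_diff[OF lin_compose[OF lin_mult_right is_alg_homD(1)[OF a]] lin_compose[OF lin_mult_left is_alg_homD(1)[OF b]]])
  have "x \<in> ?S"
  proof (rule closed_submodule_gen_UNIV)
    show "closed_submodule ?S"
      using closed_submodule_vimage[OF is_linear K.closed_submodule] by (simp add: vimage_def K.eqv_def)
    show "1 \<in> ?S" by (simp add: is_alg_homD(2)[OF a] is_alg_homD(2)[OF b])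
    show "gen x \<in> ?S" for x
      by (cases x) (simp_all only: mem_Collect_eq free_comult_gen comult_twist_E comult_twist_F comult_twist_Tor)
    fix x y assume "x \<in> ?S" "y \<in> ?S"
    then have x: "?g x * W \<doteqdot> W * ?h x" and y: "?g y * W \<doteqdot> W * ?h y" by auto
    have "?g (x * y) * W = ?g x * (?g y * W)" by (simp add: is_alg_homD(3)[OF a] mult.assoc)
    also have "\<dots> \<doteqdot> ?g x * (W * ?h y)" by (rule K.eqv_mult_left[OF y])
    also have "\<dots> = (?g x * W) * ?h y" by (simp only: mult.assoc)
    also have "\<dots> \<doteqdot> (W * ?h x) * ?h y" by (rule K.eqv_mult_right[OF x])
    also have "\<dots> = W * ?h (x * y)" by (simp add: is_alg_homD(3)[OF b] mult.assoc)
    finally show "x * y \<in> ?S" by simp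
  qed
  then show ?thesis by simp
qed

lemma comult_twist_inverse: "tmap f (free_comult R' x) \<doteqdot> W * free_comult R (f x) * hexp (- Z)"
proof -
  have "tmap f (free_comult R' x) = tmap f (free_comult R' x) * W * hexp (- Z)"
    by (simp add: mult.assoc hexp_minus_inverse)
  also have "\<dots> \<doteqdot> W * free_comult R (f x) * hexp (- Z)"
    by (rule K.eqv_mult_right[OF comult_twist])
  finally show ?thesis .
qed

lemma f_tens_ideal: "x \<in> tens_ideal (uq_ideal A d P' R') \<Longrightarrow> tmap f x \<in> tens_ideal (uq_ideal A d P R)"
  unfolding tens_ideal_def
proof (rule closed_ideal_image_subset[OF alg_tmap[OF alg_twist_map]])
  fix x assume "x \<in> {ftens x y | x y. x \<in> uq_ideal A d P' R' \<or> y \<in> uq_ideal A d P' R'}"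
  then show "tmap f x \<in> closed_ideal {ftens x y | x y. x \<in> uq_ideal A d P R \<or> y \<in> uq_ideal A d P R}"
    using f_ideal by (intro subsetD[OF closed_ideal_superset]) (auto simp: tmap_ftens[OF is_alg_homD(1)[OF alg_twist_map]], blast+)
qed

end

section \<open>The counit\<close>

lemma free_counit_coord: "free_counit x = coord 0 x"
  by (simp add: free_counit_def coord_def)

text \<open>Composition with \<open>scal\<close> makes the counit a morphism between completed
  algebras, to which \<open>alg_eqI\<close> applies. It is multiplicative because a product of words
  is empty only if both words are.\<close>

lemma alg_scal_free_counit: "is_alg_hom (\<lambda>x :: ('x fmon \<Rightarrow>\<^sub>0 'k::field_char_0) fps. scal (free_counit x) :: ('x fmon \<Rightarrow>\<^sub>0 'k) fps)"
  unfolding free_counit_coord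
proof (rule alg_linI)
  show "scal (coord 0 (mon u * mon v)) =
      (scal (coord 0 (mon u)) * scal (coord 0 (mon v)) :: ('x fmon \<Rightarrow>\<^sub>0 'k) fps)" for u v :: "'x fmon"
    by (cases u; cases v) (simp add: coord_mon zero_fmon_def plus_fmon_def flip: mon_add)
qed (simp_all add: is_linear_def scal_add scal_mult coord_mon flip: mon_zero)

lemma free_counit_gen: "free_counit (gen x) = 0"
  by (simp add: free_counit_coord gen_mon coord_mon zero_fmon_def)

lemma free_counit_twist_map:
  fixes R :: "('k::field_char_0, 'h::ab_group_add, 'i) realization"
  shows "free_counit (twist_map R H \<Phi> x) = free_counit x"
proof -
  let ?e = "\<lambda>x :: ('k, 'h, 'i) uqfree. scal (free_counit x) :: ('k, 'h, 'i) uqfree"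
  have "scal (free_counit (twist_map R H \<Phi> x)) = ?e x"
  proof (rule alg_eqI[of "\<lambda>x. ?e (twist_map R H \<Phi> x)"])
    show "?e (twist_map R H \<Phi> (gen x)) = ?e (gen x)" for x
      by (cases x) (simp_all add: is_alg_homD(3)[OF alg_scal_free_counit] free_counit_gen)
  qed (intro alg_compose[OF alg_scal_free_counit alg_twist_map] alg_scal_free_counit)+
  then show ?thesis by (simp add: scal_inject)
qed

section \<open>Transport of structure\<close>

text \<open>Compatibility is required on the whole types, not only on the carriers: the maps below are
  of the form \<open>C \<mapsto> f ` C\<close>, and all operations of the quotient algebras are defined for arbitrary
  sets.\<close>

definition mod_bij ::
    "('k::field_char_0 fps, 'a, 'y) module_scheme \<Rightarrow> ('k fps, 'b, 'z) module_scheme \<Rightarrow> ('a \<Rightarrow> 'b) \<Rightarrow> bool" where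
  "mod_bij M N f \<longleftrightarrow> bij f \<and> f ` carrier M = carrier N \<and>
     (\<forall>x y. f (x \<oplus>\<^bsub>M\<^esub> y) = f x \<oplus>\<^bsub>N\<^esub> f y) \<and> (\<forall>x y. f (x \<otimes>\<^bsub>M\<^esub> y) = f x \<otimes>\<^bsub>N\<^esub> f y) \<and>
     (\<forall>c x. f (c \<odot>\<^bsub>M\<^esub> x) = c \<odot>\<^bsub>N\<^esub> f x) \<and> f \<one>\<^bsub>M\<^esub> = \<one>\<^bsub>N\<^esub>"

lemma mod_bijD:
  assumes "mod_bij M N f"
  shows "bij f" "f ` carrier M = carrier N" "f (x \<oplus>\<^bsub>M\<^esub> y) = f x \<oplus>\<^bsub>N\<^esub> f y"
    "f (x \<otimes>\<^bsub>M\<^esub> y) = f x \<otimes>\<^bsub>N\<^esub> f y" "f (c \<odot>\<^bsub>M\<^esub> x) = c \<odot>\<^bsub>N\<^esub> f x" "f \<one>\<^bsub>M\<^esub> = \<one>\<^bsub>N\<^esub>"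
    "inv_into UNIV f (f x) = x" "f (inv_into UNIV f z) = z" "f x \<in> carrier N \<longleftrightarrow> x \<in> carrier M"
  using assms by (auto simp: mod_bij_def bij_is_inj bij_is_surj surj_f_inv_f inj_image_mem_iff
    simp flip: bij_betw_def dest: inj_image_mem_iff[OF bij_is_inj, of f x])

lemma mod_bij_inv: "mod_bij M N f \<Longrightarrow> mod_bij N M (inv_into UNIV f)"
proof -
  assume f: "mod_bij M N f"
  note D = mod_bijD[OF f]
  let ?g = "inv_into UNIV f"
  have g: "x = ?g z" if "f x = z" for x z using that D(7) by auto
  have "bij ?g" using D(1) by (rule bij_imp_bij_inv)
  moreover have "?g ` carrier N = carrier M"
    unfolding D(2)[symmetric] by (simp add: image_image D(7))
  moreover have "?g (x \<oplus>\<^bsub>N\<^esub> y) = ?g x \<oplus>\<^bsub>M\<^esub> ?g y" "?g (x \<otimes>\<^bsub>N\<^esub> y) = ?g x \<otimes>\<^bsub>M\<^esub> ?g y"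
    "?g (c \<odot>\<^bsub>N\<^esub> x) = c \<odot>\<^bsub>M\<^esub> ?g x" "?g \<one>\<^bsub>N\<^esub> = \<one>\<^bsub>M\<^esub>" for x y c
    by (rule g[symmetric], simp add: D(3,4,5,6,8))+
  ultimately show ?thesis by (simp add: mod_bij_def)
qed

lemma hadic_open_image:
  assumes f: "mod_bij M N f" and U: "hadic_open M U"
  shows "hadic_open N (f ` U)"
  unfolding hadic_open_def
proof (intro conjI ballI)
  note D = mod_bijD[OF f]
  show "f ` U \<subseteq> carrier N" using U D(2) by (auto simp: hadic_open_def)
  fix z assume "z \<in> f ` U"
  then obtain x where x: "z = f x" "x \<in> U" by blast
  then obtain n where "\<forall>m\<ge>n. \<forall>y\<in>carrier M. x \<oplus>\<^bsub>M\<^esub> (fps_X ^ m \<odot>\<^bsub>M\<^esub> y) \<in> U"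
    using U unfolding hadic_open_def by blast
  then have n: "x \<oplus>\<^bsub>M\<^esub> (fps_X ^ m \<odot>\<^bsub>M\<^esub> y) \<in> U" if "m \<ge> n" "y \<in> carrier M" for m y
    using that by blast
  show "\<exists>n. \<forall>m\<ge>n. \<forall>y\<in>carrier N. z \<oplus>\<^bsub>N\<^esub> (fps_X ^ m \<odot>\<^bsub>N\<^esub> y) \<in> f ` U"
  proof (intro exI[of _ n] allI impI ballI)
    fix m y assume m: "n \<le> m" and "y \<in> carrier N"
    then obtain y' where "y = f y'" "y' \<in> carrier M" using D(2) by blast
    with n[OF m, of y'] show "z \<oplus>\<^bsub>N\<^esub> (fps_X ^ m \<odot>\<^bsub>N\<^esub> y) \<in> f ` U"
      by (auto simp: x(1) D(3,5)[symmetric])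
  qed
qed

lemma hadic_open_vimage:
  assumes f: "mod_bij M N f" and U: "hadic_open N U"
  shows "hadic_open M (f -` U)"
  using hadic_open_image[OF mod_bij_inv[OF f] U] bij_vimage_eq_inv_image[OF mod_bijD(1)[OF f], of U] by simp

text \<open>Only an inclusion, because in an arbitrary record the carrier need not be open.\<close>

lemma topspace_hadic_subset: "topspace (hadic M) \<subseteq> carrier M"
  by (auto simp: topspace_def openin_hadic hadic_open_def)

lemma topspace_hadic_image:
  assumes f: "mod_bij M N f" shows "f ` topspace (hadic M) = topspace (hadic N)"
proof
  show "f ` topspace (hadic M) \<subseteq> topspace (hadic N)"
    using hadic_open_image[OF f] by (force simp: topspace_def openin_hadic)
  show "topspace (hadic N) \<subseteq> f ` topspace (hadic M)"
  proof
    fix z assume "z \<in> topspace (hadic N)"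
    then obtain U where "hadic_open N U" "z \<in> U" by (auto simp: topspace_def openin_hadic)
    then have "hadic_open M (f -` U)" "inv_into UNIV f z \<in> f -` U"
      using hadic_open_vimage[OF f] mod_bijD(8)[OF f] by auto
    then have "inv_into UNIV f z \<in> topspace (hadic M)" by (auto simp: topspace_def openin_hadic)
    then show "z \<in> f ` topspace (hadic M)" using mod_bijD(8)[OF f, of z] by force
  qed
qed

lemma homeomorphic_hadic:
  assumes f: "mod_bij M N f" shows "homeomorphic_map (hadic M) (hadic N) f"
proof (rule bijective_open_imp_homeomorphic_map)
  show "continuous_map (hadic M) (hadic N) f"
    unfolding continuous_map_def
  proof (intro conjI allI impI)
    show "f \<in> topspace (hadic M) \<rightarrow> topspace (hadic N)" using topspace_hadic_image[OF f] by blast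
    fix U assume U: "openin (hadic N) U"
    then have "U \<subseteq> topspace (hadic N)" by (rule openin_subset)
    then have "{x \<in> topspace (hadic M). f x \<in> U} = f -` U"
      using topspace_hadic_image[OF f] mod_bijD(7)[OF f] by (auto, metis imageE subsetD)
    then show "openin (hadic M) {x \<in> topspace (hadic M). f x \<in> U}"
      using hadic_open_vimage[OF f] U by (simp add: openin_hadic)
  qed
  show "open_map (hadic M) (hadic N) f"
    using hadic_open_image[OF f] by (simp add: open_map_def openin_hadic)
  show "f ` topspace (hadic M) = topspace (hadic N)" by (rule topspace_hadic_image[OF f])
  show "inj_on f (topspace (hadic M))"
    using mod_bijD(1)[OF f] by (meson bij_is_inj inj_on_subset subset_UNIV)
qed

lemma mod_bij_top_alg_iso:
  assumes f: "mod_bij M N f" shows "top_alg_iso M N f"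
proof -
  note D = mod_bijD[OF f]
  have "f \<in> ring_iso M N"
    unfolding ring_iso_def ring_hom_def bij_betw_def using D(2) bij_is_inj[OF D(1)]
    by (auto simp: D(3-6) intro: inj_on_subset)
  then show ?thesis
    using homeomorphic_hadic[OF f] by (simp add: top_alg_iso_def D(5))
qed

text \<open>\<open>S'\<close> is known only on images of the carrier of \<open>M\<close>, so that
  carrier must be closed under the operations before \<open>eq\<close> applies to sums and
  multiples.\<close>

lemma top_linear_transport:
  assumes f: "mod_bij M M' f" and g: "mod_bij N N' g" and S: "top_linear M N S"
    and eq: "\<And>x. x \<in> carrier M \<Longrightarrow> g (S x) = S' (f x)"
    and closed: "\<And>x y. x \<in> carrier M \<Longrightarrow> y \<in> carrier M \<Longrightarrow> x \<oplus>\<^bsub>M\<^esub> y \<in> carrier M"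
      "\<And>c x. x \<in> carrier M \<Longrightarrow> c \<odot>\<^bsub>M\<^esub> x \<in> carrier M"
  shows "top_linear M' N' S'"
  unfolding top_linear_def
proof (intro conjI ballI allI)
  note Df = mod_bijD[OF f] and Dg = mod_bijD[OF g]
  have Sm: "\<And>x. x \<in> carrier M \<Longrightarrow> S x \<in> carrier N"
    "\<And>x y. x \<in> carrier M \<Longrightarrow> y \<in> carrier M \<Longrightarrow> S (x \<oplus>\<^bsub>M\<^esub> y) = S x \<oplus>\<^bsub>N\<^esub> S y"
    "\<And>c x. x \<in> carrier M \<Longrightarrow> S (c \<odot>\<^bsub>M\<^esub> x) = c \<odot>\<^bsub>N\<^esub> S x"
    and cont: "continuous_map (hadic M) (hadic N) S"
    using S by (auto simp: top_linear_def)
  have car: "\<exists>x'\<in>carrier M. x = f x'" if "x \<in> carrier M'" for x using that Df(2) by blast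
  show "S' \<in> carrier M' \<rightarrow> carrier N'"
  proof
    fix x assume "x \<in> carrier M'"
    then obtain x' where "x' \<in> carrier M" "x = f x'" using car by blast
    then show "S' x \<in> carrier N'" using eq Sm(1) Dg(9) by metis
  qed
  fix x assume "x \<in> carrier M'"
  then obtain x' where x': "x' \<in> carrier M" "x = f x'" using car by blast
  show "S' (c \<odot>\<^bsub>M'\<^esub> x) = c \<odot>\<^bsub>N'\<^esub> S' x" for c
    using eq[OF closed(2)[OF x'(1)], of c] eq[OF x'(1)] by (simp add: x' Df(5) Sm(3) Dg(5))
  fix y assume "y \<in> carrier M'"
  then obtain y' where y': "y' \<in> carrier M" "y = f y'" using car by blast
  show "S' (x \<oplus>\<^bsub>M'\<^esub> y) = S' x \<oplus>\<^bsub>N'\<^esub> S' y"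
    using eq[OF closed(1)[OF x'(1) y'(1)]] eq[OF x'(1)] eq[OF y'(1)] by (simp add: x' y' Df(3) Sm(2) Dg(3))
next
  note Df = mod_bijD[OF f] and Dg = mod_bijD[OF g]
  have cont: "continuous_map (hadic M) (hadic N) S" using S by (auto simp: top_linear_def)
  \<comment> \<open>Continuity is proved for this composite, which agrees with \<open>S'\<close> on
    the topological space.\<close>
  let ?h = "g \<circ> S \<circ> inv_into UNIV f"
  have "continuous_map (hadic M') (hadic N') ?h"
    by (intro continuous_map_compose[OF _ continuous_map_compose[OF cont]]
        homeomorphic_imp_continuous_map homeomorphic_hadic mod_bij_inv f g)
  moreover have "?h x = S' x" if "x \<in> topspace (hadic M')" for x
  proof -
    have "inv_into UNIV f x \<in> carrier M"
      using that topspace_hadic_subset[of M'] Df(8,9) by (metis subsetD)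
    then show ?thesis using eq[of "inv_into UNIV f x"] by (simp add: Df(8))
  qed
  ultimately show "continuous_map (hadic M') (hadic N') S'"
    by (rule continuous_map_eq)
qed

definition hopf_bij :: "('k::field_char_0, 'a, 't) hopf \<Rightarrow> ('k, 'b, 'u) hopf \<Rightarrow> ('a \<Rightarrow> 'b) \<Rightarrow> ('t \<Rightarrow> 'u) \<Rightarrow> bool" where
  "hopf_bij H K f f2 \<longleftrightarrow> mod_bij H K f \<and> mod_bij (tsquare H) (tsquare K) f2 \<and>
     (\<forall>x y. f2 (tens H x y) = tens K (f x) (f y)) \<and> (\<forall>x. f2 (comult H x) = comult K (f x)) \<and>
     (\<forall>x. counit K (f x) = counit H x)"

lemma hopf_bij_inv:
  assumes "hopf_bij H K f f2" shows "hopf_bij K H (inv_into UNIV f) (inv_into UNIV f2)"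
proof -
  from assms have f: "mod_bij H K f" and f2: "mod_bij (tsquare H) (tsquare K) f2"
    and eqs: "\<And>x y. f2 (tens H x y) = tens K (f x) (f y)" "\<And>x. f2 (comult H x) = comult K (f x)"
      "\<And>x. counit K (f x) = counit H x"
    by (auto simp: hopf_bij_def)
  have g: "inv_into UNIV f2 z = x" if "f2 x = z" for x z using that mod_bijD(7)[OF f2] by auto
  show ?thesis
    unfolding hopf_bij_def
  proof (intro conjI allI mod_bij_inv f f2)
    fix x y
    show "inv_into UNIV f2 (tens K x y) = tens H (inv_into UNIV f x) (inv_into UNIV f y)"
      by (rule g) (simp add: eqs mod_bijD(8)[OF f])
    show "inv_into UNIV f2 (comult K x) = comult H (inv_into UNIV f x)"
      by (rule g) (simp add: eqs mod_bijD(8)[OF f])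
    show "counit H (inv_into UNIV f x) = counit K x"
      using eqs(3)[of "inv_into UNIV f x"] by (simp add: mod_bijD(8)[OF f])
  qed
qed

definition sub_closed :: "('k::field_char_0 fps, 'a, 'y) module_scheme \<Rightarrow> bool" where
  "sub_closed M \<longleftrightarrow> (\<forall>x\<in>carrier M. \<forall>y\<in>carrier M. x \<oplus>\<^bsub>M\<^esub> y \<in> carrier M) \<and>
     (\<forall>c. \<forall>x\<in>carrier M. c \<odot>\<^bsub>M\<^esub> x \<in> carrier M)"

lemma sub_closed_image:
  assumes f: "mod_bij M N f" and M: "sub_closed M" shows "sub_closed N"
  using M unfolding sub_closed_def mod_bijD(2)[OF f, symmetric]
  by (auto simp: mod_bijD(3,5)[OF f, symmetric])

text \<open>The two maps witnessing the antipode axioms are carried over by composing with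
  \<open>f\<close> and with the inverse of \<open>f2\<close>.\<close>

lemma is_antipode_transport:
  assumes h: "hopf_bij H K f f2" and closed: "sub_closed H" and S: "is_antipode H S"
    and eq: "\<And>x. x \<in> carrier H \<Longrightarrow> f (S x) = S' (f x)"
  shows "is_antipode K S'"
proof -
  from h have f: "mod_bij H K f" and f2: "mod_bij (tsquare H) (tsquare K) f2"
    and eqs: "\<And>x y. f2 (tens H x y) = tens K (f x) (f y)" "\<And>x. f2 (comult H x) = comult K (f x)"
      "\<And>x. counit K (f x) = counit H x"
    by (auto simp: hopf_bij_def)
  let ?g2 = "inv_into UNIV f2"
  note D = mod_bijD[OF f] and D2 = mod_bijD[OF f2]
  from S obtain \<phi> \<psi> where is_linear: "top_linear H H S" "top_linear (tsquare H) H \<phi>" "top_linear (tsquare H) H \<psi>"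
    and tens: "\<And>a b. a \<in> carrier H \<Longrightarrow> b \<in> carrier H \<Longrightarrow>
           \<phi> (tens H a b) = S a \<otimes>\<^bsub>H\<^esub> b \<and> \<psi> (tens H a b) = a \<otimes>\<^bsub>H\<^esub> S b"
    and com: "\<And>x. x \<in> carrier H \<Longrightarrow>
           \<phi> (comult H x) = counit H x \<odot>\<^bsub>H\<^esub> \<one>\<^bsub>H\<^esub> \<and>
           \<psi> (comult H x) = counit H x \<odot>\<^bsub>H\<^esub> \<one>\<^bsub>H\<^esub>"
    unfolding is_antipode_def by blast
  have pull: "\<exists>x'\<in>carrier H. x = f x'" if "x \<in> carrier K" for x using that D(2) by blast
  have g2t: "?g2 (tens K (f a) (f b)) = tens H a b" "?g2 (comult K (f a)) = comult H a" for a b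
    by (simp_all add: eqs[symmetric] D2(7))
  have is_linear': "top_linear (tsquare K) K (\<lambda>x. f (\<theta> (?g2 x)))" if "top_linear (tsquare H) H \<theta>" for \<theta>
  proof -
    have g2c: "?g2 x \<in> carrier (tsquare H)" if "x \<in> carrier (tsquare K)" for x
      using that D2(8)[of x] D2(9)[of "?g2 x"] by simp
    note E = mod_bijD[OF mod_bij_inv[OF f2]]
    show ?thesis
      using that g2c continuous_map_compose[OF homeomorphic_imp_continuous_map[OF homeomorphic_hadic[OF mod_bij_inv[OF f2]]]
        continuous_map_compose[OF _ homeomorphic_imp_continuous_map[OF homeomorphic_hadic[OF f]], of _ \<theta>]]
      unfolding top_linear_def
      by (auto simp: E(3,5) D(3,5,9) Pi_iff o_def)
  qed
  show ?thesis
    unfolding is_antipode_def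
  proof (intro conjI exI)
    show "top_linear K K S'"
      using closed by (intro top_linear_transport[OF f f is_linear(1) eq]) (auto simp: sub_closed_def)
    show "top_linear (tsquare K) K (\<lambda>x. f (\<phi> (?g2 x)))" "top_linear (tsquare K) K (\<lambda>x. f (\<psi> (?g2 x)))"
      by (rule is_linear'[OF is_linear(2)], rule is_linear'[OF is_linear(3)])
    show "\<forall>a\<in>carrier K. \<forall>b\<in>carrier K.
       f (\<phi> (?g2 (tens K a b))) = S' a \<otimes>\<^bsub>K\<^esub> b \<and> f (\<psi> (?g2 (tens K a b))) = a \<otimes>\<^bsub>K\<^esub> S' b"
      using tens by (auto dest!: pull simp: g2t D(4) eq)
    show "\<forall>x\<in>carrier K.
       f (\<phi> (?g2 (comult K x))) = counit K x \<odot>\<^bsub>K\<^esub> \<one>\<^bsub>K\<^esub> \<and>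
       f (\<psi> (?g2 (comult K x))) = counit K x \<odot>\<^bsub>K\<^esub> \<one>\<^bsub>K\<^esub>"
      using com by (auto dest!: pull simp: g2t D(5,6) eqs(3))
  qed
qed

lemma hopf_bij_top_hopf_iso:
  assumes h: "hopf_bij H K f f2" and closed: "sub_closed H"
  shows "top_hopf_iso H K f"
proof -
  from h have f: "mod_bij H K f" and f2: "mod_bij (tsquare H) (tsquare K) f2"
    and eqs: "\<And>x y. f2 (tens H x y) = tens K (f x) (f y)" "\<And>x. f2 (comult H x) = comult K (f x)"
      "\<And>x. counit K (f x) = counit H x"
    by (auto simp: hopf_bij_def)
  note D = mod_bijD[OF f]
  have "is_antipode H S \<longleftrightarrow> is_antipode K S'" if eq: "\<forall>x\<in>carrier H. f (S x) = S' (f x)" for S S'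
  proof
    show "is_antipode H S \<Longrightarrow> is_antipode K S'"
      using is_antipode_transport[OF h closed] eq by blast
    have "inv_into UNIV f (S' x) = S (inv_into UNIV f x)" if "x \<in> carrier K" for x
    proof -
      from that obtain y where "y \<in> carrier H" "x = f y" using D(2) by blast
      then show ?thesis using eq D(7) by metis
    qed
    then show "is_antipode K S' \<Longrightarrow> is_antipode H S"
      using is_antipode_transport[OF hopf_bij_inv[OF h] sub_closed_image[OF f closed]] by blast
  qed
  then show ?thesis
    using mod_bij_top_alg_iso[OF f] mod_bij_top_alg_iso[OF f2] eqs
    unfolding top_hopf_iso_def by blast
qed

section \<open>Generated complete subalgebras\<close>

definition closed_subalgebra :: "('k::field_char_0 fps, 'a, 'z) module_scheme \<Rightarrow> 'a set \<Rightarrow> bool" where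
  "closed_subalgebra M B \<longleftrightarrow> B \<subseteq> carrier M \<and> \<one>\<^bsub>M\<^esub> \<in> B \<and>
         (\<forall>x\<in>B. \<forall>y\<in>B. x \<oplus>\<^bsub>M\<^esub> y \<in> B \<and> x \<otimes>\<^bsub>M\<^esub> y \<in> B) \<and>
         (\<forall>c. \<forall>x\<in>B. c \<odot>\<^bsub>M\<^esub> x \<in> B) \<and>
         closedin (hadic M) B"

lemma complete_subalgebra_gen_eq: "complete_subalgebra_gen M S = \<Inter>{B. S \<subseteq> B \<and> closed_subalgebra M B}"
  by (simp add: complete_subalgebra_gen_def closed_subalgebra_def)

lemma complete_subalgebra_gen_mono:
  "S \<subseteq> complete_subalgebra_gen M S' \<Longrightarrow> complete_subalgebra_gen M S \<subseteq> complete_subalgebra_gen M S'"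
  unfolding complete_subalgebra_gen_eq by blast

lemma complete_subalgebra_gen_superset: "S \<subseteq> complete_subalgebra_gen M S"
  unfolding complete_subalgebra_gen_eq by blast

lemma closed_subalgebra_vimage:
  assumes f: "mod_bij M N f" and B: "closed_subalgebra N B"
  shows "closed_subalgebra M (f -` B)"
proof -
  note D = mod_bijD[OF f]
  have "{x \<in> topspace (hadic M). f x \<in> B} = f -` B"
  proof -
    have "x \<in> topspace (hadic M)" if "f x \<in> B" for x
    proof -
      have "f x \<in> topspace (hadic N)" using B that closedin_subset by (auto simp: closed_subalgebra_def)
      then show ?thesis using topspace_hadic_image[OF f] D(7) by (metis imageE)
    qed
    then show ?thesis by auto
  qed
  moreover have "closedin (hadic M) {x \<in> topspace (hadic M). f x \<in> B}"
    using B closedin_continuous_map_preimage[OF homeomorphic_imp_continuous_map[OF homeomorphic_hadic[OF f]]]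
    by (auto simp: closed_subalgebra_def)
  ultimately show ?thesis
    using B by (auto simp: closed_subalgebra_def D(3-6) D(9)[symmetric])
qed

lemma complete_subalgebra_gen_image_subset:
  assumes f: "mod_bij M N f" and x: "x \<in> complete_subalgebra_gen M S"
  shows "f x \<in> complete_subalgebra_gen N (f ` S)"
  unfolding complete_subalgebra_gen_eq
proof (rule InterI, clarify)
  fix B assume "f ` S \<subseteq> B" "closed_subalgebra N B"
  then have "S \<subseteq> f -` B" "closed_subalgebra M (f -` B)" using closed_subalgebra_vimage[OF f] by auto
  then show "f x \<in> B" using x unfolding complete_subalgebra_gen_eq by blast
qed

lemma complete_subalgebra_gen_image:
  assumes f: "mod_bij M N f"
  shows "f ` complete_subalgebra_gen M S = complete_subalgebra_gen N (f ` S)"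
proof
  show "f ` complete_subalgebra_gen M S \<subseteq> complete_subalgebra_gen N (f ` S)"
    using complete_subalgebra_gen_image_subset[OF f] by blast
  show "complete_subalgebra_gen N (f ` S) \<subseteq> f ` complete_subalgebra_gen M S"
  proof
    fix z assume "z \<in> complete_subalgebra_gen N (f ` S)"
    from complete_subalgebra_gen_image_subset[OF mod_bij_inv[OF f] this]
    have "inv_into UNIV f z \<in> complete_subalgebra_gen M S"
      by (simp add: image_image mod_bijD(7)[OF f])
    then show "z \<in> f ` complete_subalgebra_gen M S"
      using mod_bijD(8)[OF f, of z] by (metis imageI)
  qed
qed

section \<open>Images of quotient algebras, and subalgebras lifted to the free algebra\<close>

lemma bij_image_inverse:
  assumes "\<And>x. f (g x) = x" "\<And>x. g (f x) = x" shows "bij (image f)"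
  by (rule o_bij[of "image g"]) (simp_all add: fun_eq_iff image_image assms)

lemma image_cls: "is_linear f \<Longrightarrow> f ` cls J x = cls (f ` J) (f x)"
  by (simp add: cls_eq image_image is_linearD)

lemma quot_alg_mod_bij:
  assumes f: "is_alg_hom f" and g: "\<And>x. f (g x) = x" "\<And>x. g (f x) = x"
  shows "mod_bij (quot_alg J) (quot_alg (f ` J)) (image f)"
proof -
  note I = image_cls[OF is_alg_homD(1)[OF f]]
  have "surj f" using g by (metis surjI)
  then have "range (cls (f ` J)) = image f ` range (cls J)"
    by (auto simp: image_image I) (metis surjD rangeI)
  then show ?thesis
    using bij_image_inverse[of f g, OF g]
    by (simp add: mod_bij_def quot_alg_simps I image_UN is_alg_homD[OF f] is_linearD[OF is_alg_homD(1)[OF f]])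
qed

lemma closed_submodule_INT: "(\<And>i. i \<in> I \<Longrightarrow> closed_submodule (S i)) \<Longrightarrow> closed_submodule (\<Inter>i\<in>I. S i)"
proof -
  assume S: "\<And>i. i \<in> I \<Longrightarrow> closed_submodule (S i)"
  have "h_closed (\<Inter>i\<in>I. S i)"
    unfolding h_closed_def
  proof (intro allI impI INT_I)
    fix x i assume x: "\<forall>n. \<exists>y\<in>(\<Inter>i\<in>I. S i). \<exists>r. x = y + scal (fps_X ^ n) * r" and i: "i \<in> I"
    show "x \<in> S i"
    proof (rule closed_submodule_hclosedD[OF S[OF i]])
      fix n show "\<exists>y\<in>S i. \<exists>r. x = y + scal (fps_X ^ n) * r"
        using x[rule_format, of n] i by blast
    qed
  qed
  then show ?thesis
    using S by (simp add: closed_submodule_def)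
qed

context mod_closed_ideal
begin

lemma openin_quot_carrier: "hadic_open (quot_alg J) (range (cls J))"
  by (auto simp: hadic_open_def quot_alg_simps(1) quot_smult quot_add)

lemma topspace_quot: "topspace (hadic (quot_alg J)) = range (cls J)"
  using openin_quot_carrier topspace_hadic_subset[of "quot_alg J"]
  by (auto simp: quot_alg_simps(1) topspace_def openin_hadic)

text \<open>Lifted to the free algebra, closedness for the topology \<open>hadic\<close> becomes
  \<open>h_closed\<close>, which makes the results on series applicable.\<close>

lemma closed_subalgebra_preimage:
  assumes B: "closed_subalgebra (quot_alg J) B"
  shows "closed_submodule {x. cls J x \<in> B}" "cls J 1 \<in> B" "cls J x \<in> B \<Longrightarrow> cls J y \<in> B \<Longrightarrow> cls J (x * y) \<in> B"
proof -
  have ops: "cls J x \<in> B \<Longrightarrow> cls J y \<in> B \<Longrightarrow> cls J (x + y) \<in> B"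
    "cls J x \<in> B \<Longrightarrow> cls J y \<in> B \<Longrightarrow> cls J (x * y) \<in> B"
    "cls J x \<in> B \<Longrightarrow> cls J (scal c * x) \<in> B" and one: "cls J 1 \<in> B" for x y c
    using B quot_add[of x y] quot_mult[of x y] quot_smult[of c x] unfolding closed_subalgebra_def
    by (metis, metis, metis, metis quot_alg_simps(4))
  show "cls J 1 \<in> B" "cls J x \<in> B \<Longrightarrow> cls J y \<in> B \<Longrightarrow> cls J (x * y) \<in> B"
    by (rule one, rule ops)
  have "x \<in> {x. cls J x \<in> B}" if *: "\<forall>n. \<exists>y\<in>{x. cls J x \<in> B}. \<exists>r. x = y + scal (fps_X ^ n) * r" for x
  proof (rule ccontr)
    assume "x \<notin> {x. cls J x \<in> B}"
    then have "cls J x \<in> topspace (hadic (quot_alg J)) - B" by (simp add: topspace_quot)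
    moreover have "hadic_open (quot_alg J) (topspace (hadic (quot_alg J)) - B)"
      using B by (simp add: closed_subalgebra_def closedin_def openin_hadic)
    ultimately obtain n where "\<forall>m\<ge>n. \<forall>C\<in>carrier (quot_alg J).
        cls J x \<oplus>\<^bsub>quot_alg J\<^esub> (fps_X ^ m \<odot>\<^bsub>quot_alg J\<^esub> C) \<in> topspace (hadic (quot_alg J)) - B"
      unfolding hadic_open_def by meson
    then have n: "cls J x \<oplus>\<^bsub>quot_alg J\<^esub> (fps_X ^ n \<odot>\<^bsub>quot_alg J\<^esub> cls J r) \<notin> B" for r
      by (simp add: quot_alg_simps(1))
    from * obtain y r where "cls J y \<in> B" "x = y + scal (fps_X ^ n) * r" by blast
    \<comment> \<open>The approximating \<open>y\<close> is \<open>x\<close> plus a multiple of the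
      \<open>n\<close>-th power of \<hbar>, so its class lies in the neighbourhood of the class of
      \<open>x\<close> that avoids \<open>B\<close>.\<close>
    then show False using n[of "- r"] by (simp add: quot_smult quot_add)
  qed
  then show "closed_submodule {x. cls J x \<in> B}"
    using ops(1,3) ops(3)[OF one, of 0] by (simp add: closed_submodule_def h_closed_def)
qed

definition preimage_gen where "preimage_gen S = {x. cls J x \<in> complete_subalgebra_gen (quot_alg J) S}"

lemma preimage_gen_eq: "preimage_gen S = (\<Inter>B\<in>{B. S \<subseteq> B \<and> closed_subalgebra (quot_alg J) B}. {x. cls J x \<in> B})"
  by (auto simp: preimage_gen_def complete_subalgebra_gen_eq)

lemma closed_submodule_preimage_gen: "closed_submodule (preimage_gen S)"
  unfolding preimage_gen_eq by (rule closed_submodule_INT) (simp add: closed_subalgebra_preimage)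

lemma preimage_gen_mult: "x \<in> preimage_gen S \<Longrightarrow> y \<in> preimage_gen S \<Longrightarrow> x * y \<in> preimage_gen S"
  by (auto simp: preimage_gen_eq closed_subalgebra_preimage)

lemma preimage_gen_one: "1 \<in> preimage_gen S"
  by (auto simp: preimage_gen_eq closed_subalgebra_preimage)

text \<open>Completeness of the generated subalgebra enters here: this is why the Borel parts
  contain the twisted generators.\<close>

lemma preimage_gen_hexp: "x \<in> preimage_gen S \<Longrightarrow> hexp x \<in> preimage_gen S"
proof (rule closed_submodule_hexp[OF closed_submodule_preimage_gen])
  fix n assume "x \<in> preimage_gen S"
  then show "x ^ n \<in> preimage_gen S" by (induction n) (auto intro: preimage_gen_mult preimage_gen_one)
qed

lemma preimage_gen_base: "cls J x \<in> S \<Longrightarrow> x \<in> preimage_gen S"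
  using complete_subalgebra_gen_superset[of S "quot_alg J"] by (auto simp: preimage_gen_def)

lemma complete_subalgebra_gen_range:
  assumes "S \<subseteq> range (cls J)" shows "complete_subalgebra_gen (quot_alg J) S \<subseteq> range (cls J)"
proof -
  have "closed_subalgebra (quot_alg J) (range (cls J))"
    using closedin_topspace[of "hadic (quot_alg J)"]
    by (auto simp: closed_subalgebra_def topspace_quot quot_alg_simps(1,4) quot_add quot_mult quot_smult)
  then show ?thesis using assms unfolding complete_subalgebra_gen_eq by blast
qed

lemma sub_closed_quot: "sub_closed (quot_alg J)"
  by (auto simp: sub_closed_def quot_alg_simps(1) quot_add quot_smult)

text \<open>The coproduct of a set is a union over representatives and is not assumed to be a single
  coset; multiplication by cosets must therefore distribute over unions.\<close>

lemma quot_mult_UN: "cls J x \<otimes>\<^bsub>quot_alg J\<^esub> (\<Union>i\<in>I. cls J (h i)) \<otimes>\<^bsub>quot_alg J\<^esub> cls J y = (\<Union>i\<in>I. cls J (x * h i * y))"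
proof -
  have 1: "C \<otimes>\<^bsub>quot_alg J\<^esub> (\<Union>i\<in>I. D i) = (\<Union>i\<in>I. C \<otimes>\<^bsub>quot_alg J\<^esub> D i)"
    and 2: "(\<Union>i\<in>I. D i) \<otimes>\<^bsub>quot_alg J\<^esub> C = (\<Union>i\<in>I. D i \<otimes>\<^bsub>quot_alg J\<^esub> C)" for C D
    by (auto simp: quot_alg_simps(2))
  show ?thesis by (simp only: 1 2 quot_mult)
qed

end

section \<open>The isomorphism\<close>

lemma FoMpQUEA_simps:
  fixes A d P R
  defines "J \<equiv> uq_ideal A d P R"
  shows "carrier (FoMpQUEA A d P R) = carrier (quot_alg J)"
    "monoid.mult (FoMpQUEA A d P R) = monoid.mult (quot_alg J)"
    "one (FoMpQUEA A d P R) = one (quot_alg J)"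
    "add (FoMpQUEA A d P R) = add (quot_alg J)"
    "module.smult (FoMpQUEA A d P R) = module.smult (quot_alg J)"
    "tsquare (FoMpQUEA A d P R) = quot_alg (tens_ideal J)"
    "tens (FoMpQUEA A d P R) = (\<lambda>C D. \<Union>x\<in>C. \<Union>y\<in>D. cls (tens_ideal J) (ftens x y))"
    "comult (FoMpQUEA A d P R) = (\<lambda>C. \<Union>x\<in>C. cls (tens_ideal J) (free_comult R x))"
    "counit (FoMpQUEA A d P R) = (\<lambda>C. the_elem (free_counit ` C))"
  by (simp_all add: FoMpQUEA_def module.defs hopf.defs Let_def J_def free_comult_def)

lemma complete_subalgebra_gen_FoMpQUEA:
  "complete_subalgebra_gen (FoMpQUEA A d P R) = complete_subalgebra_gen (quot_alg (uq_ideal A d P R))"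
  by (simp add: fun_eq_iff complete_subalgebra_gen_def hadic_def hadic_open_def[abs_def] FoMpQUEA_simps)

definition tensor_gens where
  "tensor_gens A d P R S = {tens (FoMpQUEA A d P R) a b | a b.
     a \<in> complete_subalgebra_gen (quot_alg (uq_ideal A d P R)) S \<and>
     b \<in> complete_subalgebra_gen (quot_alg (uq_ideal A d P R)) S}"

lemma hopf_sub_simps:
  "carrier (hopf_sub K S) = complete_subalgebra_gen K S"
  "monoid.mult (hopf_sub K S) = monoid.mult K" "one (hopf_sub K S) = one K"
  "add (hopf_sub K S) = add K" "module.smult (hopf_sub K S) = module.smult K"
  "tsquare (hopf_sub K S) = (tsquare K)
     \<lparr>carrier := complete_subalgebra_gen (tsquare K) {tens K a b | a b.
        a \<in> complete_subalgebra_gen K S \<and> b \<in> complete_subalgebra_gen K S}\<rparr>"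
  "tens (hopf_sub K S) = tens K" "comult (hopf_sub K S) = comult K" "counit (hopf_sub K S) = counit K"
  by (cases K; simp add: hopf_sub_def Let_def)+

lemma hopf_sub_FoMpQUEA_simps:
  fixes A d P R S
  defines "J \<equiv> uq_ideal A d P R" and "H \<equiv> hopf_sub (FoMpQUEA A d P R) S"
  shows "carrier H = complete_subalgebra_gen (quot_alg J) S"
    "monoid.mult H = monoid.mult (quot_alg J)"
    "one H = one (quot_alg J)"
    "add H = add (quot_alg J)"
    "module.smult H = module.smult (quot_alg J)"
    "tsquare H = quot_alg (tens_ideal J)
       \<lparr>carrier := complete_subalgebra_gen (quot_alg (tens_ideal J)) (tensor_gens A d P R S)\<rparr>"
    "tens H = tens (FoMpQUEA A d P R)" "comult H = comult (FoMpQUEA A d P R)"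
    "counit H = counit (FoMpQUEA A d P R)"
  by (simp_all add: hopf_sub_simps J_def H_def FoMpQUEA_simps(1-6) complete_subalgebra_gen_FoMpQUEA tensor_gens_def)

lemma twist_hopf_simps:
  "carrier (twist_hopf K w) = carrier K" "monoid.mult (twist_hopf K w) = monoid.mult K"
  "one (twist_hopf K w) = one K" "add (twist_hopf K w) = add K"
  "module.smult (twist_hopf K w) = module.smult K" "tsquare (twist_hopf K w) = tsquare K"
  "tens (twist_hopf K w) = tens K" "counit (twist_hopf K w) = counit K"
  "comult (twist_hopf K w) x = w \<otimes>\<^bsub>tsquare K\<^esub> comult K x \<otimes>\<^bsub>tsquare K\<^esub> inv\<^bsub>tsquare K\<^esub> w"
  by (simp_all add: twist_hopf_def)

lemma sub_closed_hopf_sub: "sub_closed (hopf_sub K S)"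
  by (auto simp: sub_closed_def hopf_sub_simps complete_subalgebra_gen_eq closed_subalgebra_def)

lemma sub_closed_FoMpQUEA: "sub_closed (FoMpQUEA A d P R)"
  using mod_closed_ideal.sub_closed_quot[OF mod_closed_ideal.intro[OF is_closed_ideal_closed_ideal[of "uq_rels A d P R"]]]
  by (simp add: sub_closed_def FoMpQUEA_simps uq_ideal_def)

lemma (in uq_data) tens_cls: "tens (FoMpQUEA A d P R) (cls (uq_ideal A d P R) x) (cls (uq_ideal A d P R) y) =
    cls (tens_ideal (uq_ideal A d P R)) (ftens x y)"
proof -
  let ?J = "uq_ideal A d P R"
  have "(\<Union>a\<in>cls ?J x. \<Union>b\<in>cls ?J y. cls (tens_ideal ?J) (ftens a b)) =
      (\<Union>a\<in>cls ?J x. \<Union>b\<in>cls ?J y. cls (tens_ideal ?J) (ftens x y))"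
    by (intro SUP_cong refl) (simp add: K.cls_eq_iff J.cls_mem_iff ftens_eqv)
  also have "\<dots> = cls (tens_ideal ?J) (ftens x y)"
    using J.cls_mem_iff[of x x] J.cls_mem_iff[of y y] by auto
  finally show ?thesis by (simp add: FoMpQUEA_simps)
qed

context uq_twist
begin

abbreviation "JR \<equiv> uq_ideal A d P R"
abbreviation "JR' \<equiv> uq_ideal A d P' R'"
abbreviation "FF \<equiv> toral_twist A d P R H \<Phi>"

lemma toral_twist_eq: "FF = cls (tens_ideal JR) W"
  by (simp add: toral_twist_def toral_exponent_def)

lemma twist_elt_R': "twist_elt R' H \<Psi> = twist_elt R H \<Psi>" "twist_exponent R' H \<Psi> = twist_exponent R H \<Psi>"
  by (simp_all add: fun_eq_iff twist_elt_def twist_exponent_def R'_simps)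

lemma twist_map_R': "twist_map R' H \<Psi> = twist_map R H \<Psi>"
proof -
  have "twist_gen R' H \<Psi> x = twist_gen R H \<Psi> x" for x
    by (cases x) (simp_all add: twist_elt_R')
  then have "twist_gen R' H \<Psi> = twist_gen R H \<Psi>" by (rule ext)
  then show ?thesis by (simp add: twist_map_def)
qed

lemma uq_twist_inverse: "uq_twist d R' (- \<Phi>)"
proof (intro uq_twist.intro uq_data.intro uq_twist_axioms.intro)
  show "(- \<Phi>) $ k $ g = - (- \<Phi>) $ g $ k" for g k
    by (simp add: skew[of g k])
qed (simp_all only: R'_simps d_pos module_hscale root_hom)

lemma twist_elt_minus: "twist_elt R H (- \<Phi>) i = - M i"
  by (simp add: twist_elt_def hscale_minus sum_negf)

lemma twist_matrix_inverse: "twist_matrix P' R' H (- \<Phi>) = P"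
  by (simp add: vec_eq_iff uq_twist.twist_matrix_eq[OF uq_twist_inverse] twist_elt_R' R'_simps
    twist_elt_minus rootD twist_matrix_eq)

lemma twist_realization_inverse: "twist_realization R' H (- \<Phi>) = R"
proof -
  have "twist_shift R' H (- \<Phi>) i = - M i - M i" for i
    by (simp add: uq_twist.shift_eq[OF uq_twist_inverse] twist_elt_R' twist_elt_minus)
  then show ?thesis
    by (intro realization.equality) (simp_all add: fun_eq_iff twist_realization_def shift_eq)
qed

abbreviation "g \<equiv> twist_map R H (- \<Phi>)"

lemma fg: "f (g x) = x" "g (f x) = x"
  using twist_map_inverse[of R H \<Phi> x] twist_map_inverse[of R H "- \<Phi>" x] by simp_all

lemma tmap_fg: "tmap f (tmap g x) = x" "tmap g (tmap f x) = x"
  by (rule tmap_inverse; simp add: is_alg_homD(1)[OF alg_twist_map] fg)+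

lemma image_ideal: "f ` JR' = JR"
proof
  show "f ` JR' \<subseteq> JR" using f_ideal by blast
  have "g x \<in> JR'" if "x \<in> JR" for x
    using uq_twist.f_ideal[OF uq_twist_inverse, where A = A and P = P' and H = H and x = x] that
    by (simp add: twist_matrix_inverse twist_realization_inverse twist_map_R')
  then show "JR \<subseteq> f ` JR'" using fg(1) by (metis imageI subsetI)
qed

lemma image_tens_ideal: "tmap f ` tens_ideal JR' = tens_ideal JR"
proof
  show "tmap f ` tens_ideal JR' \<subseteq> tens_ideal JR" using f_tens_ideal by blast
  have "tmap g x \<in> tens_ideal JR'" if "x \<in> tens_ideal JR" for x
    using uq_twist.f_tens_ideal[OF uq_twist_inverse, where A = A and P = P' and H = H and x = x] that
    by (simp add: twist_matrix_inverse twist_realization_inverse twist_map_R')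
  then show "tens_ideal JR \<subseteq> tmap f ` tens_ideal JR'" using tmap_fg(1) by (metis imageI subsetI)
qed

lemma image_f_cls: "f ` cls JR' x = cls JR (f x)"
  by (simp add: image_cls[OF is_alg_homD(1)[OF alg_twist_map]] image_ideal)

lemma image_tmap_cls: "tmap f ` cls (tens_ideal JR') x = cls (tens_ideal JR) (tmap f x)"
  by (simp add: image_cls[OF lin_tmap] image_tens_ideal)

lemma mod_bij_f: "mod_bij (quot_alg JR') (quot_alg JR) (image f)"
  using quot_alg_mod_bij[of f g JR', OF alg_twist_map fg] by (simp add: image_ideal)

lemma mod_bij_tmap: "mod_bij (quot_alg (tens_ideal JR')) (quot_alg (tens_ideal JR)) (image (tmap f))"
  using quot_alg_mod_bij[of "tmap f" "tmap g" "tens_ideal JR'", OF alg_tmap[OF alg_twist_map] tmap_fg]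
  by (simp add: image_tens_ideal)

lemma image_tens: "tmap f ` tens (FoMpQUEA A d P' R') C D = tens (FoMpQUEA A d P R) (f ` C) (f ` D)"
  by (simp add: FoMpQUEA_simps image_UN image_tmap_cls tmap_ftens[OF is_alg_homD(1)[OF alg_twist_map]])

lemma image_counit: "counit (FoMpQUEA A d P R) (f ` C) = counit (FoMpQUEA A d P' R') C"
  by (simp add: FoMpQUEA_simps image_image free_counit_twist_map)

text \<open>The inverse of the twist is written out as a coset, since \<open>m_inv\<close> is
  computed in different carriers for the full algebra and for its Borel parts.\<close>

lemma image_comult:
  "tmap f ` comult (FoMpQUEA A d P' R') C =
    FF \<otimes>\<^bsub>quot_alg (tens_ideal JR)\<^esub> comult (FoMpQUEA A d P R) (f ` C) \<otimes>\<^bsub>quot_alg (tens_ideal JR)\<^esub> cls (tens_ideal JR) (hexp (- Z))"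
proof -
  have "tmap f ` comult (FoMpQUEA A d P' R') C = (\<Union>x\<in>C. cls (tens_ideal JR) (tmap f (free_comult R' x)))"
    by (simp add: FoMpQUEA_simps image_UN image_tmap_cls)
  also have "\<dots> = (\<Union>x\<in>C. cls (tens_ideal JR) (W * free_comult R (f x) * hexp (- Z)))"
    by (intro SUP_cong refl) (simp add: K.cls_eq_iff comult_twist_inverse)
  also have "\<dots> = FF \<otimes>\<^bsub>quot_alg (tens_ideal JR)\<^esub> comult (FoMpQUEA A d P R) (f ` C) \<otimes>\<^bsub>quot_alg (tens_ideal JR)\<^esub> cls (tens_ideal JR) (hexp (- Z))"
    by (simp add: toral_twist_eq FoMpQUEA_simps K.quot_mult_UN)
  finally show ?thesis .
qed

lemma hopf_bij_full:
  "hopf_bij (FoMpQUEA A d P' R') (twist_hopf (FoMpQUEA A d P R) FF) (image f) (image (tmap f))"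
proof -
  have inv: "inv\<^bsub>quot_alg (tens_ideal JR)\<^esub> FF = cls (tens_ideal JR) (hexp (- Z))"
    unfolding toral_twist_eq
    by (rule K.quot_inv) (simp_all add: quot_alg_simps(1) hexp_minus_inverse)
  show ?thesis
    using mod_bij_f mod_bij_tmap image_tens image_comult image_counit
    by (simp add: hopf_bij_def twist_hopf_simps mod_bij_def FoMpQUEA_simps(1-6) inv)
qed

lemma image_uq: "f ` uq A d P' R' x = cls JR (f (gen x))"
  by (simp add: uq_def image_f_cls)

lemma exponent_preimage_gen: "(\<And>T. tor T \<in> J.preimage_gen S) \<Longrightarrow> l i \<in> J.preimage_gen S"
  unfolding twist_exponent_def by (intro closed_submodule_sum closed_submodule_scal J.closed_submodule_preimage_gen)

text \<open>Each twisted generator differs from the original one by an exponential of torus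
  elements, and \<open>G\<close> contains all of \<open>Tor\<close>. That exponential and its
  inverse lie in either subalgebra, whence both inclusions.\<close>

lemma subalgebra_image:
  assumes G: "range Tor \<subseteq> G"
  shows "image f ` complete_subalgebra_gen (quot_alg JR') (uq A d P' R' ` G) =
    complete_subalgebra_gen (quot_alg JR) (uq A d P R ` G)"
proof -
  let ?S = "uq A d P R ` G" and ?S' = "image f ` uq A d P' R' ` G"
  have S: "gen x \<in> J.preimage_gen ?S" if "x \<in> G" for x
    using that by (intro J.preimage_gen_base) (simp add: uq_def)
  have S': "f (gen x) \<in> J.preimage_gen ?S'" if "x \<in> G" for x
    using that by (intro J.preimage_gen_base) (simp add: image_image image_uq del: twist_map_gen)
  have lS: "l i \<in> J.preimage_gen ?S" for i
    using G by (intro exponent_preimage_gen S) auto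
  have lS': "l i \<in> J.preimage_gen ?S'" for i
    using G S'[of "Tor _"] by (intro exponent_preimage_gen) auto
  have "?S' \<subseteq> complete_subalgebra_gen (quot_alg JR) ?S"
  proof -
    have "f (gen x) \<in> J.preimage_gen ?S" if "x \<in> G" for x
      using S[OF that] by (cases x) (auto intro!: J.preimage_gen_mult J.preimage_gen_hexp lS)
    then show ?thesis by (auto simp: image_uq J.preimage_gen_def simp del: twist_map_gen)
  qed
  moreover have "?S \<subseteq> complete_subalgebra_gen (quot_alg JR) ?S'"
  proof -
    have "gen x \<in> J.preimage_gen ?S'" if x: "x \<in> G" for x
    proof (cases x)
      case (Tor T)
      then show ?thesis using S'[OF x] by simp
    next
      case (E i)
      have "hexp (- l i) * f (gen (E i)) \<in> J.preimage_gen ?S'"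
        using S'[OF x] E by (intro J.preimage_gen_mult J.preimage_gen_hexp closed_submodule_uminus J.closed_submodule_preimage_gen lS') simp
      then show ?thesis using E by (simp add: hexp_minus_inverse flip: mult.assoc)
    next
      case (F i)
      have "f (gen (F i)) * hexp (- l i) \<in> J.preimage_gen ?S'"
        using S'[OF x] F by (intro J.preimage_gen_mult J.preimage_gen_hexp closed_submodule_uminus J.closed_submodule_preimage_gen lS') simp
      then show ?thesis using F by (simp add: hexp_minus_inverse mult.assoc)
    qed
    then show ?thesis by (auto simp: uq_def J.preimage_gen_def)
  qed
  ultimately show ?thesis
    unfolding complete_subalgebra_gen_image[OF mod_bij_f]
    by (intro subset_antisym complete_subalgebra_gen_mono)
qed

lemma tensor_gens_image:
  assumes G: "range Tor \<subseteq> G"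
  shows "image (tmap f) ` tensor_gens A d P' R' (uq A d P' R' ` G) = tensor_gens A d P R (uq A d P R ` G)"
proof
  let ?B = "complete_subalgebra_gen (quot_alg JR') (uq A d P' R' ` G)"
  show "image (tmap f) ` tensor_gens A d P' R' (uq A d P' R' ` G) \<subseteq> tensor_gens A d P R (uq A d P R ` G)"
    unfolding tensor_gens_def subalgebra_image[OF G, symmetric] by (force simp: image_tens)
  show "tensor_gens A d P R (uq A d P R ` G) \<subseteq> image (tmap f) ` tensor_gens A d P' R' (uq A d P' R' ` G)"
  proof
    fix t assume "t \<in> tensor_gens A d P R (uq A d P R ` G)"
    then obtain a b where "a \<in> ?B" "b \<in> ?B" "t = tens (FoMpQUEA A d P R) (f ` a) (f ` b)"
      unfolding tensor_gens_def subalgebra_image[OF G, symmetric] by blast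
    then show "t \<in> image (tmap f) ` tensor_gens A d P' R' (uq A d P' R' ` G)"
      unfolding tensor_gens_def image_tens[symmetric] by blast
  qed
qed

lemma hopf_bij_sub:
  assumes G: "range Tor \<subseteq> G"
  shows "hopf_bij (hopf_sub (FoMpQUEA A d P' R') (uq A d P' R' ` G))
    (twist_hopf (hopf_sub (FoMpQUEA A d P R) (uq A d P R ` G)) FF) (image f) (image (tmap f))"
proof -
  let ?S = "uq A d P R ` G"
  let ?T = "complete_subalgebra_gen (quot_alg (tens_ideal JR)) (tensor_gens A d P R ?S)"
  have range: "?T \<subseteq> range (cls (tens_ideal JR))"
  proof (rule K.complete_subalgebra_gen_range)
    have "?S \<subseteq> range (cls JR)" by (auto simp: uq_def)
    note rng = J.complete_subalgebra_gen_range[OF this]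
    show "tensor_gens A d P R ?S \<subseteq> range (cls (tens_ideal JR))"
    proof
      fix t assume "t \<in> tensor_gens A d P R ?S"
      then obtain a b where "a \<in> complete_subalgebra_gen (quot_alg JR) ?S"
          "b \<in> complete_subalgebra_gen (quot_alg JR) ?S" and t: "t = tens (FoMpQUEA A d P R) a b"
        unfolding tensor_gens_def by blast
      then obtain x y where "a = cls JR x" "b = cls JR y"
        using subsetD[OF rng, of a] subsetD[OF rng, of b] by auto
      then show "t \<in> range (cls (tens_ideal JR))" by (simp add: t tens_cls)
    qed
  qed
  \<comment> \<open>This places \<open>- Z\<close>, and then the exponential of it, in the
    restricted tensor square, so that the inverse of the twist there is the same coset as in the
    full one.\<close>
  have "ftens (tor S) (tor T) \<in> K.preimage_gen (tensor_gens A d P R ?S)" for S T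
  proof (rule K.preimage_gen_base)
    have "cls JR (tor T) \<in> complete_subalgebra_gen (quot_alg JR) ?S" for T
      using G by (intro subsetD[OF complete_subalgebra_gen_superset]) (auto simp flip: uq_def)
    then show "cls (tens_ideal JR) (ftens (tor S) (tor T)) \<in> tensor_gens A d P R ?S"
      unfolding tensor_gens_def tens_cls[symmetric] by blast
  qed
  then have "- Z \<in> K.preimage_gen (tensor_gens A d P R ?S)"
    unfolding toral_exponent_def by (intro closed_submodule_uminus closed_submodule_sum closed_submodule_scal K.closed_submodule_preimage_gen)
  then have W': "cls (tens_ideal JR) (hexp (- Z)) \<in> ?T"
    using K.preimage_gen_hexp by (auto simp: K.preimage_gen_def)
  have inv: "inv\<^bsub>quot_alg (tens_ideal JR)\<lparr>carrier := ?T\<rparr>\<^esub> FF = cls (tens_ideal JR) (hexp (- Z))"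
    unfolding toral_twist_eq
    by (rule K.quot_inv) (use range W' in \<open>simp_all add: hexp_minus_inverse\<close>)
  have "mod_bij (hopf_sub (FoMpQUEA A d P' R') (uq A d P' R' ` G)) (hopf_sub (FoMpQUEA A d P R) ?S) (image f)"
    using mod_bij_f subalgebra_image[OF G] by (simp add: mod_bij_def hopf_sub_FoMpQUEA_simps)
  moreover have "mod_bij (tsquare (hopf_sub (FoMpQUEA A d P' R') (uq A d P' R' ` G)))
      (tsquare (hopf_sub (FoMpQUEA A d P R) ?S)) (image (tmap f))"
    using mod_bij_tmap complete_subalgebra_gen_image[OF mod_bij_tmap] tensor_gens_image[OF G]
    by (simp add: mod_bij_def hopf_sub_FoMpQUEA_simps)
  ultimately show ?thesis
    using image_tens image_comult image_counit
    by (simp add: hopf_bij_def twist_hopf_simps mod_bij_def hopf_sub_FoMpQUEA_simps inv)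
qed

lemma twisted_E_eq: "twisted_E A d P R H \<Phi> i = f ` uq A d P' R' (E i)"
proof -
  have "twist_L A d P R H \<Phi> i = cls JR (hexp (- l i))"
    by (simp add: twist_L_def twist_exponent_def scal_minus sum_negf)
  moreover have "inv\<^bsub>FoMpQUEA A d P R\<^esub> (cls JR (hexp (- l i))) = cls JR (hexp (l i))"
    by (rule J.quot_inv) (simp_all add: FoMpQUEA_simps quot_alg_simps(1) hexp_minus_inverse)
  ultimately show ?thesis
    by (simp add: twisted_E_def uq_def image_f_cls FoMpQUEA_simps(2) J.quot_mult)
qed

lemma twisted_F_eq: "twisted_F A d P R H \<Phi> i = f ` uq A d P' R' (F i)"
proof -
  have "fps_const (1/2) * root R i (H g) * \<Phi> $ k $ g = - (fps_const (1/2) * root R i (H g) * \<Phi> $ g $ k)" for g k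
    by (simp add: skew[of g k])
  then have "twist_K A d P R H \<Phi> i = cls JR (hexp (l i))"
    by (simp only: twist_K_def twist_exponent_def)
  then show ?thesis
    by (simp add: twisted_F_def uq_def image_f_cls FoMpQUEA_simps(2) J.quot_mult)
qed

lemma uq_Tor_eq: "uq A d P R (Tor T) = f ` uq A d P' R' (Tor T)"
  by (simp add: image_uq) (simp add: uq_def)

text \<open>The shifts of the two vectors cancel in \<open>Tmean\<close>, so the independence
  condition is unchanged. The values of the roots on the minus vectors fit by
  \<open>root_skew\<close>.\<close>

lemma is_realization_twist:
  assumes "is_realization P R" shows "is_realization P' R'"
proof -
  have "- (2 * root R j (M i)) = 2 * root R i (M j)" for i j
    by (simp add: root_skew[of j i])
  then show ?thesis
    using assms
    by (simp add: is_realization_def R'_simps has_rank_def Tmean_def twist_matrix_eq rootD)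
qed

lemma cartan_type_twist:
  assumes "cartan_type A d P" shows "cartan_type A d P'"
proof -
  have "P' $ i $ j + P' $ j $ i = P $ i $ j + P $ j $ i" for i j
    by (simp add: twist_matrix_eq root_skew[of j i])
  then have "P' + transpose P' = P + transpose P"
    by (simp add: vec_eq_iff transpose_def)
  then show ?thesis using assms by (simp add: cartan_type_def)
qed

lemma top_hopf_iso_full: "top_hopf_iso (FoMpQUEA A d P' R') (twist_hopf (FoMpQUEA A d P R) FF) (image f)"
  by (rule hopf_bij_top_hopf_iso[OF hopf_bij_full sub_closed_FoMpQUEA])

lemma top_hopf_iso_borel:
  "top_hopf_iso (FoMpQUEA_bplus A d P' R') (twist_hopf (FoMpQUEA_bplus A d P R) FF) (image f)"
  "top_hopf_iso (FoMpQUEA_bminus A d P' R') (twist_hopf (FoMpQUEA_bminus A d P R) FF) (image f)"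
  unfolding FoMpQUEA_bplus_def FoMpQUEA_bminus_def
  by (rule hopf_bij_top_hopf_iso[OF hopf_bij_sub sub_closed_hopf_sub], blast)+

end

theorem theorem5p1p4:
  fixes A :: "int^'i::finite^'i" and d :: "'i \<Rightarrow> nat"
    and P :: "('k::field_char_0) fps^'i^'i"
    and R :: "('k, 'h::ab_group_add, 'i) realization"
    and H :: "'g::finite \<Rightarrow> 'h" and \<Phi> :: "'k fps^'g^'g"
  assumes "symmetrizable_gcm A d"
    and "cartan_type A d P"
    and "is_realization P R"
    and "is_basis R H"
    and "transpose \<Phi> = - \<Phi>"
  shows
    "let P' = twist_matrix P R H \<Phi>; R' = twist_realization R H \<Phi>;
         FF = toral_twist A d P R H \<Phi>
     in
       (\<exists>f. top_hopf_iso (FoMpQUEA A d P' R') (twist_hopf (FoMpQUEA A d P R) FF) f \<and>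
         (\<forall>i. f (uq A d P' R' (E i)) = twisted_E A d P R H \<Phi> i) \<and>
         (\<forall>T. f (uq A d P' R' (Tor T)) = uq A d P R (Tor T)) \<and>
         (\<forall>i. f (uq A d P' R' (F i)) = twisted_F A d P R H \<Phi> i)) \<and>
       (\<exists>f. top_hopf_iso (FoMpQUEA_bplus A d P' R') (twist_hopf (FoMpQUEA_bplus A d P R) FF) f \<and>
         (\<forall>i. f (uq A d P' R' (E i)) = twisted_E A d P R H \<Phi> i) \<and>
         (\<forall>T. f (uq A d P' R' (Tor T)) = uq A d P R (Tor T))) \<and>
       (\<exists>f. top_hopf_iso (FoMpQUEA_bminus A d P' R') (twist_hopf (FoMpQUEA_bminus A d P R) FF) f \<and>
         (\<forall>T. f (uq A d P' R' (Tor T)) = uq A d P R (Tor T)) \<and>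
         (\<forall>i. f (uq A d P' R' (F i)) = twisted_F A d P R H \<Phi> i)) \<and>
       (\<forall>W \<in> {FoMpQUEA, FoMpQUEA_bplus, FoMpQUEA_bminus}. \<forall>t. has_rank R t \<longrightarrow>
         in_FoMpQUEA_class W A d (\<lambda>Q. has_rank Q t) (twist_hopf (W A d P R) FF) \<and>
         (straight R \<longrightarrow>
            in_FoMpQUEA_class W A d (\<lambda>Q. has_rank Q t \<and> straight Q)
              (twist_hopf (W A d P R) FF)) \<and>
         (small R \<and>
          (\<forall>l. twist_shift R H \<Phi> l \<in> Modules.module.span (hscale R) (range (Tmean R))) \<longrightarrow>
            in_FoMpQUEA_class W A d (\<lambda>Q. has_rank Q t \<and> small Q)
              (twist_hopf (W A d P R) FF)))"
proof -
  let ?P = "twist_matrix P R H \<Phi>" and ?R = "twist_realization R H \<Phi>"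
    and ?w = "toral_twist A d P R H \<Phi>" and ?f = "image (twist_map R H \<Phi>)"
  interpret uq_twist A d P R H \<Phi>
  proof (intro uq_twist.intro uq_data.intro uq_twist_axioms.intro)
    show "0 < d i" for i using assms(1) by (simp add: symmetrizable_gcm_def)
    show "Modules.module (hscale R)" "Modules.module_hom (hscale R) (*) (root R i)" for i
      using assms(3) by (simp_all add: is_realization_def)
    show "\<Phi> $ k $ g = - \<Phi> $ g $ k" for g k
      using arg_cong[OF assms(5), of "\<lambda>A. A $ g $ k"] by (simp add: transpose_def)
  qed
  have iso: "top_hopf_iso (V A d ?P ?R) (twist_hopf (V A d P R) ?w) ?f"
    if "V \<in> {FoMpQUEA, FoMpQUEA_bplus, FoMpQUEA_bminus}" for V
    using that top_hopf_iso_full top_hopf_iso_borel by auto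
  have cls: "in_FoMpQUEA_class V A d Q (twist_hopf (V A d P R) ?w)"
    if "V \<in> {FoMpQUEA, FoMpQUEA_bplus, FoMpQUEA_bminus}" "Q ?R" for V Q
    unfolding in_FoMpQUEA_class_def
    using iso[OF that(1)] cartan_type_twist[OF assms(2)] is_realization_twist[OF assms(3)] that(2) by blast
  \<comment> \<open>Rank and straightness involve only the module and the roots, which the twist
    does not change.\<close>
  have rank: "has_rank ?R t \<longleftrightarrow> has_rank R t" and straight: "straight ?R \<longleftrightarrow> straight R" for t
    by (simp_all add: has_rank_def straight_def R'_simps)
  show ?thesis
    unfolding Let_def
  proof (intro conjI ballI allI impI)
    show "\<exists>f. top_hopf_iso (FoMpQUEA A d ?P ?R) (twist_hopf (FoMpQUEA A d P R) ?w) f \<and>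
         (\<forall>i. f (uq A d ?P ?R (E i)) = twisted_E A d P R H \<Phi> i) \<and>
         (\<forall>T. f (uq A d ?P ?R (Tor T)) = uq A d P R (Tor T)) \<and>
         (\<forall>i. f (uq A d ?P ?R (F i)) = twisted_F A d P R H \<Phi> i)"
      using iso by (intro exI[of _ ?f]) (simp add: twisted_E_eq twisted_F_eq uq_Tor_eq)
    show "\<exists>f. top_hopf_iso (FoMpQUEA_bplus A d ?P ?R) (twist_hopf (FoMpQUEA_bplus A d P R) ?w) f \<and>
         (\<forall>i. f (uq A d ?P ?R (E i)) = twisted_E A d P R H \<Phi> i) \<and>
         (\<forall>T. f (uq A d ?P ?R (Tor T)) = uq A d P R (Tor T))"
      using iso by (intro exI[of _ ?f]) (simp add: twisted_E_eq uq_Tor_eq)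
    show "\<exists>f. top_hopf_iso (FoMpQUEA_bminus A d ?P ?R) (twist_hopf (FoMpQUEA_bminus A d P R) ?w) f \<and>
         (\<forall>T. f (uq A d ?P ?R (Tor T)) = uq A d P R (Tor T)) \<and>
         (\<forall>i. f (uq A d ?P ?R (F i)) = twisted_F A d P R H \<Phi> i)"
      using iso by (intro exI[of _ ?f]) (simp add: twisted_F_eq uq_Tor_eq)
  next
    fix V :: "int^'i^'i \<Rightarrow> ('i \<Rightarrow> nat) \<Rightarrow> 'k fps^'i^'i \<Rightarrow> ('k, 'h, 'i) realization \<Rightarrow> ('k, 'h, 'i) uqhopf" and t
    assume V: "V \<in> {FoMpQUEA, FoMpQUEA_bplus, FoMpQUEA_bminus}" and t: "has_rank R t"
    show "in_FoMpQUEA_class V A d (\<lambda>Q. has_rank Q t) (twist_hopf (V A d P R) ?w)"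
      using t by (intro cls V) (simp add: rank)
    show "in_FoMpQUEA_class V A d (\<lambda>Q. has_rank Q t \<and> straight Q) (twist_hopf (V A d P R) ?w)" if "straight R"
      using t that by (intro cls V) (simp add: rank straight)
    show "in_FoMpQUEA_class V A d (\<lambda>Q. has_rank Q t \<and> small Q) (twist_hopf (V A d P R) ?w)"
      if "small R \<and> (\<forall>l. twist_shift R H \<Phi> l \<in> Modules.module.span (hscale R) (range (Tmean R)))"
      using t that small_twist_realization_iff[OF module_hscale, of H \<Phi>] by (intro cls V) (simp add: rank)
  qed
qed

end
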